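(* There are equivalences of $\mathsf{Pos}$-enriched categories $\mathsf{Pries}_{ex/reg}\simeq\mathsf{Nach}\simeq\mathsf{Stone}_{ex/reg}$.
   Context: An ordered topological space is a triple $(X,\tau,\leq)$ with $\tau$ a topology and $\leq$ a partial order on $X$. A Nachbin space is an ordered topological space with $(X,\tau)$ compact and $\leq$ closed in $X\times X$. $\mathsf{Nach}$ is the category of Nachbin spaces and continuous order-preserving functions, with hom-sets ordered pointwise. A Priestley space is an ordered topological space with $(X,\tau)$ compact such that whenever $x\nleq y$ there is a clopen upper set $U$ with $x\in U$, $y\notin U$; $\mathsf{Pries}$ is the full subcategory of $\mathsf{Nach}$ on the Priestley spaces. $\mathsf{Stone}$ is the category of Stone spaces and continuous maps, with discretely ordered hom-sets (equivalently, the full subcategory of $\mathsf{Pries}$ on objects with discrete order). $\mathsf{Pries}$ and $\mathsf{Stone}$ are regular in the enriched sense below. For a regular $\mathsf{Pos}$-category $\mathcal{E}$, $\mathcal{E}_{ex/reg}$ denotes its ($\mathsf{Pos}$-enriched) exact completion, defined as follows. All categories are enriched over the cartesian closed category $\mathsf{Pos}$ of posets and monotone maps (hom-sets are posets, composition is monotone). Limits are weighted ($\mathsf{Pos}$-enriched); in particular the projections of products and pullbacks are jointly order-monomorphic, where a family $(p_i)$ with common domain is jointly order-monomorphic if $p_iu\le p_iv$ for all $i$ implies $u\le v$. A morphism $m\colon X\to Y$ is an $\mathsf{ff}$-morphism if $mf\le mg$ implies $f\le g$. A morphism $e\colon A\to B$ of $\mathcal{C}$ is an $\mathsf{so}$-morphism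 if for every $\mathsf{ff}$-morphism $m\colon X\to Y$ the canonical square from $\mathcal{C}(B,X)$ to $\mathcal{C}(A,X)$, $\mathcal{C}(B,Y)$ over $\mathcal{C}(A,Y)$ is a pullback in $\mathsf{Pos}$. A category is regular if it has all finite weighted limits, every morphism factors as an $\mathsf{so}$-morphism followed by an $\mathsf{ff}$-morphism, and $\mathsf{so}$-morphisms are stable under pullback. A relation $R\colon X\looparrowright Y$ in a regular category is a subobject of $X\times Y$ represented by an $\mathsf{ff}$-morphism $\langle r_0,r_1\rangle\colon R\rightarrowtail X\times Y$; relations are ordered by inclusion. Write $(x,y)\in_A R$ if $\langle x,y\rangle\colon A\to X\times Y$ factors through $\langle r_0,r_1\rangle$. The composite $SR\colon X\looparrowright Z$ of $R\colon X\looparrowright Y$ and $S\colon Y\looparrowright Z$ is the $\mathsf{ff}$-part of the $(\mathsf{so},\mathsf{ff})$-factorization of $\langle r_0t_0,s_1t_1\rangle$, where $(T,t_0,t_1)$ is the pullback of $r_1$ and $s_0$. $R$ is weakening-closed if $x'\le x$, $(x,y)\in_A R$, $y\le y'$ imply $(x',y')\in_A R$. A congruence on $X$ is a weakening-closed relation $E\colon X\looparrowright X$ that is reflexive and transitive. $Q_w(\mathcal{E})$ is the locally posetal bicategory with objects the pairs $(X,E)$, $E$ a congruence on $X\in\mathcal{E}$; morphisms $(X,E)\to(Y,F)$ the relations $\Phi\colon X\looparrowright Y$ in $\mathcal{E}$ with $F\Phi E=\Phi$, ordered by inclusion; composition that of relations; identity on $(X,E)$ the relation $E$. $\mathcal{E}_{ex/reg}$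 has the same objects; its morphisms $(X,E)\to(Y,F)$ are the morphisms $R_*$ of $Q_w(\mathcal{E})$ having a right adjoint, i.e. for which there is $R^*\colon(Y,F)\to(X,E)$ in $Q_w(\mathcal{E})$ with $R^*R_*\supseteq E$ and $R_*R^*\subseteq F$; the order is $R_*\le S_*:\iff R_*\supseteq S_*$. *)

theory Defs
  imports "HOL-Analysis.Analysis"
begin

section \<open>Categories enriched over posets\<close>

text \<open>
  Categories are presented in the style of enriched category theory: homs are indexed by pairs of
  objects, and composition \<open>Comp C X Y Z g f\<close> of \<open>f\<close> from \<open>X\<close> to \<open>Y\<close> with \<open>g\<close> from \<open>Y\<close> to \<open>Z\<close>
  takes the three objects as arguments, so that a morphism need not carry its domain and codomain.
\<close>

record ('o, 'm) poscat =
  Obj :: "'o set"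
  Hom :: "'o \<Rightarrow> 'o \<Rightarrow> 'm set"
  Ident :: "'o \<Rightarrow> 'm"
  Comp :: "'o \<Rightarrow> 'o \<Rightarrow> 'o \<Rightarrow> 'm \<Rightarrow> 'm \<Rightarrow> 'm"
  Le :: "'o \<Rightarrow> 'o \<Rightarrow> 'm \<Rightarrow> 'm \<Rightarrow> bool"

locale pos_category =
  fixes C :: "('o, 'm) poscat"
  assumes Ident_in: "X \<in> Obj C \<Longrightarrow> Ident C X \<in> Hom C X X"
    and Comp_in: "\<lbrakk>X \<in> Obj C; Y \<in> Obj C; Z \<in> Obj C; f \<in> Hom C X Y; g \<in> Hom C Y Z\<rbrakk>
      \<Longrightarrow> Comp C X Y Z g f \<in> Hom C X Z"
    and Comp_Ident_left: "\<lbrakk>X \<in> Obj C; Y \<in> Obj C; f \<in> Hom C X Y\<rbrakk>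
      \<Longrightarrow> Comp C X Y Y (Ident C Y) f = f"
    and Comp_Ident_right: "\<lbrakk>X \<in> Obj C; Y \<in> Obj C; f \<in> Hom C X Y\<rbrakk>
      \<Longrightarrow> Comp C X X Y f (Ident C X) = f"
    and Comp_assoc: "\<lbrakk>W \<in> Obj C; X \<in> Obj C; Y \<in> Obj C; Z \<in> Obj C;
        f \<in> Hom C W X; g \<in> Hom C X Y; h \<in> Hom C Y Z\<rbrakk>
      \<Longrightarrow> Comp C W Y Z h (Comp C W X Y g f) = Comp C W X Z (Comp C X Y Z h g) f"
    and Le_refl: "\<lbrakk>X \<in> Obj C; Y \<in> Obj C; f \<in> Hom C X Y\<rbrakk> \<Longrightarrow> Le C X Y f f"
    and Le_trans: "\<lbrakk>X \<in> Obj C; Y \<in> Obj C; f \<in> Hom C X Y; g \<in> Hom C X Y; h \<in> Hom C X Y;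
        Le C X Y f g; Le C X Y g h\<rbrakk> \<Longrightarrow> Le C X Y f h"
    and Le_antisym: "\<lbrakk>X \<in> Obj C; Y \<in> Obj C; f \<in> Hom C X Y; g \<in> Hom C X Y;
        Le C X Y f g; Le C X Y g f\<rbrakk> \<Longrightarrow> f = g"
    and Comp_mono: "\<lbrakk>X \<in> Obj C; Y \<in> Obj C; Z \<in> Obj C; f \<in> Hom C X Y; f' \<in> Hom C X Y;
        g \<in> Hom C Y Z; g' \<in> Hom C Y Z; Le C X Y f f'; Le C Y Z g g'\<rbrakk>
      \<Longrightarrow> Le C X Z (Comp C X Y Z g f) (Comp C X Y Z g' f')"

definition pos_functor ::
    "('o, 'm) poscat \<Rightarrow> ('p, 'n) poscat \<Rightarrow> ('o \<Rightarrow> 'p) \<Rightarrow> ('o \<Rightarrow> 'o \<Rightarrow> 'm \<Rightarrow> 'n) \<Rightarrow> bool" where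
  "pos_functor C D Fo Fm \<longleftrightarrow>
    (\<forall>X\<in>Obj C. Fo X \<in> Obj D \<and> Fm X X (Ident C X) = Ident D (Fo X)) \<and>
    (\<forall>X\<in>Obj C. \<forall>Y\<in>Obj C. \<forall>f\<in>Hom C X Y. Fm X Y f \<in> Hom D (Fo X) (Fo Y)) \<and>
    (\<forall>X\<in>Obj C. \<forall>Y\<in>Obj C. \<forall>Z\<in>Obj C. \<forall>f\<in>Hom C X Y. \<forall>g\<in>Hom C Y Z.
      Fm X Z (Comp C X Y Z g f) = Comp D (Fo X) (Fo Y) (Fo Z) (Fm Y Z g) (Fm X Y f)) \<and>
    (\<forall>X\<in>Obj C. \<forall>Y\<in>Obj C. \<forall>f\<in>Hom C X Y. \<forall>g\<in>Hom C X Y.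
      Le C X Y f g \<longrightarrow> Le D (Fo X) (Fo Y) (Fm X Y f) (Fm X Y g))"

definition is_iso :: "('o, 'm) poscat \<Rightarrow> 'o \<Rightarrow> 'o \<Rightarrow> 'm \<Rightarrow> bool" where
  "is_iso C X Y f \<longleftrightarrow> f \<in> Hom C X Y \<and>
    (\<exists>g\<in>Hom C Y X. Comp C X Y X g f = Ident C X \<and> Comp C Y X Y f g = Ident C Y)"

definition naturally_isomorphic ::
    "('o, 'm) poscat \<Rightarrow> ('p, 'n) poscat \<Rightarrow> ('o \<Rightarrow> 'p) \<Rightarrow> ('o \<Rightarrow> 'o \<Rightarrow> 'm \<Rightarrow> 'n)
      \<Rightarrow> ('o \<Rightarrow> 'p) \<Rightarrow> ('o \<Rightarrow> 'o \<Rightarrow> 'm \<Rightarrow> 'n) \<Rightarrow> bool" where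
  "naturally_isomorphic C D Fo Fm Go Gm \<longleftrightarrow> (\<exists>\<eta>.
    (\<forall>X\<in>Obj C. is_iso D (Fo X) (Go X) (\<eta> X)) \<and>
    (\<forall>X\<in>Obj C. \<forall>Y\<in>Obj C. \<forall>f\<in>Hom C X Y.
      Comp D (Fo X) (Fo Y) (Go Y) (\<eta> Y) (Fm X Y f) =
      Comp D (Fo X) (Go X) (Go Y) (Gm X Y f) (\<eta> X)))"

definition pos_equivalent :: "('o, 'm) poscat \<Rightarrow> ('p, 'n) poscat \<Rightarrow> bool" where
  "pos_equivalent C D \<longleftrightarrow> pos_category C \<and> pos_category D \<and>
    (\<exists>Fo Fm Go Gm. pos_functor C D Fo Fm \<and> pos_functor D C Go Gm \<and>
      naturally_isomorphic C C (\<lambda>X. Go (Fo X)) (\<lambda>X Y f. Gm (Fo X) (Fo Y) (Fm X Y f))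
        (\<lambda>X. X) (\<lambda>X Y f. f) \<and>
      naturally_isomorphic D D (\<lambda>X. Fo (Go X)) (\<lambda>X Y f. Fm (Go X) (Go Y) (Gm X Y f))
        (\<lambda>X. X) (\<lambda>X Y f. f))"


section \<open>Factorizations and limits\<close>

definition ff_morphism :: "('o, 'm) poscat \<Rightarrow> 'o \<Rightarrow> 'o \<Rightarrow> 'm \<Rightarrow> bool" where
  "ff_morphism C X Y m \<longleftrightarrow> m \<in> Hom C X Y \<and>
    (\<forall>A\<in>Obj C. \<forall>f\<in>Hom C A X. \<forall>g\<in>Hom C A X.
      Le C A Y (Comp C A X Y m f) (Comp C A X Y m g) \<longrightarrow> Le C A X f g)"

text \<open>
  The square for \<open>e\<close> and \<open>m\<close> is a pullback of posets iff sending \<open>h\<close> to the pair of composites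
  \<open>(h e, m h)\<close> is an order isomorphism from \<open>Hom C B X\<close> onto the poset of commutative squares
  \<open>m u = v e\<close>, ordered componentwise.
\<close>

definition so_morphism :: "('o, 'm) poscat \<Rightarrow> 'o \<Rightarrow> 'o \<Rightarrow> 'm \<Rightarrow> bool" where
  "so_morphism C A B e \<longleftrightarrow> e \<in> Hom C A B \<and>
    (\<forall>X\<in>Obj C. \<forall>Y\<in>Obj C. \<forall>m. ff_morphism C X Y m \<longrightarrow>
      bij_betw (\<lambda>h. (Comp C A B X h e, Comp C B X Y m h)) (Hom C B X)
        {(u, v). u \<in> Hom C A X \<and> v \<in> Hom C B Y \<and> Comp C A X Y m u = Comp C A B Y v e} \<and>
      (\<forall>h\<in>Hom C B X. \<forall>h'\<in>Hom C B X.
        Le C B X h h' \<longleftrightarrow>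
          Le C A X (Comp C A B X h e) (Comp C A B X h' e) \<and>
          Le C B Y (Comp C B X Y m h) (Comp C B X Y m h')))"

definition jointly_order_monic ::
    "('o, 'm) poscat \<Rightarrow> 'o \<Rightarrow> 'o \<Rightarrow> 'o \<Rightarrow> 'm \<Rightarrow> 'm \<Rightarrow> bool" where
  "jointly_order_monic C P X Y p q \<longleftrightarrow>
    (\<forall>A\<in>Obj C. \<forall>u\<in>Hom C A P. \<forall>v\<in>Hom C A P.
      Le C A X (Comp C A P X p u) (Comp C A P X p v) \<and>
      Le C A Y (Comp C A P Y q u) (Comp C A P Y q v) \<longrightarrow> Le C A P u v)"

definition is_product :: "('o, 'm) poscat \<Rightarrow> 'o \<Rightarrow> 'o \<Rightarrow> 'o \<Rightarrow> 'm \<Rightarrow> 'm \<Rightarrow> bool" where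
  "is_product C X Y P p q \<longleftrightarrow> P \<in> Obj C \<and> p \<in> Hom C P X \<and> q \<in> Hom C P Y \<and>
    (\<forall>A\<in>Obj C. \<forall>a\<in>Hom C A X. \<forall>b\<in>Hom C A Y.
      \<exists>!u. u \<in> Hom C A P \<and> Comp C A P X p u = a \<and> Comp C A P Y q u = b) \<and>
    jointly_order_monic C P X Y p q"

definition is_pullback ::
    "('o, 'm) poscat \<Rightarrow> 'o \<Rightarrow> 'o \<Rightarrow> 'o \<Rightarrow> 'm \<Rightarrow> 'm \<Rightarrow> 'o \<Rightarrow> 'm \<Rightarrow> 'm \<Rightarrow> bool" where
  "is_pullback C X Y Z f g T t0 t1 \<longleftrightarrow> T \<in> Obj C \<and> t0 \<in> Hom C T X \<and> t1 \<in> Hom C T Y \<and>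
    Comp C T X Z f t0 = Comp C T Y Z g t1 \<and>
    (\<forall>A\<in>Obj C. \<forall>a\<in>Hom C A X. \<forall>b\<in>Hom C A Y. Comp C A X Z f a = Comp C A Y Z g b \<longrightarrow>
      (\<exists>!u. u \<in> Hom C A T \<and> Comp C A T X t0 u = a \<and> Comp C A T Y t1 u = b)) \<and>
    jointly_order_monic C T X Y t0 t1"


section \<open>Relations\<close>

text \<open>
  A relation is a subobject of \<open>X \<times> Y\<close>, that is, an equivalence class of spans \<open>(R, r0, r1)\<close>
  whose pairing \<open>m\<close> into the product is an ff-morphism. Since product projections are jointly
  monic, a factorization of one pairing through another is the same as a factorization of both
  legs; the choice of product is immaterial because products are unique up to isomorphism.
\<close>

type_synonym ('o, 'm) span = "'o \<times> 'm \<times> 'm"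

definition rel_span :: "('o, 'm) poscat \<Rightarrow> 'o \<Rightarrow> 'o \<Rightarrow> ('o, 'm) span \<Rightarrow> bool" where
  "rel_span C X Y = (\<lambda>(R, r0, r1). R \<in> Obj C \<and>
    (\<exists>P p q m. is_product C X Y P p q \<and> ff_morphism C R P m \<and>
      Comp C R P X p m = r0 \<and> Comp C R P Y q m = r1))"

definition span_le ::
    "('o, 'm) poscat \<Rightarrow> 'o \<Rightarrow> 'o \<Rightarrow> ('o, 'm) span \<Rightarrow> ('o, 'm) span \<Rightarrow> bool" where
  "span_le C X Y = (\<lambda>(R, r0, r1) (S, s0, s1).
    \<exists>h\<in>Hom C R S. Comp C R S X s0 h = r0 \<and> Comp C R S Y s1 h = r1)"

type_synonym ('o, 'm) relation = "('o, 'm) span set"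

definition Rels :: "('o, 'm) poscat \<Rightarrow> 'o \<Rightarrow> 'o \<Rightarrow> ('o, 'm) relation set" where
  "Rels C X Y = Collect (rel_span C X Y) //
    {(R, S). rel_span C X Y R \<and> rel_span C X Y S \<and> span_le C X Y R S \<and> span_le C X Y S R}"

definition rel_le ::
    "('o, 'm) poscat \<Rightarrow> 'o \<Rightarrow> 'o \<Rightarrow> ('o, 'm) relation \<Rightarrow> ('o, 'm) relation \<Rightarrow> bool" where
  "rel_le C X Y \<R> \<S> \<longleftrightarrow> (\<exists>R\<in>\<R>. \<exists>S\<in>\<S>. span_le C X Y R S)"

text \<open>The relation \<open>(x, y) \<in>\<^sub>A \<R>\<close>.\<close>

definition in_rel ::
    "('o, 'm) poscat \<Rightarrow> 'o \<Rightarrow> 'o \<Rightarrow> 'o \<Rightarrow> 'm \<Rightarrow> 'm \<Rightarrow> ('o, 'm) relation \<Rightarrow> bool" where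
  "in_rel C X Y A x y \<R> \<longleftrightarrow> (\<exists>R\<in>\<R>. span_le C X Y (A, x, y) R)"

text \<open>
  The composite consists of all spans that arise as the ff-part of an (so, ff)-factorization,
  for any choice of representatives and of the pullback.
\<close>

definition rel_comp ::
    "('o, 'm) poscat \<Rightarrow> 'o \<Rightarrow> 'o \<Rightarrow> 'o \<Rightarrow> ('o, 'm) relation \<Rightarrow> ('o, 'm) relation
      \<Rightarrow> ('o, 'm) relation" where
  "rel_comp C X Y Z \<S> \<R> = {(Q, q0, q1). rel_span C X Z (Q, q0, q1) \<and>
    (\<exists>R r0 r1 S s0 s1 T t0 t1 e. (R, r0, r1) \<in> \<R> \<and> (S, s0, s1) \<in> \<S> \<and>
      is_pullback C R S Y r1 s0 T t0 t1 \<and> so_morphism C T Q e \<and>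
      Comp C T Q X q0 e = Comp C T R X r0 t0 \<and>
      Comp C T Q Z q1 e = Comp C T S Z s1 t1)}"

definition weakening_closed ::
    "('o, 'm) poscat \<Rightarrow> 'o \<Rightarrow> 'o \<Rightarrow> ('o, 'm) relation \<Rightarrow> bool" where
  "weakening_closed C X Y \<R> \<longleftrightarrow>
    (\<forall>A\<in>Obj C. \<forall>x\<in>Hom C A X. \<forall>x'\<in>Hom C A X. \<forall>y\<in>Hom C A Y. \<forall>y'\<in>Hom C A Y.
      Le C A X x' x \<and> in_rel C X Y A x y \<R> \<and> Le C A Y y y' \<longrightarrow> in_rel C X Y A x' y' \<R>)"

definition congruence :: "('o, 'm) poscat \<Rightarrow> 'o \<Rightarrow> ('o, 'm) relation \<Rightarrow> bool" where
  "congruence C X E \<longleftrightarrow> E \<in> Rels C X X \<and> weakening_closed C X X E \<and>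
    (\<forall>A\<in>Obj C. \<forall>x\<in>Hom C A X. in_rel C X X A x x E) \<and>
    (\<forall>A\<in>Obj C. \<forall>x\<in>Hom C A X. \<forall>y\<in>Hom C A X. \<forall>z\<in>Hom C A X.
      in_rel C X X A x y E \<and> in_rel C X X A y z E \<longrightarrow> in_rel C X X A x z E)"


section \<open>The exact completion\<close>

text \<open>Both constructions are meant to be applied to a regular \<open>C\<close>.\<close>

definition Qw :: "('o, 'm) poscat \<Rightarrow> ('o \<times> ('o, 'm) relation, ('o, 'm) relation) poscat" where
  "Qw C = \<lparr>
    Obj = {(X, E). X \<in> Obj C \<and> congruence C X E},
    Hom = (\<lambda>(X, E) (Y, F).
      {\<Phi> \<in> Rels C X Y. rel_comp C X Y Y F (rel_comp C X X Y \<Phi> E) = \<Phi>}),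
    Ident = (\<lambda>(X, E). E),
    Comp = (\<lambda>(X, E) (Y, F) (Z, G) \<Psi> \<Phi>. rel_comp C X Y Z \<Psi> \<Phi>),
    Le = (\<lambda>(X, E) (Y, F) \<Phi> \<Psi>. rel_le C X Y \<Phi> \<Psi>)\<rparr>"

text \<open>\<open>R\<close> is the right adjoint of \<open>L\<close>.\<close>

definition adjoint_morphisms :: "('o, 'm) poscat \<Rightarrow> 'o \<Rightarrow> 'o \<Rightarrow> 'm \<Rightarrow> 'm \<Rightarrow> bool" where
  "adjoint_morphisms C X Y L R \<longleftrightarrow> L \<in> Hom C X Y \<and> R \<in> Hom C Y X \<and>
    Le C X X (Ident C X) (Comp C X Y X R L) \<and> Le C Y Y (Comp C Y X Y L R) (Ident C Y)"

definition ex_reg :: "('o, 'm) poscat \<Rightarrow> ('o \<times> ('o, 'm) relation, ('o, 'm) relation) poscat" where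
  "ex_reg C = \<lparr>
    Obj = Obj (Qw C),
    Hom = (\<lambda>a b. {L. \<exists>R. adjoint_morphisms (Qw C) a b L R}),
    Ident = Ident (Qw C),
    Comp = Comp (Qw C),
    Le = (\<lambda>a b \<Phi> \<Psi>. Le (Qw C) a b \<Psi> \<Phi>)\<rparr>"


section \<open>Ordered topological spaces\<close>

type_synonym 'a ordspace = "'a topology \<times> 'a rel"

definition ordered_space :: "'a ordspace \<Rightarrow> bool" where
  "ordered_space = (\<lambda>(T, r). partial_order_on (topspace T) r)"

definition nachbin_space :: "'a ordspace \<Rightarrow> bool" where
  "nachbin_space = (\<lambda>(T, r). ordered_space (T, r) \<and> compact_space T \<and>
    closedin (prod_topology T T) r)"

definition priestley_space :: "'a ordspace \<Rightarrow> bool" where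
  "priestley_space = (\<lambda>(T, r). ordered_space (T, r) \<and> compact_space T \<and>
    (\<forall>x\<in>topspace T. \<forall>y\<in>topspace T. (x, y) \<notin> r \<longrightarrow>
      (\<exists>U. openin T U \<and> closedin T U \<and> (\<forall>u\<in>U. \<forall>v. (u, v) \<in> r \<longrightarrow> v \<in> U) \<and>
        x \<in> U \<and> y \<notin> U)))"

text \<open>
  For the discrete order, the Priestley separation condition says that distinct points are
  separated by clopen sets, so these are exactly the Stone spaces; between them, every continuous
  map is order-preserving and the pointwise order on maps is equality.
\<close>

definition stone_space :: "'a ordspace \<Rightarrow> bool" where
  "stone_space = (\<lambda>(T, r). priestley_space (T, r) \<and> r = Id_on (topspace T))"

text \<open>Morphisms are extensional so that equality of morphisms is equality on the carrier.\<close>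

definition ordspace_category ::
    "'a ordspace set \<Rightarrow> ('a ordspace, 'a \<Rightarrow> 'a) poscat" where
  "ordspace_category \<O> = \<lparr>
    Obj = \<O>,
    Hom = (\<lambda>(T, r) (T', r'). {f \<in> extensional (topspace T). continuous_map T T' f \<and>
      (\<forall>x y. (x, y) \<in> r \<longrightarrow> (f x, f y) \<in> r')}),
    Ident = (\<lambda>(T, r). \<lambda>x\<in>topspace T. x),
    Comp = (\<lambda>(T, r) (T', r') (T'', r'') g f. compose (topspace T) g f),
    Le = (\<lambda>(T, r) (T', r') f g. \<forall>x\<in>topspace T. (f x, g x) \<in> r')\<rparr>"

text \<open>
  There is no type of all spaces, so a universe of small spaces is needed. It is given by an
  arbitrary infinite type \<open>'k\<close>: a space is small if its weight (least cardinality of a base) is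
  less than \<open>|'k|\<close>. A compact Hausdorff space of weight \<open>w\<close> has at most \<open>2\<^sup>w\<close> points, so the
  points can always be taken in \<open>'k set\<close>. Bounding the weight rather than the number of points
  ensures, for every infinite \<open>'k\<close>, that each small compact Hausdorff space is a quotient of a
  small Stone space. If \<open>|'k|\<close> is a strong limit cardinal (for instance the cardinality of a
  Grothendieck universe), the bound on the weight is equivalent to the same bound on the number
  of points. Conversely, every Nachbin space on a type \<open>'a\<close> occurs up to isomorphism for a
  suitable \<open>'k\<close>, for instance \<open>('a + nat) set\<close>; see \<open>nachbin_space_representable\<close> below.
\<close>

definition small_space :: "'k set topology \<Rightarrow> bool" where
  "small_space T \<longleftrightarrow> (\<exists>\<B>. \<B> \<prec> (UNIV :: 'k set) \<and> (\<forall>V\<in>\<B>. openin T V) \<and>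
    (\<forall>U x. openin T U \<and> x \<in> U \<longrightarrow> (\<exists>V\<in>\<B>. x \<in> V \<and> V \<subseteq> U)))"

definition Nach :: "('k set ordspace, 'k set \<Rightarrow> 'k set) poscat" where
  "Nach = ordspace_category {(T, r). small_space T \<and> nachbin_space (T, r)}"

definition Pries :: "('k set ordspace, 'k set \<Rightarrow> 'k set) poscat" where
  "Pries = ordspace_category {(T, r). small_space T \<and> priestley_space (T, r)}"

definition Stone :: "('k set ordspace, 'k set \<Rightarrow> 'k set) poscat" where
  "Stone = ordspace_category {(T, r). small_space T \<and> stone_space (T, r)}"


section \<open>Adequacy of the universe\<close>

lemma times_self_lepoll:
  assumes "infinite X"
  shows "X \<times> X \<lesssim> X"
  using card_of_Times_same_infinite[OF assms] unfolding lepoll_def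
  by (metis bij_betw_def card_of_ordIso subset_refl)

lemma Fpow_lepoll:
  assumes inf: "infinite X"
  shows "Fpow X \<lesssim> X"
proof -
  define A where "A n = {F. F \<subseteq> X \<and> finite F \<and> card F = n}" for n
  have A: "A n \<lesssim> X" for n
  proof (induction n)
    case 0
    have "A 0 = {{}}" by (auto simp: A_def)
    then show ?case using inf by (simp add: finite_lepoll_infinite)
  next
    case (Suc n)
    have "A (Suc n) \<subseteq> (\<lambda>(x, F). insert x F) ` (X \<times> A n)"
    proof
      fix F assume F: "F \<in> A (Suc n)"
      then obtain x G where "F = insert x G" "x \<notin> G" "card G = n" "finite G"
        unfolding A_def by (auto simp: card_Suc_eq)
      then show "F \<in> (\<lambda>(x, F). insert x F) ` (X \<times> A n)"
        using F by (auto simp: A_def image_iff)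
    qed
    then have "A (Suc n) \<lesssim> X \<times> A n" by (rule subset_image_lepoll)
    also have "X \<times> A n \<lesssim> X \<times> X" by (intro times_lepoll_mono Suc.IH) simp
    also have "X \<times> X \<lesssim> X" by (rule times_self_lepoll[OF inf])
    finally show ?case .
  qed
  have "(card_of (\<Union>n\<in>(UNIV :: nat set). A n), card_of X) \<in> ordLeq"
  proof (rule card_of_UNION_ordLeq_infinite[OF inf])
    show "(card_of (UNIV :: nat set), card_of X) \<in> ordLeq"
      using inf by (simp add: infinite_iff_card_of_nat)
    show "\<forall>n\<in>UNIV. (card_of (A n), card_of X) \<in> ordLeq"
      using A unfolding lepoll_def card_of_ordLeq by blast
  qed
  moreover have "(\<Union>n\<in>(UNIV :: nat set). A n) = Fpow X" by (auto simp: A_def Fpow_def)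
  ultimately show ?thesis unfolding lepoll_def card_of_ordLeq by simp
qed

lemma compact_Hausdorff_base_lepoll:
  assumes "compact_space T" "Hausdorff_space T" "infinite (topspace T)"
  obtains \<B> where "\<B> \<lesssim> topspace T" "\<And>V. V \<in> \<B> \<Longrightarrow> openin T V"
    "\<And>U x. \<lbrakk>openin T U; x \<in> U\<rbrakk> \<Longrightarrow> \<exists>V\<in>\<B>. x \<in> V \<and> V \<subseteq> U"
proof -
  define X where "X = topspace T"
  have "\<exists>U V. openin T U \<and> openin T V \<and> (x \<in> X \<and> y \<in> X \<and> x \<noteq> y \<longrightarrow> x \<in> U \<and> y \<in> V \<and> U \<inter> V = {})"
    for x y
    using assms(2) unfolding Hausdorff_space_def disjnt_def X_def by (metis openin_empty)
  then obtain P Q where P: "\<And>x y. openin T (P x y)" and Q: "\<And>x y. openin T (Q x y)"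
    and PQ: "\<And>x y. \<lbrakk>x \<in> X; y \<in> X; x \<noteq> y\<rbrakk> \<Longrightarrow> x \<in> P x y \<and> y \<in> Q x y \<and> P x y \<inter> Q x y = {}"
    by metis
  define g where "g = (\<lambda>(x, F). X \<inter> \<Inter> (P x ` F))"
  define \<B> where "\<B> = g ` (X \<times> Fpow X)"
  have inf: "infinite X" using assms(3) by (simp add: X_def)
  have "\<B> \<lesssim> X \<times> Fpow X" unfolding \<B>_def by (rule image_lepoll)
  also have "X \<times> Fpow X \<lesssim> X \<times> X"
    by (intro times_lepoll_mono Fpow_lepoll inf) simp
  also have "X \<times> X \<lesssim> X" by (rule times_self_lepoll[OF inf])
  finally have 1: "\<B> \<lesssim> topspace T" by (simp add: X_def)
  have 2: "openin T V" if V: "V \<in> \<B>" for V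
  proof -
    obtain x F where F: "finite F" "V = X \<inter> \<Inter> (P x ` F)"
      using V by (auto simp: \<B>_def g_def Fpow_def)
    have "finite (insert X (P x ` F))" "\<And>W. W \<in> insert X (P x ` F) \<Longrightarrow> openin T W"
      using F P by (auto simp: X_def)
    then have "openin T (\<Inter> (insert X (P x ` F)))" by (intro openin_Inter) auto
    then show ?thesis using F by simp
  qed
  have 3: "\<exists>V\<in>\<B>. x \<in> V \<and> V \<subseteq> U" if U: "openin T U" "x \<in> U" for U x
  proof -
    have x: "x \<in> X" using U openin_subset X_def by blast
    have "compactin T (X - U)"
      using U assms(1) by (simp add: X_def closedin_compact_space closedin_diff)
    moreover have "X - U \<subseteq> \<Union> (Q x ` (X - U))" using PQ x U(2) by blast
    ultimately obtain \<F> where \<F>: "finite \<F>" "\<F> \<subseteq> Q x ` (X - U)" "X - U \<subseteq> \<Union>\<F>"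
      unfolding compactin_def using Q by (metis (no_types, lifting) imageE)
    then obtain F where F: "finite F" "F \<subseteq> X - U" "\<F> = Q x ` F"
      by (meson finite_subset_image)
    have "g (x, F) \<in> \<B>" using F x by (auto simp: \<B>_def Fpow_def)
    moreover have "x \<in> g (x, F)" using F PQ x U(2) by (auto simp: g_def)
    moreover have "g (x, F) \<subseteq> U"
    proof
      fix z assume z: "z \<in> g (x, F)"
      show "z \<in> U"
      proof (rule ccontr)
        assume "z \<notin> U"
        then obtain y where "y \<in> F" "z \<in> Q x y" using z \<F>(3) F(3) by (auto simp: g_def)
        then show False using z PQ[of x y] x F U(2) by (auto simp: g_def)
      qed
    qed
    ultimately show ?thesis by blast
  qed
  show ?thesis by (rule that[OF 1 2 3])
qed

lemma nachbin_imp_Hausdorff: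
  assumes "nachbin_space (T, r)"
  shows "Hausdorff_space T"
proof -
  let ?X = "topspace T"
  have r: "closedin (prod_topology T T) r" "partial_order_on ?X r"
    using assms by (auto simp: nachbin_space_def ordered_space_def)
  have "continuous_map (prod_topology T T) (prod_topology T T) (\<lambda>z. (snd z, fst z))"
    by (intro continuous_map_pairedI continuous_map_fst continuous_map_snd)
  from closedin_continuous_map_preimage[OF this r(1)]
  have "closedin (prod_topology T T) (r \<inter> {z \<in> topspace (prod_topology T T). (snd z, fst z) \<in> r})"
    using r(1) by blast
  moreover have "r \<inter> {z \<in> topspace (prod_topology T T). (snd z, fst z) \<in> r} = (\<lambda>x. (x, x)) ` ?X"
    using partial_order_onD[OF r(2)] by (auto simp: refl_on_def dest: antisymD)
  ultimately show ?thesis by (simp add: Hausdorff_space_closedin_diagonal)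
qed

lemma nachbin_space_representable:
  fixes T :: "'a topology" and r :: "'a rel"
  assumes nach: "nachbin_space (T, r)"
    and inf: "infinite (UNIV :: 'k set)" and small: "topspace T \<prec> (UNIV :: 'k set)"
  obtains T' r' f where "(T', r') \<in> Obj (Nach :: ('k set ordspace, 'k set \<Rightarrow> 'k set) poscat)"
    "homeomorphic_map T T' f"
    "\<And>x y. \<lbrakk>x \<in> topspace T; y \<in> topspace T\<rbrakk> \<Longrightarrow> (f x, f y) \<in> r' \<longleftrightarrow> (x, y) \<in> r"
proof -
  let ?X = "topspace T"
  have comp: "compact_space T" and po: "partial_order_on ?X r"
    and cl: "closedin (prod_topology T T) r"
    using nach by (auto simp: nachbin_space_def ordered_space_def)
  obtain \<B> where \<B>: "\<B> \<prec> (UNIV :: 'k set)" "\<And>V. V \<in> \<B> \<Longrightarrow> openin T V"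
    "\<And>U x. \<lbrakk>openin T U; x \<in> U\<rbrakk> \<Longrightarrow> \<exists>V\<in>\<B>. x \<in> V \<and> V \<subseteq> U"
  proof (cases "finite ?X")
    case True
    have "finite {U. openin T U}"
      by (rule finite_subset[of _ "Pow ?X"]) (use True openin_subset in auto)
    then show ?thesis using that[of "{U. openin T U}"] finite_lesspoll_infinite[OF inf] by blast
  next
    case False
    show ?thesis
      by (rule compact_Hausdorff_base_lepoll[OF comp nachbin_imp_Hausdorff[OF nach] False])
        (rule that, erule lesspoll_trans1[OF _ small])
  qed
  obtain i :: "'a \<Rightarrow> 'k" where i: "inj_on i ?X"
    using small lesspoll_imp_lepoll unfolding lepoll_def by blast
  define f where "f = (\<lambda>x. {i x})"
  define g where "g = inv_into ?X f"
  have gf: "g (f x) = x" if "x \<in> ?X" for x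
    unfolding g_def using i that by (intro inv_into_f_f) (auto simp: f_def inj_on_def)
  define T' where "T' = pullback_topology (f ` ?X) g T"
  have opT': "openin T' S \<longleftrightarrow> (\<exists>U. openin T U \<and> S = g -` U \<inter> f ` ?X)" for S
    by (simp add: T'_def openin_pullback_topology)
  have topT': "topspace T' = f ` ?X"
    using gf by (auto simp: T'_def topspace_pullback_topology)
  have cont_g: "continuous_map T' T g"
    unfolding T'_def using continuous_map_pullback[OF continuous_map_id[of T]] by (metis id_comp)
  have cont_f: "continuous_map T T' f"
  proof (unfold continuous_map, intro conjI allI impI)
    show "f ` ?X \<subseteq> topspace T'" by (simp add: topT')
    fix S assume "openin T' S"
    then obtain U where U: "openin T U" "S = g -` U \<inter> f ` ?X" using opT' by blast
    have "{x \<in> ?X. f x \<in> S} = U"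
      using U(2) gf openin_subset[OF U(1)] by (auto simp: subset_iff)
    then show "openin T {x \<in> ?X. f x \<in> S}" using U by simp
  qed
  have hm: "homeomorphic_maps T T' f g"
    unfolding homeomorphic_maps_def using cont_f cont_g gf topT' by auto
  define r' where "r' = {z \<in> topspace (prod_topology T' T'). (g (fst z), g (snd z)) \<in> r}"
  have r': "(f x, f y) \<in> r' \<longleftrightarrow> (x, y) \<in> r" if "x \<in> ?X" "y \<in> ?X" for x y
    using that gf by (simp add: r'_def topT')
  have "continuous_map (prod_topology T' T') (prod_topology T T) (\<lambda>z. (g (fst z), g (snd z)))"
    using cont_g by (intro continuous_map_pairedI continuous_map_compose[unfolded o_def,
          OF continuous_map_fst] continuous_map_compose[unfolded o_def, OF continuous_map_snd])
  from closedin_continuous_map_preimage[OF this cl]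
  have cl': "closedin (prod_topology T' T') r'" by (simp add: r'_def)
  have comp': "compact_space T'"
    using hm comp homeomorphic_compact_space homeomorphic_space_def by blast
  have po': "partial_order_on (topspace T') r'"
  proof -
    note d = partial_order_onD[OF po]
    have sub: "r' \<subseteq> topspace T' \<times> topspace T'" by (auto simp: r'_def)
    have "refl_on (topspace T') r'"
      using d(1) gf by (auto simp: refl_on_def r'_def topT')
    moreover have "trans r'"
      by (rule transI) (auto simp: r'_def intro: transD[OF d(2)])
    moreover have "antisym r'"
    proof (rule antisymI)
      fix x y assume xy: "(x, y) \<in> r'" "(y, x) \<in> r'"
      then have "g x = g y" by (intro antisymD[OF d(3)]) (auto simp: r'_def)
      moreover have "x \<in> f ` ?X" "y \<in> f ` ?X" using xy by (auto simp: r'_def topT')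
      ultimately show "x = y" using gf by auto
    qed
    ultimately show ?thesis using sub by (simp add: partial_order_on_def preorder_on_def)
  qed
  have "small_space T'"
    unfolding small_space_def
  proof (intro exI conjI allI ballI impI)
    show "(\<lambda>V. g -` V \<inter> f ` ?X) ` \<B> \<prec> (UNIV :: 'k set)"
      using lesspoll_trans1[OF image_lepoll \<B>(1)] .
    show "openin T' V" if "V \<in> (\<lambda>V. g -` V \<inter> f ` ?X) ` \<B>" for V
      using that \<B>(2) opT' by blast
    fix S y assume "openin T' S \<and> y \<in> S"
    then obtain U where U: "openin T U" "S = g -` U \<inter> f ` ?X" "y \<in> S" using opT' by blast
    then obtain V where V: "V \<in> \<B>" "g y \<in> V" "V \<subseteq> U" using \<B>(3)[of U "g y"] by auto
    then show "\<exists>V\<in>(\<lambda>V. g -` V \<inter> f ` ?X) ` \<B>. y \<in> V \<and> V \<subseteq> S"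
      using U by (intro bexI[of _ "g -` V \<inter> f ` ?X"]) auto
  qed
  then have "(T', r') \<in> Obj (Nach :: ('k set ordspace, 'k set \<Rightarrow> 'k set) poscat)"
    using comp' po' cl' by (simp add: Nach_def ordspace_category_def nachbin_space_def ordered_space_def)
  then show ?thesis
    by (rule that) (use r' hm in \<open>auto simp: homeomorphic_maps_map\<close>)
qed

end

theory Submission
  imports Defs
begin

text \<open>
  In a full subcategory \<open>\<C>\<close> of Nachbin spaces that is closed under closed subspaces and binary
  products, ff-morphisms are the order embeddings and so-morphisms the surjections. Hence relations
  from \<open>X\<close> to \<open>Y\<close> are the closed subsets of \<open>X \<times> Y\<close> with their set-theoretic composition, and
  congruences on \<open>X\<close> are the closed preorders \<open>E\<close> containing the order of \<open>X\<close>. The ordered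
  quotient \<open>X/E\<close> is a Nachbin space. A morphism \<open>(X, E) \<rightarrow> (Y, F)\<close> of the exact completion, being a
  left adjoint, is the relation \<open>f [x] \<le> [y]\<close> of a unique map \<open>f\<close> from \<open>X/E\<close> to \<open>Y/F\<close>, which is
  continuous because its graph is closed. So \<open>\<C>\<^bsub>ex/reg\<^esub>\<close> is equivalent to the category of all
  Nachbin spaces as soon as each of these is the image of an object of \<open>\<C>\<close>, and every compact
  Hausdorff space is the image of a Stone space of the same weight.
\<close>

section \<open>Equivalences of enriched categories\<close>

text \<open>The functor runs from Nachbin spaces to the completion: a cover \<open>q\<close> from
  \<open>X\<close> onto \<open>N\<close> is chosen for each \<open>N\<close>, and \<open>N\<close>
  goes to \<open>X\<close> with the preorder \<open>q x \<le> q y\<close>. In this direction only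
  covers have to be chosen; fullness is the statement on left adjoints, and essential surjectivity
  is the existence of ordered quotients. Enlarging \<open>f\<close> shrinks the relation
  \<open>f (q x) \<le> p y\<close>, which explains why the completion orders its morphisms by
  reverse inclusion. Both halves of the theorem are instances of one argument on locales, which asks
  of the small category only for closed subspaces, binary products, covers and quotients. The other
  concern is size: every subspace, product, quotient and cover must have its points in
  \<open>'k set\<close> and a base smaller than \<open>'k\<close>. Copying along injections settles
  the first point, counting finite subsets of a base the second.\<close>

lemma pos_equivalent_sym: "pos_equivalent C D \<Longrightarrow> pos_equivalent D C"
  unfolding pos_equivalent_def by blast

text \<open>An order-reflecting functor is faithful by antisymmetry, so a full and essentially
  surjective one has a quasi-inverse. It is built from a chosen isomorphism \<open>e Y\<close> for
  each \<open>Y\<close> and from lifts along \<open>Fm\<close>; every equation in \<open>C\<close>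
  is checked after applying \<open>Fm\<close>.\<close>

lemma pos_equivalentI:
  assumes C: "pos_category C" and D: "pos_category D" and F: "pos_functor C D Fo Fm"
    and full: "\<And>X Y g. \<lbrakk>X \<in> Obj C; Y \<in> Obj C; g \<in> Hom D (Fo X) (Fo Y)\<rbrakk>
      \<Longrightarrow> \<exists>f\<in>Hom C X Y. Fm X Y f = g"
    and reflect: "\<And>X Y f g. \<lbrakk>X \<in> Obj C; Y \<in> Obj C; f \<in> Hom C X Y; g \<in> Hom C X Y;
      Le D (Fo X) (Fo Y) (Fm X Y f) (Fm X Y g)\<rbrakk> \<Longrightarrow> Le C X Y f g"
    and ess: "\<And>Y. Y \<in> Obj D \<Longrightarrow> \<exists>X\<in>Obj C. \<exists>e. is_iso D (Fo X) Y e"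
  shows "pos_equivalent C D"
proof -
  interpret C: pos_category C by (rule C)
  interpret D: pos_category D by (rule D)
  have Fo: "Fo X \<in> Obj D" and Fid: "Fm X X (Ident C X) = Ident D (Fo X)" if "X \<in> Obj C" for X
    using F that unfolding pos_functor_def by blast+
  have Fm: "Fm X Y f \<in> Hom D (Fo X) (Fo Y)"
    if "X \<in> Obj C" "Y \<in> Obj C" "f \<in> Hom C X Y" for X Y f
    using F that unfolding pos_functor_def by blast
  have Fcomp: "Fm X Z (Comp C X Y Z g f) = Comp D (Fo X) (Fo Y) (Fo Z) (Fm Y Z g) (Fm X Y f)"
    if "X \<in> Obj C" "Y \<in> Obj C" "Z \<in> Obj C" "f \<in> Hom C X Y" "g \<in> Hom C Y Z" for X Y Z f g
    using F that unfolding pos_functor_def by blast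
  have faithful: "f = g" if "X \<in> Obj C" "Y \<in> Obj C" "f \<in> Hom C X Y" "g \<in> Hom C X Y"
    "Fm X Y f = Fm X Y g" for X Y f g
    using that by (intro C.Le_antisym[of X Y] reflect) (auto intro!: D.Le_refl Fo Fm)
  have "\<exists>X e e'. X \<in> Obj C \<and> e \<in> Hom D (Fo X) Y \<and> e' \<in> Hom D Y (Fo X) \<and>
      Comp D (Fo X) Y (Fo X) e' e = Ident D (Fo X) \<and> Comp D Y (Fo X) Y e e' = Ident D Y"
    if "Y \<in> Obj D" for Y
    using ess[OF that] unfolding is_iso_def by blast
  then obtain Go e e' where
    Go: "\<And>Y. Y \<in> Obj D \<Longrightarrow> Go Y \<in> Obj C" and
    e: "\<And>Y. Y \<in> Obj D \<Longrightarrow> e Y \<in> Hom D (Fo (Go Y)) Y" and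
    e': "\<And>Y. Y \<in> Obj D \<Longrightarrow> e' Y \<in> Hom D Y (Fo (Go Y))" and
    e'e: "\<And>Y. Y \<in> Obj D \<Longrightarrow> Comp D (Fo (Go Y)) Y (Fo (Go Y)) (e' Y) (e Y) = Ident D (Fo (Go Y))" and
    ee': "\<And>Y. Y \<in> Obj D \<Longrightarrow> Comp D Y (Fo (Go Y)) Y (e Y) (e' Y) = Ident D Y"
    by metis
  define lift where "lift X Y g = (SOME f. f \<in> Hom C X Y \<and> Fm X Y f = g)" for X Y g
  have lift: "lift X Y g \<in> Hom C X Y" "Fm X Y (lift X Y g) = g"
    if "X \<in> Obj C" "Y \<in> Obj C" "g \<in> Hom D (Fo X) (Fo Y)" for X Y g
    using someI_ex[OF full[OF that, unfolded Bex_def]] unfolding lift_def by blast+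
  \<comment> \<open>Conjugation by the chosen isomorphisms; its lift along \<open>Fm\<close> is the
    action of the quasi-inverse on morphisms.\<close>
  define conj
      where "conj Y Z g = Comp D (Fo (Go Y)) Z (Fo (Go Z)) (e' Z) (Comp D (Fo (Go Y)) Y Z g (e Y))"
    for Y Z g
  have conj: "conj Y Z g \<in> Hom D (Fo (Go Y)) (Fo (Go Z))"
    if "Y \<in> Obj D" "Z \<in> Obj D" "g \<in> Hom D Y Z" for Y Z g
    unfolding conj_def by (intro D.Comp_in e e' Fo Go that)
  \<comment> \<open>This is the naturality square of \<open>e\<close>. It also yields functoriality,
    because \<open>e\<close> can be cancelled on the left by \<open>e_mono\<close>.\<close>
  have e_conj: "Comp D (Fo (Go Y)) (Fo (Go Z)) Z (e Z) (conj Y Z g) =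
      Comp D (Fo (Go Y)) Y Z g (e Y)"
    if YZ: "Y \<in> Obj D" "Z \<in> Obj D" "g \<in> Hom D Y Z" for Y Z g
  proof -
    have ge: "Comp D (Fo (Go Y)) Y Z g (e Y) \<in> Hom D (Fo (Go Y)) Z"
      by (intro D.Comp_in e Fo Go YZ)
    show ?thesis
      unfolding conj_def
      by (subst D.Comp_assoc[OF _ _ _ _ ge])
        (simp_all add: Fo Go e e' ee' YZ D.Comp_Ident_left[OF _ _ ge])
  qed
  have e_mono: "f = g"
      if "Y \<in> Obj D" "W \<in> Obj D" "f \<in> Hom D W (Fo (Go Y))" "g \<in> Hom D W (Fo (Go Y))"
    "Comp D W (Fo (Go Y)) Y (e Y) f = Comp D W (Fo (Go Y)) Y (e Y) g" for Y W f g
  proof -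
    have "h = Comp D W Y (Fo (Go Y)) (e' Y) (Comp D W (Fo (Go Y)) Y (e Y) h)"
      if "h \<in> Hom D W (Fo (Go Y))" for h
      using that \<open>Y \<in> Obj D\<close> \<open>W \<in> Obj D\<close> e e' e'e Fo Go D.Comp_assoc D.Comp_Ident_left by metis
    then show ?thesis using that by metis
  qed
  define Gm where "Gm Y Z g = lift (Go Y) (Go Z) (conj Y Z g)" for Y Z g
  have Gm: "Gm Y Z g \<in> Hom C (Go Y) (Go Z)" "Fm (Go Y) (Go Z) (Gm Y Z g) = conj Y Z g"
    if "Y \<in> Obj D" "Z \<in> Obj D" "g \<in> Hom D Y Z" for Y Z g
    unfolding Gm_def by (intro lift Go conj that)+
  have G: "pos_functor D C Go Gm"
    unfolding pos_functor_def
  proof (intro conjI ballI impI)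
    fix Y assume Y: "Y \<in> Obj D"
    note id = D.Ident_in[OF Y]
    show "Go Y \<in> Obj C" by (rule Go[OF Y])
    show "Gm Y Y (Ident D Y) = Ident C (Go Y)"
    proof (rule faithful[OF Go[OF Y] Go[OF Y] Gm(1)[OF Y Y id] C.Ident_in[OF Go[OF Y]]])
      show "Fm (Go Y) (Go Y) (Gm Y Y (Ident D Y)) = Fm (Go Y) (Go Y) (Ident C (Go Y))"
        unfolding Gm(2)[OF Y Y id] Fid[OF Go[OF Y]] conj_def
        by (simp add: D.Comp_Ident_left Y Fo Go e e'e)
    qed
  next
    fix Y Z g assume "Y \<in> Obj D" "Z \<in> Obj D" "g \<in> Hom D Y Z"
    then show "Gm Y Z g \<in> Hom C (Go Y) (Go Z)" by (rule Gm(1))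
  next
    fix Y Z W f g assume Y: "Y \<in> Obj D" and Z: "Z \<in> Obj D" and W: "W \<in> Obj D"
      and f: "f \<in> Hom D Y Z" and g: "g \<in> Hom D Z W"
    note gf = D.Comp_in[OF Y Z W f g]
    show "Gm Y W (Comp D Y Z W g f) = Comp C (Go Y) (Go Z) (Go W) (Gm Z W g) (Gm Y Z f)"
    proof (rule faithful[OF Go[OF Y] Go[OF W] Gm(1)[OF Y W gf]])
      show "Comp C (Go Y) (Go Z) (Go W) (Gm Z W g) (Gm Y Z f) \<in> Hom C (Go Y) (Go W)"
        by (intro C.Comp_in Go Gm Y Z W f g)
      let ?c = "Comp D (Fo (Go Y)) (Fo (Go Z)) (Fo (Go W)) (conj Z W g) (conj Y Z f)"
      have "conj Y W (Comp D Y Z W g f) = ?c"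
      proof (rule e_mono[OF W Fo[OF Go[OF Y]] conj[OF Y W gf]])
        show "?c \<in> Hom D (Fo (Go Y)) (Fo (Go W))" by (intro D.Comp_in Fo Go conj Y Z W f g)
        have "Comp D (Fo (Go Y)) (Fo (Go W)) W (e W) ?c
            = Comp D (Fo (Go Y)) (Fo (Go Z)) W (Comp D (Fo (Go Z)) Z W g (e Z)) (conj Y Z f)"
          using D.Comp_assoc[OF Fo[OF Go[OF Y]] Fo[OF Go[OF Z]] Fo[OF Go[OF W]] W
              conj[OF Y Z f] conj[OF Z W g] e[OF W]] e_conj[OF Z W g] by simp
        also have "\<dots> = Comp D (Fo (Go Y)) Z W g (Comp D (Fo (Go Y)) Y Z f (e Y))"
          using D.Comp_assoc[OF Fo[OF Go[OF Y]] Fo[OF Go[OF Z]] Z W conj[OF Y Z f] e[OF Z] g]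
            e_conj[OF Y Z f] by simp
        also have "\<dots> = Comp D (Fo (Go Y)) Y W (Comp D Y Z W g f) (e Y)"
          by (rule D.Comp_assoc[OF Fo[OF Go[OF Y]] Y Z W e[OF Y] f g])
        finally show "Comp D (Fo (Go Y)) (Fo (Go W)) W (e W) (conj Y W (Comp D Y Z W g f))
            = Comp D (Fo (Go Y)) (Fo (Go W)) W (e W) ?c"
          by (simp add: e_conj[OF Y W gf])
      qed
      then show "Fm (Go Y) (Go W) (Gm Y W (Comp D Y Z W g f)) =
          Fm (Go Y) (Go W) (Comp C (Go Y) (Go Z) (Go W) (Gm Z W g) (Gm Y Z f))"
        by (simp add: Gm Fcomp Go Y Z W f g gf)
    qed
  next
    fix Y Z f g assume YZ: "Y \<in> Obj D" "Z \<in> Obj D" and f: "f \<in> Hom D Y Z" and g: "g \<in> Hom D Y Z"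
      and fg: "Le D Y Z f g"
    have "Le D (Fo (Go Y)) (Fo (Go Z)) (conj Y Z f) (conj Y Z g)"
      unfolding conj_def
      by (intro D.Comp_mono D.Comp_in D.Le_refl fg e e' f g YZ Fo Go)
    then show "Le C (Go Y) (Go Z) (Gm Y Z f) (Gm Y Z g)"
      using YZ f g by (intro reflect) (simp_all add: Go Gm)
  qed
  have "naturally_isomorphic C C (\<lambda>X. Go (Fo X)) (\<lambda>X Y f. Gm (Fo X) (Fo Y) (Fm X Y f))
      (\<lambda>X. X) (\<lambda>X Y f. f)"
    unfolding naturally_isomorphic_def
  proof (intro exI conjI ballI)
    let ?n = "\<lambda>X. lift (Go (Fo X)) X (e (Fo X))"
    let ?n' = "\<lambda>X. lift X (Go (Fo X)) (e' (Fo X))"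
    have n: "?n X \<in> Hom C (Go (Fo X)) X" "Fm (Go (Fo X)) X (?n X) = e (Fo X)"
      "?n' X \<in> Hom C X (Go (Fo X))" "Fm X (Go (Fo X)) (?n' X) = e' (Fo X)" if "X \<in> Obj C" for X
      using that by (simp_all add: lift Go Fo e e')
    show "is_iso C (Go (Fo X)) X (?n X)" if X: "X \<in> Obj C" for X
      unfolding is_iso_def
    proof (intro conjI bexI)
      show "Comp C (Go (Fo X)) X (Go (Fo X)) (?n' X) (?n X) = Ident C (Go (Fo X))"
        using X by (intro faithful[of "Go (Fo X)" "Go (Fo X)"] C.Comp_in C.Ident_in)
          (simp_all add: Go Fo n Fcomp Fid e'e)
      show "Comp C X (Go (Fo X)) X (?n X) (?n' X) = Ident C X"
        using X by (intro faithful[of X X] C.Comp_in[of X "Go (Fo X)"] C.Ident_in)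
          (simp_all add: Go Fo n Fcomp Fid ee')
    qed (use n X in auto)
    fix X Y f assume X: "X \<in> Obj C" and Y: "Y \<in> Obj C" and f: "f \<in> Hom C X Y"
    note Ff = Fm[OF X Y f]
    show "Comp C (Go (Fo X)) (Go (Fo Y)) Y (?n Y) (Gm (Fo X) (Fo Y) (Fm X Y f)) =
        Comp C (Go (Fo X)) X Y f (?n X)"
    proof (rule faithful)
      show "Fm (Go (Fo X)) Y (Comp C (Go (Fo X)) (Go (Fo Y)) Y (?n Y) (Gm (Fo X) (Fo Y) (Fm X Y
          f))) =
          Fm (Go (Fo X)) Y (Comp C (Go (Fo X)) X Y f (?n X))"
        using X Y f Ff by (simp add: Go Fo Fcomp n Gm e_conj)
    qed (use X Y f Ff in \<open>auto intro!: Go Fo C.Comp_in[of "Go (Fo X)"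
        "Go (Fo Y)"] C.Comp_in[of _ X] n Gm\<close>)
  qed
  moreover have "naturally_isomorphic D D (\<lambda>X. Fo (Go X)) (\<lambda>X Y f. Fm (Go X) (Go Y) (Gm X Y f))
      (\<lambda>X. X) (\<lambda>X Y f. f)"
    unfolding naturally_isomorphic_def
  proof (intro exI conjI ballI)
    show "is_iso D (Fo (Go Y)) Y (e Y)" if "Y \<in> Obj D" for Y
      unfolding is_iso_def using that e e' ee' e'e by blast
  qed (simp add: Gm e_conj)
  ultimately show ?thesis
    unfolding pos_equivalent_def using C D F G by blast
qed

section \<open>Compact Hausdorff spaces and closed relations\<close>

text \<open>The preimage of a closed \<open>D\<close> is the projection to \<open>X\<close> of the
  part of the graph that lies over \<open>D\<close>, and projecting along a compact factor is a
  closed map.\<close>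

lemma continuous_map_if_closed_graph:
  assumes Y: "compact_space Y" and f: "f \<in> topspace X \<rightarrow> topspace Y"
    and cl: "closedin (prod_topology X Y) ((\<lambda>x. (x, f x)) ` topspace X)"
  shows "continuous_map X Y f"
  unfolding continuous_map_closedin
proof (intro conjI ballI allI impI f)
  fix D assume D: "closedin Y D"
  have "closedin (prod_topology X Y) ((\<lambda>x. (x, f x)) ` topspace X \<inter> topspace X \<times> D)"
    using D cl by (intro closedin_Int) (auto simp: closedin_prod_Times_iff)
  then have "closedin X (fst ` ((\<lambda>x. (x, f x)) ` topspace X \<inter> topspace X \<times> D))"
    using closed_map_fst[OF Y] unfolding closed_map_def by blast
  moreover have "fst ` ((\<lambda>x. (x, f x)) ` topspace X \<inter> topspace X \<times> D) = {x \<in> topspace X. f x \<in> D}"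
    by force
  ultimately show "closedin X {x \<in> topspace X. f x \<in> D}" by simp
qed

text \<open>The composite is the projection, along the compact middle space, of a closed set of
  triples. These are arranged as \<open>((x, z), y)\<close>, so that the projection is
  \<open>fst\<close>.\<close>

lemma closedin_relcomp:
  assumes Y: "compact_space Y"
    and R: "closedin (prod_topology X Y) R" and S: "closedin (prod_topology Y Z) S"
  shows "closedin (prod_topology X Z) (R O S)"
proof -
  let ?P = "prod_topology (prod_topology X Z) Y"
  let ?A = "{t \<in> topspace ?P. (fst (fst t), snd t) \<in> R}"
  let ?B = "{t \<in> topspace ?P. (snd t, snd (fst t)) \<in> S}"
  have f: "continuous_map ?P X (\<lambda>t. fst (fst t))" "continuous_map ?P Z (\<lambda>t. snd (fst t))"
    using continuous_map_compose[OF continuous_map_fst continuous_map_fst, of X Z Y]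
      continuous_map_compose[OF continuous_map_fst continuous_map_snd, of X Z Y]
    by (simp_all add: o_def)
  have "closedin ?P ?A" "closedin ?P ?B"
    by (rule closedin_continuous_map_preimage[OF _ R] closedin_continuous_map_preimage[OF _ S],
        intro continuous_map_pairedI f continuous_map_snd)+
  then have "closedin (prod_topology X Z) (fst ` (?A \<inter> ?B))"
    using closed_map_fst[OF Y] unfolding closed_map_def by blast
  moreover have "fst ` (?A \<inter> ?B) = R O S"
  proof (intro equalityI subsetI)
    fix u assume "u \<in> R O S"
    then obtain x y z where u: "u = (x, z)" "(x, y) \<in> R" "(y, z) \<in> S" by blast
    then have "((x, z), y) \<in> ?A \<inter> ?B"
      using closedin_subset[OF R] closedin_subset[OF S] by auto
    then show "u \<in> fst ` (?A \<inter> ?B)" using u(1) by (intro image_eqI[of _ _ "((x, z), y)"]) simp_all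
  next
    fix u assume "u \<in> fst ` (?A \<inter> ?B)"
    then obtain t where "u = fst t" "(fst (fst t), snd t) \<in> R" "(snd t, snd (fst t)) \<in> S" by blast
    then show "u \<in> R O S" by (metis prod.collapse relcomp.relcompI)
  qed
  ultimately show ?thesis by simp
qed

lemma closedin_vimage_pair:
  assumes "continuous_map X Y f" "continuous_map X' Y' g" "closedin (prod_topology Y Y') R"
  shows "closedin (prod_topology X X') {(x, x'). x \<in> topspace X \<and> x' \<in> topspace X' \<and>
      (f x, g x') \<in> R}"
proof -
  have "continuous_map (prod_topology X X') (prod_topology Y Y') (\<lambda>z. (f (fst z), g (snd z)))"
    using assms(1,2) by (intro continuous_map_pairedI continuous_map_compose[unfolded o_def,
          OF continuous_map_fst] continuous_map_compose[unfolded o_def, OF continuous_map_snd])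
  from closedin_continuous_map_preimage[OF this assms(3)] show ?thesis
    by (rule back_subst[of "closedin _"]) auto
qed

lemma closedin_converse:
  assumes "closedin (prod_topology X Y) R"
  shows "closedin (prod_topology Y X) (R\<inverse>)"
proof -
  have "continuous_map (prod_topology Y X) (prod_topology X Y) (\<lambda>z. (snd z, fst z))"
    by (intro continuous_map_pairedI continuous_map_fst continuous_map_snd)
  from closedin_continuous_map_preimage[OF this assms]
  have "closedin (prod_topology Y X) {z \<in> topspace (prod_topology Y X). (snd z, fst z) \<in> R}" .
  moreover have "{z \<in> topspace (prod_topology Y X). (snd z, fst z) \<in> R} = R\<inverse>"
    using closedin_subset[OF assms] by auto
  ultimately show ?thesis by simp
qed

text \<open>Maps from compact to Hausdorff spaces are closed. This pushes relations down to
  quotients, whereas \<open>closedin_vimage_pair\<close> pulls them back to covers.\<close>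

lemma closedin_image_pair:
  assumes "compact_space X" "compact_space X'" "Hausdorff_space Y" "Hausdorff_space Y'"
    and "continuous_map X Y f" "continuous_map X' Y' g" "closedin (prod_topology X X') R"
  shows "closedin (prod_topology Y Y') ((\<lambda>(x, x'). (f x, g x')) ` R)"
proof -
  have "continuous_map (prod_topology X X') (prod_topology Y Y') (\<lambda>(x, x'). (f x, g x'))"
    unfolding case_prod_unfold
    using assms(5,6) by (intro continuous_map_pairedI continuous_map_compose[unfolded o_def,
          OF continuous_map_fst] continuous_map_compose[unfolded o_def, OF continuous_map_snd])
  moreover have "compact_space (prod_topology X X')" "Hausdorff_space (prod_topology Y Y')"
    using assms by (simp_all add: compact_space_prod_topology Hausdorff_space_prod_topology)
  ultimately show ?thesis
    using assms(7) continuous_imp_closed_map closed_map_def by blast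
qed

section \<open>Relations in a category of Nachbin spaces\<close>

abbreviation pts :: "'a ordspace \<Rightarrow> 'a set" where
  "pts X \<equiv> topspace (fst X)"

text \<open>Written with \<open>fst\<close> and \<open>snd\<close> in place of tuple patterns, so
  that the simplification rules below apply to objects that are variables.\<close>

definition hom :: "'a ordspace \<Rightarrow> 'a ordspace \<Rightarrow> ('a \<Rightarrow> 'a) set" where
  "hom X Y = {f \<in> extensional (pts X). continuous_map (fst X) (fst Y) f \<and>
    (\<forall>x y. (x, y) \<in> snd X \<longrightarrow> (f x, f y) \<in> snd Y)}"

lemma ordspace_category_simps [simp]:
  "Obj (ordspace_category \<O>) = \<O>"
  "Hom (ordspace_category \<O>) X Y = hom X Y"
  "Ident (ordspace_category \<O>) X = (\<lambda>x\<in>pts X. x)"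
  "Comp (ordspace_category \<O>) X Y Z g f = compose (pts X) g f"
  "Le (ordspace_category \<O>) X Y f g \<longleftrightarrow> (\<forall>x\<in>pts X. (f x, g x) \<in> snd Y)"
  by (simp_all add: ordspace_category_def hom_def split: prod.splits)

lemma hom_pts: "f \<in> hom X Y \<Longrightarrow> x \<in> pts X \<Longrightarrow> f x \<in> pts Y"
  unfolding hom_def using continuous_map_image_subset_topspace by fastforce

lemma hom_mono: "f \<in> hom X Y \<Longrightarrow> (x, y) \<in> snd X \<Longrightarrow> (f x, f y) \<in> snd Y"
  unfolding hom_def by blast

lemma hom_continuous: "f \<in> hom X Y \<Longrightarrow> continuous_map (fst X) (fst Y) f"
  unfolding hom_def by blast

lemma hom_extensional: "f \<in> hom X Y \<Longrightarrow> f \<in> extensional (pts X)"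
  unfolding hom_def by blast

lemma hom_eqI: "f \<in> hom X Y \<Longrightarrow> g \<in> hom X Z \<Longrightarrow> (\<And>x. x \<in> pts X \<Longrightarrow> f x = g x) \<Longrightarrow> f = g"
  by (rule extensionalityI) (auto intro: hom_extensional)

lemma nachbin_spaceD:
  assumes "nachbin_space X"
  shows "compact_space (fst X)" "Hausdorff_space (fst X)"
    "closedin (prod_topology (fst X) (fst X)) (snd X)"
    "x \<in> pts X \<Longrightarrow> (x, x) \<in> snd X"
    "(x, y) \<in> snd X \<Longrightarrow> (y, z) \<in> snd X \<Longrightarrow> (x, z) \<in> snd X"
    "(x, y) \<in> snd X \<Longrightarrow> (y, x) \<in> snd X \<Longrightarrow> x = y"
    "(x, y) \<in> snd X \<Longrightarrow> x \<in> pts X" "(x, y) \<in> snd X \<Longrightarrow> y \<in> pts X"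
proof -
  have "partial_order_on (pts X) (snd X)" "closedin (prod_topology (fst X) (fst X)) (snd X)"
    "compact_space (fst X)"
    using assms by (auto simp: nachbin_space_def ordered_space_def split: prod.splits)
  note * = this partial_order_onD[OF this(1)]
  show "compact_space (fst X)" "closedin (prod_topology (fst X) (fst X)) (snd X)" by fact+
  show "Hausdorff_space (fst X)"
    using nachbin_imp_Hausdorff[of "fst X" "snd X"] assms by simp
  show "x \<in> pts X \<Longrightarrow> (x, x) \<in> snd X" using *(4) by (rule refl_onD)
  show "(x, y) \<in> snd X \<Longrightarrow> (y, z) \<in> snd X \<Longrightarrow> (x, z) \<in> snd X" using *(5) by (rule transD)
  show "(x, y) \<in> snd X \<Longrightarrow> (y, x) \<in> snd X \<Longrightarrow> x = y" using *(6) by (rule antisymD)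
  show "(x, y) \<in> snd X \<Longrightarrow> x \<in> pts X" "(x, y) \<in> snd X \<Longrightarrow> y \<in> pts X"
    using closedin_subset[OF *(2)] by auto
qed

lemma compose_hom:
  assumes X: "nachbin_space X" and f: "f \<in> hom X Y" and g: "g \<in> hom Y Z"
  shows "compose (pts X) g f \<in> hom X Z"
proof -
  have "continuous_map (fst X) (fst Z) (compose (pts X) g f)"
    using continuous_map_compose[OF hom_continuous[OF f] hom_continuous[OF g]]
    by (rule continuous_map_eq) (simp add: compose_def)
  then show ?thesis
    using hom_mono[OF f] hom_mono[OF g] nachbin_spaceD(7,8)[OF X]
    by (auto simp: hom_def compose_def)
qed

lemma restrict_id_hom: "nachbin_space X \<Longrightarrow> (\<lambda>x\<in>pts X. x) \<in> hom X X"
  unfolding hom_def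
  by (auto dest: nachbin_spaceD(7,8) intro: continuous_map_eq[OF continuous_map_id])

lemma pos_category_ordspace:
  assumes "\<And>X. X \<in> \<O> \<Longrightarrow> nachbin_space X"
  shows "pos_category (ordspace_category \<O>)"
proof
  show "Comp (ordspace_category \<O>) W Y Z h (Comp (ordspace_category \<O>) W X Y g f) =
      Comp (ordspace_category \<O>) W X Z (Comp (ordspace_category \<O>) X Y Z h g) f"
    if "f \<in> Hom (ordspace_category \<O>) W X" for W X Y Z f g h
  proof -
    have "f x \<in> pts X" if "x \<in> pts W" for x using hom_pts[OF _ that] \<open>f \<in> Hom _ W X\<close> by simp
    then show ?thesis by (simp add: compose_def cong: restrict_cong)
  qed
  show "f = g" if "X \<in> Obj (ordspace_category \<O>)" "Y \<in> Obj (ordspace_category \<O>)"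
    "f \<in> Hom (ordspace_category \<O>) X Y" "g \<in> Hom (ordspace_category \<O>) X Y"
    "Le (ordspace_category \<O>) X Y f g" "Le (ordspace_category \<O>) X Y g f" for X Y f g
  proof (rule hom_eqI)
    show "f x = g x" if "x \<in> pts X" for x
      using nachbin_spaceD(6)[OF assms, of Y] \<open>Y \<in> Obj _\<close> \<open>Le _ X Y f g\<close> \<open>Le _ X Y g f\<close> that by simp
  qed (use that in simp_all)
  show "Le (ordspace_category \<O>) X Z (Comp (ordspace_category \<O>) X Y Z g f)
      (Comp (ordspace_category \<O>) X Y Z g' f')"
    if "X \<in> Obj (ordspace_category \<O>)" "Y \<in> Obj (ordspace_category \<O>)"
      "Z \<in> Obj (ordspace_category \<O>)" "f \<in> Hom (ordspace_category \<O>) X Y"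
      "f' \<in> Hom (ordspace_category \<O>) X Y" "g \<in> Hom (ordspace_category \<O>) Y Z"
      "g' \<in> Hom (ordspace_category \<O>) Y Z"
      "Le (ordspace_category \<O>) X Y f f'" "Le (ordspace_category \<O>) Y Z g g'"
    for X Y Z f f' g g'
  proof -
    have "(g (f x), g' (f' x)) \<in> snd Z" if "x \<in> pts X" for x
    proof -
      have "(f x, f' x) \<in> snd Y" "f' x \<in> pts Y" using that \<open>Le _ X Y f f'\<close> \<open>f' \<in> Hom _ X Y\<close>
        by (simp_all add: hom_pts)
      then have "(g (f x), g (f' x)) \<in> snd Z" "(g (f' x), g' (f' x)) \<in> snd Z"
        using \<open>g \<in> Hom _ Y Z\<close> \<open>Le _ Y Z g g'\<close> by (auto intro: hom_mono)
      then show ?thesis using nachbin_spaceD(5)[OF assms] \<open>Z \<in> Obj _\<close> by simp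
    qed
    then show ?thesis by (simp add: compose_def)
  qed
next
  fix X Y f assume "X \<in> Obj (ordspace_category \<O>)" "Y \<in> Obj (ordspace_category \<O>)"
    and f: "f \<in> Hom (ordspace_category \<O>) X Y"
  then have X: "nachbin_space X" and Y: "nachbin_space Y" and f: "f \<in> hom X Y"
    using assms by simp_all
  have "compose (pts X) (\<lambda>y\<in>pts Y. y) f = f"
    using f by (intro hom_eqI[OF compose_hom[OF X f restrict_id_hom[OF Y]] f])
      (simp add: compose_def hom_pts)
  moreover have "compose (pts X) f (\<lambda>x\<in>pts X. x) = f"
    by (intro hom_eqI[OF compose_hom[OF X restrict_id_hom[OF X] f] f]) (simp add: compose_def)
  ultimately show "Comp (ordspace_category \<O>) X Y Y (Ident (ordspace_category \<O>) Y) f = f"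
    "Comp (ordspace_category \<O>) X X Y f (Ident (ordspace_category \<O>) X) = f"
    by simp_all
next
  fix X Y f g h assume "X \<in> Obj (ordspace_category \<O>)" "Y \<in> Obj (ordspace_category \<O>)"
    "Le (ordspace_category \<O>) X Y f g" "Le (ordspace_category \<O>) X Y g h"
  then show "Le (ordspace_category \<O>) X Y f h"
    using nachbin_spaceD(5)[OF assms, of Y] unfolding ordspace_category_simps by blast
next
  fix X Y Z f g assume "X \<in> Obj (ordspace_category \<O>)" "f \<in> Hom (ordspace_category \<O>) X Y"
    "g \<in> Hom (ordspace_category \<O>) Y Z"
  then show "Comp (ordspace_category \<O>) X Y Z g f \<in> Hom (ordspace_category \<O>) X Z"
    using compose_hom[OF assms] by simp
next
  fix X Y f assume "Y \<in> Obj (ordspace_category \<O>)" "f \<in> Hom (ordspace_category \<O>) X Y"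
  then show "Le (ordspace_category \<O>) X Y f f"
    using nachbin_spaceD(4)[OF assms] hom_pts[of f X Y] by simp
next
  fix X assume "X \<in> Obj (ordspace_category \<O>)"
  then show "Ident (ordspace_category \<O>) X \<in> Hom (ordspace_category \<O>) X X"
    using restrict_id_hom[OF assms] by simp
qed

section \<open>Spans of maps and the closed relations that they represent\<close>

definition graph :: "('a ordspace, 'a \<Rightarrow> 'a) span \<Rightarrow> 'a rel" where
  "graph = (\<lambda>(R, r0, r1). (\<lambda>a. (r0 a, r1 a)) ` pts R)"

lemma graph_simp: "graph (R, r0, r1) = (\<lambda>a. (r0 a, r1 a)) ` pts R"
  by (simp add: graph_def)

text \<open>Points have the fixed type \<open>'a\<close>, so a product cannot literally consist of
  pairs. It is given by projections whose pairing is onto and reflects the order; injectivity of the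
  pairing follows by antisymmetry. Closed subspaces of products represent relations; closed
  subspaces also serve as images and as one-point test objects.\<close>

locale nachbin_category =
  fixes \<O> :: "'a ordspace set"
  assumes nachbin: "X \<in> \<O> \<Longrightarrow> nachbin_space X"
    and closed_subspace: "\<lbrakk>X \<in> \<O>; closedin (fst X) A\<rbrakk> \<Longrightarrow> (subtopology (fst X) A, snd X \<inter> A \<times> A) \<in> \<O>"
    and binary_product: "\<lbrakk>X \<in> \<O>; Y \<in> \<O>\<rbrakk> \<Longrightarrow> \<exists>P\<in>\<O>. \<exists>p\<in>hom P X. \<exists>q\<in>hom P Y.
      graph (P, p, q) = pts X \<times> pts Y \<and>
      (\<forall>a\<in>pts P. \<forall>b\<in>pts P. (p a, p b) \<in> snd X \<and> (q a, q b) \<in> snd Y \<longrightarrow> (a, b) \<in> snd P)"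
begin

abbreviation "\<C> \<equiv> ordspace_category \<O>"

text \<open>The concrete form of a jointly order-monic pair. Relations, products and pullbacks are
  all of this kind, and so are ff-morphisms when the two legs coincide.\<close>

definition monic_span :: "'a ordspace \<Rightarrow> 'a ordspace \<Rightarrow> ('a ordspace, 'a \<Rightarrow> 'a) span \<Rightarrow> bool" where
  "monic_span X Y = (\<lambda>(R, r0, r1). R \<in> \<O> \<and> r0 \<in> hom R X \<and> r1 \<in> hom R Y \<and>
    (\<forall>a\<in>pts R. \<forall>b\<in>pts R. (r0 a, r0 b) \<in> snd X \<and> (r1 a, r1 b) \<in> snd Y \<longrightarrow> (a, b) \<in> snd R))"

lemma monic_spanD:
  assumes "monic_span X Y (R, r0, r1)"
  shows "R \<in> \<O>" "r0 \<in> hom R X" "r1 \<in> hom R Y"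
    "\<lbrakk>a \<in> pts R; b \<in> pts R; (r0 a, r0 b) \<in> snd X; (r1 a, r1 b) \<in> snd Y\<rbrakk> \<Longrightarrow> (a, b) \<in> snd R"
  using assms by (auto simp: monic_span_def)

lemma monic_span_inj:
  assumes S: "monic_span X Y (R, r0, r1)" and XY: "X \<in> \<O>" "Y \<in> \<O>"
    and ab: "a \<in> pts R" "b \<in> pts R" "r0 a = r0 b" "r1 a = r1 b"
  shows "a = b"
proof -
  note s = monic_spanD[OF S]
  have "(r0 a, r0 a) \<in> snd X" "(r1 a, r1 a) \<in> snd Y"
    using nachbin_spaceD(4)[OF nachbin] XY hom_pts[OF s(2)] hom_pts[OF s(3)] ab by blast+
  then have "(a, b) \<in> snd R" "(b, a) \<in> snd R" using s(4) ab by auto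
  then show ?thesis using nachbin_spaceD(6)[OF nachbin[OF s(1)]] by blast
qed

text \<open>A lift can be chosen pointwise, and joint injectivity makes it unique. Its graph is cut
  out by two equations between continuous maps into Hausdorff spaces, hence closed, so compactness
  of \<open>R\<close> makes the lift continuous. It is monotone because the span reflects the
  order.\<close>

lemma monic_span_lift:
  assumes S: "monic_span X Y (R, r0, r1)" and XY: "X \<in> \<O>" "Y \<in> \<O>" "A \<in> \<O>"
    and x: "x \<in> hom A X" and y: "y \<in> hom A Y"
    and sub: "graph (A, x, y) \<subseteq> graph (R, r0, r1)"
  obtains h where "h \<in> hom A R" "\<And>a. a \<in> pts A \<Longrightarrow> r0 (h a) = x a" "\<And>a. a \<in> pts A \<Longrightarrow> r1 (h a) = y a"
proof -
  note s = monic_spanD[OF S]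
  have "\<exists>c\<in>pts R. r0 c = x a \<and> r1 c = y a" if "a \<in> pts A" for a
    using sub that unfolding graph_simp by (force simp: image_iff)
  then obtain g where g: "\<And>a. a \<in> pts A \<Longrightarrow> g a \<in> pts R \<and> r0 (g a) = x a \<and> r1 (g a) = y a"
    by metis
  define h where "h = restrict g (pts A)"
  have h: "h a \<in> pts R" "r0 (h a) = x a" "r1 (h a) = y a" if "a \<in> pts A" for a
    using g that by (auto simp: h_def)
  let ?P = "prod_topology (fst A) (fst R)"
  have fs: "continuous_map ?P Z (\<lambda>t. f (fst t))" if "continuous_map (fst A) Z f"
      for Z :: "'a topology" and f
    using continuous_map_compose[OF continuous_map_fst that] by (simp add: o_def)
  have sn: "continuous_map ?P Z (\<lambda>t. f (snd t))" if "continuous_map (fst R) Z f"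
      for Z :: "'a topology" and f
    using continuous_map_compose[OF continuous_map_snd that] by (simp add: o_def)
  have "closedin ?P ({t \<in> topspace ?P. x (fst t) = r0 (snd t)} \<inter> {t \<in> topspace ?P. y (fst t) =
      r1 (snd t)})"
    by (intro closedin_Int closedin_continuous_maps_eq[OF nachbin_spaceD(2)[OF nachbin[OF XY(1)]]]
        closedin_continuous_maps_eq[OF nachbin_spaceD(2)[OF nachbin[OF XY(2)]]]
        fs[OF hom_continuous[OF x]] fs[OF hom_continuous[OF y]]
        sn[OF hom_continuous[OF s(2)]] sn[OF hom_continuous[OF s(3)]])
  moreover have "{t \<in> topspace ?P. x (fst t) = r0 (snd t)} \<inter> {t \<in> topspace ?P. y (fst t) =
      r1 (snd t)}
      = (\<lambda>a. (a, h a)) ` pts A" (is "?L = ?R")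
  proof (intro equalityI subsetI)
    fix t assume "t \<in> ?L"
    then have t: "fst t \<in> pts A" "snd t \<in> pts R" "x (fst t) = r0 (snd t)" "y (fst t) = r1 (snd t)"
      by auto
    then have "snd t = h (fst t)" by (rule_tac monic_span_inj[OF S XY(1,2)]) (simp_all add: h)
    then have "t = (fst t, h (fst t))" by (simp add: prod_eq_iff)
    then show "t \<in> ?R" using t(1) by (rule image_eqI)
  next
    fix t assume "t \<in> ?R"
    then show "t \<in> ?L" using h by auto
  qed
  ultimately have "continuous_map (fst A) (fst R) h"
    using h(1) nachbin_spaceD(1)[OF nachbin[OF s(1)]]
    by (intro continuous_map_if_closed_graph) auto
  moreover have "(h a, h b) \<in> snd R" if ab: "(a, b) \<in> snd A" for a b
  proof -
    have "a \<in> pts A" "b \<in> pts A" using ab nachbin_spaceD(7,8)[OF nachbin[OF XY(3)]] by blast+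
    moreover have "(x a, x b) \<in> snd X" "(y a, y b) \<in> snd Y"
      using hom_mono[OF x ab] hom_mono[OF y ab] .
    ultimately show ?thesis by (intro s(4)) (simp_all add: h)
  qed
  ultimately have "h \<in> hom A R" by (auto simp: hom_def h_def)
  then show ?thesis using that h by blast
qed

lemma graph_closed:
  assumes "R \<in> \<O>" "X \<in> \<O>" "Y \<in> \<O>" "r0 \<in> hom R X" "r1 \<in> hom R Y"
  shows "closedin (prod_topology (fst X) (fst Y)) (graph (R, r0, r1))"
proof -
  have "closed_map (fst R) (prod_topology (fst X) (fst Y)) (\<lambda>a. (r0 a, r1 a))"
    using assms nachbin_spaceD(1,2)[OF nachbin]
    by (intro continuous_imp_closed_map continuous_map_pairedI hom_continuous)
      (auto simp: Hausdorff_space_prod_topology)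
  then show ?thesis by (simp add: graph_simp closed_map_def)
qed

text \<open>The representing object is the preimage of \<open>G\<close> in a product
  \<open>P\<close>, a closed subspace; its legs jointly reflect the order because the projections of
  \<open>P\<close> do.\<close>

lemma monic_span_exists:
  assumes XY: "X \<in> \<O>" "Y \<in> \<O>" and G: "closedin (prod_topology (fst X) (fst Y)) G"
  obtains R r0 r1 where "monic_span X Y (R, r0, r1)" "graph (R, r0, r1) = G"
proof -
  obtain P p q where P: "P \<in> \<O>" and p: "p \<in> hom P X" and q: "q \<in> hom P Y"
    and im: "graph (P, p, q) = pts X \<times> pts Y"
    and ref: "\<And>a b. \<lbrakk>a \<in> pts P; b \<in> pts P; (p a, p b) \<in> snd X; (q a, q b) \<in> snd Y\<rbrakk> \<Longrightarrow> (a, b) \<in> snd P"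
    using binary_product[OF XY] by metis
  define A where "A = {a \<in> pts P. (p a, q a) \<in> G}"
  have A: "closedin (fst P) A"
    unfolding A_def
    by (intro closedin_continuous_map_preimage[OF _ G] continuous_map_pairedI hom_continuous[OF p]
        hom_continuous[OF q])
  define R where "R = (subtopology (fst P) A, snd P \<inter> A \<times> A)"
  have R: "R \<in> \<O>" unfolding R_def by (rule closed_subspace[OF P A])
  have ptsR: "pts R = A" using closedin_subset[OF A] by (auto simp: R_def)
  have res: "restrict f A \<in> hom R Z" if f: "f \<in> hom P Z" for f Z
  proof -
    have "continuous_map (fst R) (fst Z) (restrict f A)"
      using continuous_map_from_subtopology[OF hom_continuous[OF f], of A]
      unfolding R_def fst_conv by (rule continuous_map_eq) auto
    then show ?thesis using hom_mono[OF f] unfolding hom_def ptsR by (auto simp: R_def)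
  qed
  have "monic_span X Y (R, restrict p A, restrict q A)"
    using R res[OF p] res[OF q] ref closedin_subset[OF A]
    unfolding monic_span_def by (auto simp: ptsR) (auto simp: R_def)
  moreover have "graph (R, restrict p A, restrict q A) = G"
  proof -
    have "graph (R, restrict p A, restrict q A) = (\<lambda>a. (p a, q a)) ` A"
      by (simp add: graph_simp ptsR)
    also have "\<dots> = graph (P, p, q) \<inter> G" by (auto simp: graph_simp A_def)
    finally show ?thesis using closedin_subset[OF G] im by auto
  qed
  ultimately show ?thesis by (rule that)
qed

text \<open>Points of a space are probed by morphisms out of its one-point subspaces.\<close>

definition point_space :: "'a ordspace \<Rightarrow> 'a \<Rightarrow> 'a ordspace" where
  "point_space X x = (subtopology (fst X) {x}, snd X \<inter> {x} \<times> {x})"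

lemma point_space:
  assumes "X \<in> \<O>" "x \<in> pts X"
  shows "point_space X x \<in> \<O>" "pts (point_space X x) = {x}"
proof -
  have "closedin (fst X) {x}"
    by (rule closedin_Hausdorff_singleton[OF nachbin_spaceD(2)[OF nachbin[OF assms(1)]] assms(2)])
  then show "point_space X x \<in> \<O>" unfolding point_space_def by (rule closed_subspace[OF assms(1)])
  show "pts (point_space X x) = {x}"
    using assms(2) unfolding point_space_def fst_conv topspace_subtopology by blast
qed

lemma const_hom:
  assumes "X \<in> \<O>" "x \<in> pts X" "Y \<in> \<O>" "y \<in> pts Y"
  shows "(\<lambda>_\<in>{x}. y) \<in> hom (point_space X x) Y"
proof -
  have "continuous_map (fst (point_space X x)) (fst Y) (\<lambda>_\<in>{x}. y)"
  proof (rule continuous_map_eq)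
    show "continuous_map (fst (point_space X x)) (fst Y) (\<lambda>_. y)" using assms(4) by simp
  qed (simp add: point_space(2)[OF assms(1,2)])
  moreover have "(\<lambda>_\<in>{x}. y) \<in> extensional (pts (point_space X x))"
    unfolding point_space(2)[OF assms(1,2)] by (rule restrict_extensional)
  ultimately show ?thesis
    using nachbin_spaceD(4)[OF nachbin[OF assms(3)] assms(4)]
    unfolding hom_def by (simp add: point_space_def)
qed

section \<open>Order embeddings, surjections and finite limits\<close>

lemma jointly_order_monic_iff:
  assumes "P \<in> \<O>" "X \<in> \<O>" "Y \<in> \<O>" "p \<in> hom P X" "q \<in> hom P Y"
  shows "jointly_order_monic \<C> P X Y p q \<longleftrightarrow> monic_span X Y (P, p, q)"
proof
  assume m: "jointly_order_monic \<C> P X Y p q"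
  have "(a, b) \<in> snd P"
    if ab: "a \<in> pts P" "b \<in> pts P" "(p a, p b) \<in> snd X" "(q a, q b) \<in> snd Y" for a b
  proof -
    \<comment> \<open>Joint monicity is tested on the two constant maps with values \<open>a\<close>
      and \<open>b\<close>, defined on the one-point subspace at \<open>a\<close>.\<close>
    note [simp] = point_space[OF assms(1) ab(1)]
    have "\<forall>x\<in>pts (point_space P a). ((\<lambda>_\<in>{a}. a) x, (\<lambda>_\<in>{a}. b) x) \<in> snd P"
      using m[unfolded jointly_order_monic_def, simplified, rule_format, OF point_space(1)[OF
          assms(1) ab(1)]
          const_hom[OF assms(1) ab(1) assms(1) ab(1)] const_hom[OF assms(1) ab(1) assms(1) ab(2)]]
              ab
      by (simp add: compose_def)
    then show ?thesis by simp
  qed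
  then show "monic_span X Y (P, p, q)" using assms by (simp add: monic_span_def)
next
  assume S: "monic_span X Y (P, p, q)"
  show "jointly_order_monic \<C> P X Y p q"
    unfolding jointly_order_monic_def ordspace_category_simps
  proof (intro ballI impI)
    fix A u v a assume u: "u \<in> hom A P" and v: "v \<in> hom A P" and a: "a \<in> pts A"
      and "(\<forall>x\<in>pts A. (compose (pts A) p u x, compose (pts A) p v x) \<in> snd X) \<and>
       (\<forall>x\<in>pts A. (compose (pts A) q u x, compose (pts A) q v x) \<in> snd Y)"
    then show "(u a, v a) \<in> snd P"
      using monic_spanD(4)[OF S hom_pts[OF u a] hom_pts[OF v a]] a by (simp add: compose_def)
  qed
qed

text \<open>Being an ff-morphism is joint order-monicity of a single map, encoded as a span with two
  equal legs so that the lifting lemma covers it.\<close>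

lemma ff_morphism_iff_monic_span:
  assumes "X \<in> \<O>" "Y \<in> \<O>"
  shows "ff_morphism \<C> X Y m \<longleftrightarrow> monic_span Y Y (X, m, m)"
proof -
  have "ff_morphism \<C> X Y m \<longleftrightarrow> m \<in> hom X Y \<and> jointly_order_monic \<C> X Y Y m m"
    by (simp add: ff_morphism_def jointly_order_monic_def)
  also have "\<dots> \<longleftrightarrow> monic_span Y Y (X, m, m)"
    using jointly_order_monic_iff[OF assms(1,2,2)] by (auto simp: monic_span_def)
  finally show ?thesis .
qed

text \<open>The common universal property behind products, pullbacks and inclusions of relations,
  which differ only in the graph concerned.\<close>

lemma monic_span_universal:
  assumes S: "monic_span X Y (T, t0, t1)" and XY: "X \<in> \<O>" "Y \<in> \<O>" "A \<in> \<O>"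
    and a: "a \<in> hom A X" and b: "b \<in> hom A Y" and sub: "graph (A, a, b) \<subseteq> graph (T, t0, t1)"
  shows "\<exists>!u. u \<in> hom A T \<and> compose (pts A) t0 u = a \<and> compose (pts A) t1 u = b"
proof -
  note s = monic_spanD[OF S]
  obtain h where h: "h \<in> hom A T" "\<And>x. x \<in> pts A \<Longrightarrow> t0 (h x) = a x" "\<And>x. x \<in> pts A \<Longrightarrow> t1 (h x) = b x"
    using monic_span_lift[OF S XY a b sub] by blast
  have eq: "compose (pts A) t0 u = a \<longleftrightarrow> (\<forall>x\<in>pts A. t0 (u x) = a x)"
    "compose (pts A) t1 u = b \<longleftrightarrow> (\<forall>x\<in>pts A. t1 (u x) = b x)" for u
    using hom_extensional[OF a] hom_extensional[OF b]
    by (force simp: compose_def restrict_def fun_eq_iff extensional_def)+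
  show ?thesis
    unfolding eq
  proof (rule ex1I[of _ h])
    fix u assume u: "u \<in> hom A T \<and> (\<forall>x\<in>pts A. t0 (u x) = a x) \<and> (\<forall>x\<in>pts A. t1 (u x) = b x)"
    show "u = h"
    proof (rule hom_eqI[of u A T h T])
      show "u x = h x" if x: "x \<in> pts A" for x
        using u h(2,3) x hom_pts[OF _ x] h(1) by (rule_tac monic_span_inj[OF S XY(1,2)]) simp_all
    qed (use u h in simp_all)
  qed (use h in simp)
qed

lemma is_productD:
  assumes "is_product \<C> X Y P p q" "X \<in> \<O>" "Y \<in> \<O>"
  shows "monic_span X Y (P, p, q)"
  using assms jointly_order_monic_iff[of P X Y p q] by (simp add: is_product_def)

lemma product_exists:
  assumes XY: "X \<in> \<O>" "Y \<in> \<O>"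
  obtains P p q where "is_product \<C> X Y P p q"
proof -
  have "closedin (prod_topology (fst X) (fst Y)) (pts X \<times> pts Y)"
      by (simp add: closedin_prod_Times_iff)
  then obtain P p q where P: "monic_span X Y (P, p, q)" "graph (P, p, q) = pts X \<times> pts Y"
    using monic_span_exists[OF XY] by blast
  have "graph (A, a, b) \<subseteq> graph (P, p, q)" if "a \<in> hom A X" "b \<in> hom A Y" for A a b
    using hom_pts[OF that(1)] hom_pts[OF that(2)] unfolding P(2) by (auto simp: graph_simp)
  then have "is_product \<C> X Y P p q"
    using monic_span_universal[OF P(1) XY] monic_spanD[OF P(1)] jointly_order_monic_iff[OF _ XY,
        of P p q] P(1)
    by (simp add: is_product_def)
  then show ?thesis by (rule that)
qed

text \<open>Product projections preserve and jointly reflect the order, so the pairing into a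
  product reflects the order exactly when the two legs do so jointly. This removes the choice of a
  product from the notion of relation.\<close>

lemma rel_span_iff:
  assumes XY: "X \<in> \<O>" "Y \<in> \<O>"
  shows "rel_span \<C> X Y s \<longleftrightarrow> monic_span X Y s"
proof -
  obtain R r0 r1 where s: "s = (R, r0, r1)" by (cases s) auto
  show ?thesis
  proof
    assume "rel_span \<C> X Y s"
    then obtain P p q m where R: "R \<in> \<O>" and P: "is_product \<C> X Y P p q"
        and m: "ff_morphism \<C> R P m"
      and r: "r0 = compose (pts R) p m" "r1 = compose (pts R) q m"
      by (auto simp: rel_span_def s)
    note P' = is_productD[OF P XY]
    have PO: "P \<in> \<O>" and p: "p \<in> hom P X" and q: "q \<in> hom P Y" using monic_spanD[OF P'] by blast+
    have m': "monic_span P P (R, m, m)" using m ff_morphism_iff_monic_span[OF R PO] by blast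
    note mh = monic_spanD(2)[OF m']
    have "(a, b) \<in> snd R" if ab: "a \<in> pts R" "b \<in> pts R"
        and le: "(r0 a, r0 b) \<in> snd X" "(r1 a, r1 b) \<in> snd Y" for a b
    proof -
      have "(m a, m b) \<in> snd P"
        using le ab unfolding r
            by (intro monic_spanD(4)[OF P'] hom_pts[OF mh]) (simp_all add: compose_def)
      then show ?thesis using monic_spanD(4)[OF m' ab] by blast
    qed
    moreover have "r0 \<in> hom R X" "r1 \<in> hom R Y"
      unfolding r using compose_hom[OF nachbin[OF R] mh] p q by blast+
    ultimately show "monic_span X Y s" using R by (simp add: s monic_span_def)
  next
    assume "monic_span X Y s"
    note S = this[unfolded s] and s' = monic_spanD[OF this[unfolded s]]
    obtain P p q where P: "is_product \<C> X Y P p q" using product_exists[OF XY] .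
    note P' = is_productD[OF P XY]
    obtain m where m: "m \<in> hom R P" "compose (pts R) p m = r0" "compose (pts R) q m = r1"
      using P s'(1-3) unfolding is_product_def ordspace_category_simps by blast
    have "(a, b) \<in> snd R" if ab: "a \<in> pts R" "b \<in> pts R" and le: "(m a, m b) \<in> snd P" for a b
    proof (rule s'(4)[OF ab])
      show "(r0 a, r0 b) \<in> snd X" "(r1 a, r1 b) \<in> snd Y"
        using hom_mono[OF monic_spanD(2)[OF P'] le] hom_mono[OF monic_spanD(3)[OF P'] le] ab
        unfolding m(2,3)[symmetric] by (simp_all add: compose_def)
    qed
    then have "monic_span P P (R, m, m)" using s'(1) m(1) by (simp add: monic_span_def)
    then have "ff_morphism \<C> R P m" using ff_morphism_iff_monic_span s'(1) monic_spanD(1)[OF P']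
        by blast
    then show "rel_span \<C> X Y s" using P m(2,3) s'(1)
      unfolding s rel_span_def prod.case ordspace_category_simps by blast
  qed
qed

text \<open>A commutative square is a span whose graph lies in the fibre product. One-point objects
  show that a pullback reaches every point of the fibre product; conversely
  \<open>monic_span_universal\<close> supplies the universal property.\<close>

lemma is_pullback_iff:
  assumes RSY: "R \<in> \<O>" "S \<in> \<O>" "Y \<in> \<O>" and f: "f \<in> hom R Y" and g: "g \<in> hom S Y"
  shows "is_pullback \<C> R S Y f g T t0 t1 \<longleftrightarrow> monic_span R S (T, t0, t1) \<and>
    graph (T, t0, t1) = {(a, b). a \<in> pts R \<and> b \<in> pts S \<and> f a = g b}" (is "?L \<longleftrightarrow> ?J \<and> _ = ?G")
proof -
  have comm: "compose (pts A) f a = compose (pts A) g b \<longleftrightarrow> graph (A, a, b) \<subseteq> ?G"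
    if "a \<in> hom A R" "b \<in> hom A S" for A a b
    using hom_pts[OF that(1)] hom_pts[OF that(2)]
    by (auto simp: graph_simp compose_def restrict_def fun_eq_iff)
  show ?thesis
  proof (intro iffI conjI; (elim conjE)?)
    assume L: ?L
    then have T: "T \<in> \<O>" "t0 \<in> hom T R" "t1 \<in> hom T S" "compose (pts T) f t0 = compose (pts T) g t1"
      and uni: "\<And>A a b. \<lbrakk>A \<in> \<O>; a \<in> hom A R; b \<in> hom A S; compose (pts A) f a = compose (pts A) g b\<rbrakk>
        \<Longrightarrow> \<exists>u. u \<in> hom A T \<and> compose (pts A) t0 u = a \<and> compose (pts A) t1 u = b"
      and jom: "jointly_order_monic \<C> T R S t0 t1"
      unfolding is_pullback_def ordspace_category_simps by blast+
    show ?J using jom jointly_order_monic_iff[OF T(1) RSY(1,2) T(2,3)] by blast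
    show "graph (T, t0, t1) = ?G"
    proof (intro equalityI subsetI)
      show "x \<in> ?G" if "x \<in> graph (T, t0, t1)" for x using comm[OF T(2,3)] T(4) that by blast
      fix x assume "x \<in> ?G"
      then obtain a b where x: "x = (a, b)" and ab: "a \<in> pts R" "b \<in> pts S" "f a = g b" by blast
      note o = point_space[OF RSY(1) ab(1)]
      have "compose {a} f (\<lambda>_\<in>{a}. a) = compose {a} g (\<lambda>_\<in>{a}. b)"
        using ab(3) by (simp add: compose_def cong: restrict_cong)
      then obtain u where u: "u \<in> hom (point_space R a) T" "compose {a} t0 u = (\<lambda>_\<in>{a}. a)"
        "compose {a} t1 u = (\<lambda>_\<in>{a}. b)"
        using uni[OF o(1) const_hom[OF RSY(1) ab(1) RSY(1) ab(1)] const_hom[OF RSY(1) ab(1) RSY(2)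
            ab(2)]]
        unfolding o(2) by blast
      have "t0 (u a) = a" "t1 (u a) = b" "u a \<in> pts T"
        using fun_cong[OF u(2), of a] fun_cong[OF u(3), of a] hom_pts[OF u(1), of a] o(2)
        by (simp_all add: compose_def)
      then show "x \<in> graph (T, t0, t1)" unfolding x graph_simp
          by (intro image_eqI[of _ _ "u a"]) simp_all
    qed
  next
    assume J: ?J and G: "graph (T, t0, t1) = ?G"
    note t = monic_spanD(1-3)[OF J]
    show ?L
      unfolding is_pullback_def ordspace_category_simps
    proof (intro conjI ballI impI t)
      show "compose (pts T) f t0 = compose (pts T) g t1" using comm[OF t(2,3)] G by blast
      show "jointly_order_monic \<C> T R S t0 t1"
          using J jointly_order_monic_iff[OF t(1) RSY(1,2) t(2,3)] by blast
      fix A a b assume A: "A \<in> \<O>" and a: "a \<in> hom A R" and b: "b \<in> hom A S"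
        and "compose (pts A) f a = compose (pts A) g b"
      then have "graph (A, a, b) \<subseteq> graph (T, t0, t1)" using comm[OF a b] G by simp
      then show "\<exists>!u. u \<in> hom A T \<and> compose (pts A) t0 u = a \<and> compose (pts A) t1 u = b"
        by (rule monic_span_universal[OF J RSY(1,2) A a b])
    qed
  qed
qed

text \<open>With the induced topology and order, the image is a closed subspace because
  \<open>A\<close> is compact and \<open>B\<close> is Hausdorff. Hence it is an object against which
  so-morphisms can be tested.\<close>

lemma image_factorization:
  assumes "A \<in> \<O>" "B \<in> \<O>" "e \<in> hom A B"
  defines "I \<equiv> (subtopology (fst B) (e ` pts A), snd B \<inter> (e ` pts A) \<times> (e ` pts A))"
  shows "I \<in> \<O>" "pts I = e ` pts A" "e \<in> hom A I" "ff_morphism \<C> I B (\<lambda>x\<in>pts I. x)"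
proof -
  have sub: "e ` pts A \<subseteq> pts B" using hom_pts[OF assms(3)] by blast
  have "closed_map (fst A) (fst B) e"
    using nachbin_spaceD(1)[OF nachbin[OF assms(1)]] nachbin_spaceD(2)[OF nachbin[OF assms(2)]]
      hom_continuous[OF assms(3)] by (simp add: continuous_imp_closed_map)
  then have "closedin (fst B) (e ` pts A)" by (simp add: closed_map_def)
  then show I: "I \<in> \<O>" unfolding I_def by (rule closed_subspace[OF assms(2)])
  show pI: "pts I = e ` pts A" using sub by (auto simp: I_def)
  have "continuous_map (fst A) (fst I) e"
    using hom_continuous[OF assms(3)]
        by (simp add: I_def continuous_map_in_subtopology image_subset_iff_funcset)
  moreover have "(e x, e y) \<in> snd I" if "(x, y) \<in> snd A" for x y
    using hom_mono[OF assms(3) that] nachbin_spaceD(7,8)[OF nachbin[OF assms(1)] that]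
        by (simp add: I_def)
  ultimately show "e \<in> hom A I" using hom_extensional[OF assms(3)] by (simp add: hom_def)
  have "continuous_map (fst I) (fst B) (\<lambda>x\<in>pts I. x)"
    by (rule continuous_map_eq[of _ _ "\<lambda>x. x"])
      (simp_all add: I_def continuous_map_from_subtopology continuous_map_id[unfolded id_def])
  moreover have "((\<lambda>x\<in>pts I. x) x, (\<lambda>x\<in>pts I. x) y) \<in> snd B" if "(x, y) \<in> snd I" for x y
    using that pI by (simp add: I_def)
  ultimately have "(\<lambda>x\<in>pts I. x) \<in> hom I B" by (simp add: hom_def)
  moreover have "(a, b) \<in> snd I" if "a \<in> pts I" "b \<in> pts I" "(a, b) \<in> snd B" for a b
    using that pI by (simp add: I_def)
  ultimately have "monic_span B B (I, \<lambda>x\<in>pts I. x, \<lambda>x\<in>pts I. x)" using I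
      by (simp add: monic_span_def)
  then show "ff_morphism \<C> I B (\<lambda>x\<in>pts I. x)" using ff_morphism_iff_monic_span[OF I assms(2)]
      by blast
qed

text \<open>Orthogonality to the inclusion of the image of \<open>e\<close> gives a map from
  \<open>B\<close> into that image whose composite with the inclusion is the identity, so the image
  is everything. Conversely, if \<open>e\<close> is onto, a commutative square forces the values of
  \<open>v\<close> to be values of \<open>m\<close>, and \<open>monic_span_lift\<close> provides a
  continuous filler.\<close>

lemma so_morphism_iff:
  assumes AB: "A \<in> \<O>" "B \<in> \<O>"
  shows "so_morphism \<C> A B e \<longleftrightarrow> e \<in> hom A B \<and> e ` pts A = pts B"
proof (intro iffI conjI; (elim conjE)?)
  assume so: "so_morphism \<C> A B e"
  then show e: "e \<in> hom A B" by (simp add: so_morphism_def)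
  define I where "I = (subtopology (fst B) (e ` pts A), snd B \<inter> (e ` pts A) \<times> (e ` pts A))"
  note I = image_factorization[OF AB e, folded I_def]
  let ?m = "\<lambda>x\<in>pts I. x" and ?v = "\<lambda>x\<in>pts B. x"
  have "bij_betw (\<lambda>h. (compose (pts A) h e, compose (pts B) ?m h)) (hom B I)
      {(u, v). u \<in> hom A I \<and> v \<in> hom B B \<and> compose (pts A) ?m u = compose (pts A) v e}"
    using so I(1,4) AB(2) unfolding so_morphism_def ordspace_category_simps by blast
  moreover have "compose (pts A) ?m e = compose (pts A) ?v e"
    using hom_pts[OF e] hom_pts[OF I(3)] by (simp add: compose_def restrict_def fun_eq_iff)
  ultimately have "(e, ?v) \<in> (\<lambda>h. (compose (pts A) h e, compose (pts B) ?m h)) ` hom B I"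
    using restrict_id_hom[OF nachbin[OF AB(2)]] I(3) by (simp add: bij_betw_def)
  then obtain h where h: "h \<in> hom B I" "?v = compose (pts B) ?m h" by blast
  have "b \<in> e ` pts A" if b: "b \<in> pts B" for b
    using fun_cong[OF h(2), of b] b hom_pts[OF h(1) b] I(2) by (simp add: compose_def)
  then show "e ` pts A = pts B" using hom_pts[OF e] by blast
next
  assume e: "e \<in> hom A B" and surj: "e ` pts A = pts B"
  show "so_morphism \<C> A B e"
    unfolding so_morphism_def ordspace_category_simps
  proof (intro conjI ballI allI impI e)
    fix X Y m assume X: "X \<in> \<O>" and Y: "Y \<in> \<O>" and m: "ff_morphism \<C> X Y m"
    have J: "monic_span Y Y (X, m, m)" using m ff_morphism_iff_monic_span[OF X Y] by blast
    note mh = monic_spanD(2)[OF J]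
    have cancel: "h b = h' b" if "compose (pts A) h e = compose (pts A) h' e" "b \<in> pts B" for h h' b
    proof -
      obtain a where "a \<in> pts A" "b = e a" using surj \<open>b \<in> pts B\<close> by blast
      then show ?thesis using fun_cong[OF that(1), of a] by (simp add: compose_def)
    qed
    show "bij_betw (\<lambda>h. (compose (pts A) h e, compose (pts B) m h)) (hom B X)
      {(u, v). u \<in> hom A X \<and> v \<in> hom B Y \<and> compose (pts A) m u = compose (pts A) v e}"
      unfolding bij_betw_def
    proof (intro conjI inj_onI equalityI subsetI)
      show "h = h'" if "h \<in> hom B X" "h' \<in> hom B X"
        "(compose (pts A) h e, compose (pts B) m h) =
            (compose (pts A) h' e, compose (pts B) m h')" for h h'
      proof (rule hom_eqI[OF that(1,2)])
        show "h b = h' b" if "b \<in> pts B" for b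
          by (rule cancel[OF conjunct1[OF \<open>(_, _) = (_, _)\<close>[unfolded prod.inject]] that])
      qed
    next
      fix z assume "z \<in> (\<lambda>h. (compose (pts A) h e, compose (pts B) m h)) ` hom B X"
      then obtain h where h: "h \<in> hom B X" "z = (compose (pts A) h e, compose (pts B) m h)" by blast
      have "compose (pts A) m (compose (pts A) h e) = compose (pts A) (compose (pts B) m h) e"
        using hom_pts[OF e] by (simp add: compose_def restrict_def fun_eq_iff)
      then show "z \<in> {(u, v). u \<in> hom A X \<and> v \<in> hom B Y \<and> compose (pts A) m u =
          compose (pts A) v e}"
        using h compose_hom[OF nachbin[OF AB(1)] e h(1)] compose_hom[OF nachbin[OF AB(2)] h(1) mh]
            by simp
    next
      fix z assume "z \<in> {(u, v). u \<in> hom A X \<and> v \<in> hom B Y \<and> compose (pts A) m u =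
          compose (pts A) v e}"
      then obtain u v where z: "z = (u, v)" and u: "u \<in> hom A X" and v: "v \<in> hom B Y"
        and uv: "compose (pts A) m u = compose (pts A) v e" by blast
      have uv': "m (u a) = v (e a)" if "a \<in> pts A" for a
        using fun_cong[OF uv, of a] that by (simp add: compose_def)
      have "graph (B, v, v) \<subseteq> graph (X, m, m)"
      proof
        fix w assume "w \<in> graph (B, v, v)"
        then obtain a where a: "a \<in> pts A" "w = (v (e a), v (e a))"
          unfolding graph_simp surj[symmetric] by blast
        then show "w \<in> graph (X, m, m)"
          unfolding graph_simp by (intro image_eqI[of _ _ "u a"] hom_pts[OF u a(1)]) (simp add: uv')
      qed
      then obtain h where h: "h \<in> hom B X" "\<And>b. b \<in> pts B \<Longrightarrow> m (h b) = v b"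
        using monic_span_lift[OF J Y Y AB(2) v v] by blast
      have "compose (pts A) h e = u"
      proof (rule hom_eqI[OF compose_hom[OF nachbin[OF AB(1)] e h(1)] u])
        fix a assume a: "a \<in> pts A"
        have "h (e a) = u a"
          using h(2)[OF hom_pts[OF e a]] uv'[OF a]
          by (intro monic_span_inj[OF J Y Y hom_pts[OF h(1) hom_pts[OF e a]] hom_pts[OF u a]])
              simp_all
        then show "compose (pts A) h e a = u a" using a by (simp add: compose_def)
      qed
      moreover have "compose (pts B) m h = v"
        by (rule hom_eqI[OF compose_hom[OF nachbin[OF AB(2)] h(1) mh] v]) (simp add: compose_def
            h(2))
      ultimately show "z \<in> (\<lambda>h. (compose (pts A) h e, compose (pts B) m h)) ` hom B X"
        using h(1) unfolding z by blast
    qed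
    fix h h' assume h: "h \<in> hom B X" "h' \<in> hom B X"
    show "(\<forall>x\<in>pts B. (h x, h' x) \<in> snd X) \<longleftrightarrow>
      (\<forall>x\<in>pts A. (compose (pts A) h e x, compose (pts A) h' e x) \<in> snd X) \<and>
      (\<forall>x\<in>pts B. (compose (pts B) m h x, compose (pts B) m h' x) \<in> snd Y)" (is "?P \<longleftrightarrow> ?Q \<and> ?R")
    proof (intro iffI conjI; (elim conjE)?)
      assume ?P
      then show ?Q ?R using hom_pts[OF e] hom_mono[OF mh] by (simp_all add: compose_def)
    next
      assume ?Q
      then show ?P unfolding surj[symmetric] by (simp add: compose_def)
    qed
  qed
qed

section \<open>Subobjects of a product as closed sets of pairs\<close>

definition rel_of :: "'a ordspace \<Rightarrow> 'a ordspace \<Rightarrow> 'a rel \<Rightarrow> ('a ordspace, 'a \<Rightarrow> 'a) relation" where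
  "rel_of X Y G = {s. monic_span X Y s \<and> graph s = G}"

abbreviation closed_rel :: "'a ordspace \<Rightarrow> 'a ordspace \<Rightarrow> 'a rel \<Rightarrow> bool" where
  "closed_rel X Y G \<equiv> closedin (prod_topology (fst X) (fst Y)) G"

lemma closed_rel_pts: "closed_rel X Y G \<Longrightarrow> (x, y) \<in> G \<Longrightarrow> x \<in> pts X \<and> y \<in> pts Y"
  using closedin_subset by fastforce

lemma span_le_iff:
  assumes XY: "X \<in> \<O>" "Y \<in> \<O>" "A \<in> \<O>" and S: "monic_span X Y S" and x: "x \<in> hom A X"
      and y: "y \<in> hom A Y"
  shows "span_le \<C> X Y (A, x, y) S \<longleftrightarrow> graph (A, x, y) \<subseteq> graph S"
proof -
  obtain R r0 r1 where S': "S = (R, r0, r1)" by (cases S) auto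
  note J = S[unfolded S']
  show ?thesis
  proof
    assume "span_le \<C> X Y (A, x, y) S"
    then obtain h where h: "h \<in> hom A R" "compose (pts A) r0 h = x" "compose (pts A) r1 h = y"
      by (auto simp: span_le_def S')
    show "graph (A, x, y) \<subseteq> graph S"
    proof
      fix w assume "w \<in> graph (A, x, y)"
      then obtain a where a: "a \<in> pts A" "w = (x a, y a)" unfolding graph_simp by blast
      then have "w = (r0 (h a), r1 (h a))" unfolding h(2,3)[symmetric] by (simp add: compose_def)
      then show "w \<in> graph S" unfolding S' graph_simp using hom_pts[OF h(1) a(1)] by blast
    qed
  next
    assume "graph (A, x, y) \<subseteq> graph S"
    from monic_span_universal[OF J XY x y this[unfolded S']]
    show "span_le \<C> X Y (A, x, y) S" by (auto simp: span_le_def S')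
  qed
qed

lemma span_le_iff_graph:
  assumes XY: "X \<in> \<O>" "Y \<in> \<O>" and R: "monic_span X Y R" and S: "monic_span X Y S"
  shows "span_le \<C> X Y R S \<longleftrightarrow> graph R \<subseteq> graph S"
proof -
  obtain Q q0 q1 where Q: "R = (Q, q0, q1)" by (cases R) auto
  note q = monic_spanD(1-3)[OF R[unfolded Q]]
  show ?thesis unfolding Q by (rule span_le_iff[OF XY q(1) S q(2,3)])
qed

lemma monic_span_graph_closed: "\<lbrakk>monic_span X Y s; X \<in> \<O>; Y \<in> \<O>\<rbrakk> \<Longrightarrow> closed_rel X Y (graph s)"
  by (cases s) (auto dest: monic_spanD(1-3) intro: graph_closed)

lemma rel_of_nonempty: "\<lbrakk>X \<in> \<O>; Y \<in> \<O>; closed_rel X Y G\<rbrakk> \<Longrightarrow> \<exists>s. s \<in> rel_of X Y G"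
  by (metis (mono_tags, lifting) rel_of_def monic_span_exists mem_Collect_eq)

text \<open>Mutual inclusion of monic spans is equality of graphs, so each equivalence class is
  named by one closed set, and \<open>monic_span_exists\<close> realizes all of them.\<close>

lemma Rels_eq:
  assumes XY: "X \<in> \<O>" "Y \<in> \<O>"
  shows "Rels \<C> X Y = rel_of X Y ` {G. closed_rel X Y G}"
proof -
  let ?r = "{(R, S). rel_span \<C> X Y R \<and> rel_span \<C> X Y S \<and> span_le \<C> X Y R S \<and> span_le \<C> X Y S R}"
  have cls: "?r `` {s} = rel_of X Y (graph s)" if s: "monic_span X Y s" for s
    using s span_le_iff_graph[OF XY s] span_le_iff_graph[OF XY _ s]
    by (auto simp: rel_span_iff[OF XY] rel_of_def)
  have "Rels \<C> X Y = (\<lambda>s. ?r `` {s}) ` {s. monic_span X Y s}"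
    unfolding Rels_def quotient_def rel_span_iff[OF XY] by blast
  also have "\<dots> = (\<lambda>s. rel_of X Y (graph s)) ` {s. monic_span X Y s}"
    by (rule image_cong[OF refl], rule cls) simp
  also have "\<dots> = rel_of X Y ` {G. closed_rel X Y G}"
  proof (intro equalityI subsetI; elim imageE)
    fix w s assume "w = rel_of X Y (graph s)" "s \<in> {s. monic_span X Y s}"
    then show "w \<in> rel_of X Y ` {G. closed_rel X Y G}"
        using monic_span_graph_closed[OF _ XY, of s] by blast
  next
    fix w G assume w: "w = rel_of X Y G" and "G \<in> {G. closed_rel X Y G}"
    then obtain s where "s \<in> rel_of X Y G" using rel_of_nonempty[OF XY] by blast
    then show "w \<in> (\<lambda>s. rel_of X Y (graph s)) ` {s. monic_span X Y s}"
      unfolding w by (intro image_eqI[of _ _ s]) (simp_all add: rel_of_def)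
  qed
  finally show ?thesis .
qed

lemma rel_le_rel_of:
  assumes XY: "X \<in> \<O>" "Y \<in> \<O>" and G: "closed_rel X Y G" and H: "closed_rel X Y H"
  shows "rel_le \<C> X Y (rel_of X Y G) (rel_of X Y H) \<longleftrightarrow> G \<subseteq> H"
proof
  assume "rel_le \<C> X Y (rel_of X Y G) (rel_of X Y H)"
  then show "G \<subseteq> H" using span_le_iff_graph[OF XY] by (auto simp: rel_le_def rel_of_def)
next
  assume "G \<subseteq> H"
  moreover obtain s t where "s \<in> rel_of X Y G" "t \<in> rel_of X Y H" using rel_of_nonempty[OF XY] G H
      by blast
  ultimately have "span_le \<C> X Y s t" using span_le_iff_graph[OF XY, of s t]
      by (simp add: rel_of_def)
  then show "rel_le \<C> X Y (rel_of X Y G) (rel_of X Y H)" unfolding rel_le_def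
      using \<open>s \<in> _\<close> \<open>t \<in> _\<close> by blast
qed

lemma rel_of_inj:
  assumes XY: "X \<in> \<O>" "Y \<in> \<O>" and G: "closed_rel X Y G" and H: "closed_rel X Y H"
  shows "rel_of X Y G = rel_of X Y H \<longleftrightarrow> G = H"
  using rel_of_nonempty[OF XY G] by (auto simp: rel_of_def)

lemma in_rel_rel_of:
  assumes XY: "X \<in> \<O>" "Y \<in> \<O>" "A \<in> \<O>" and G: "closed_rel X Y G"
    and x: "x \<in> hom A X" and y: "y \<in> hom A Y"
  shows "in_rel \<C> X Y A x y (rel_of X Y G) \<longleftrightarrow> (\<forall>a\<in>pts A. (x a, y a) \<in> G)"
proof -
  have "in_rel \<C> X Y A x y (rel_of X Y G) \<longleftrightarrow> graph (A, x, y) \<subseteq> G"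
    using rel_of_nonempty[OF XY(1,2) G] span_le_iff[OF XY _ x y]
        by (auto simp: in_rel_def rel_of_def)
  then show ?thesis unfolding graph_simp by blast
qed

text \<open>The surjection onto the image does not change the set of related pairs, so only the
  pullback matters. The arguments change order because \<open>O\<close> composes in diagrammatic
  order. As the composite is a set of spans, every span with graph \<open>G O H\<close> has to be
  reached: the span from a pullback lifts to it, and the lift is onto.\<close>

lemma rel_comp_rel_of:
  assumes XYZ: "X \<in> \<O>" "Y \<in> \<O>" "Z \<in> \<O>" and G: "closed_rel X Y G" and H: "closed_rel Y Z H"
  shows "rel_comp \<C> X Y Z (rel_of Y Z H) (rel_of X Y G) = rel_of X Z (G O H)"
proof (intro equalityI subsetI)
  \<comment> \<open>For any choice of representatives and pullback, the outer legs relate exactly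
    the pairs of \<open>G O H\<close>; both inclusions rest on this.\<close>
  have T: "(\<lambda>t. (r0 (t0 t), s1 (t1 t))) ` pts T = G O H"
    if R: "(R, r0, r1) \<in> rel_of X Y G" and S: "(S, s0, s1) \<in> rel_of Y Z H"
      and T: "graph (T, t0, t1) = {(a, b). a \<in> pts R \<and> b \<in> pts S \<and> r1 a = s0 b}"
    for R r0 r1 S s0 s1 T t0 t1
  proof -
    have "(\<lambda>t. (r0 (t0 t), s1 (t1 t))) ` pts T = (\<lambda>(a, b). (r0 a, s1 b)) ` graph (T, t0, t1)"
      by (simp add: graph_simp image_image)
    also have "\<dots> = graph (R, r0, r1) O graph (S, s0, s1)"
    proof (intro equalityI subsetI)
      fix w assume "w \<in> (\<lambda>(a, b). (r0 a, s1 b)) ` graph (T, t0, t1)"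
      then obtain a b where w: "w = (r0 a, s1 b)" and ab: "a \<in> pts R" "b \<in> pts S" "r1 a = s0 b"
        unfolding T by auto
      have "(r0 a, r1 a) \<in> graph (R, r0, r1)" using ab(1) unfolding graph_simp by blast
      moreover have "(r1 a, s1 b) \<in> graph (S, s0, s1)" unfolding ab(3) graph_simp using ab(2)
          by blast
      ultimately show "w \<in> graph (R, r0, r1) O graph (S, s0, s1)" unfolding w by blast
    next
      fix w assume "w \<in> graph (R, r0, r1) O graph (S, s0, s1)"
      then obtain a b where "w = (r0 a, s1 b)" "a \<in> pts R" "b \<in> pts S" "r1 a = s0 b"
        unfolding graph_simp by auto
      then show "w \<in> (\<lambda>(a, b). (r0 a, s1 b)) ` graph (T, t0, t1)"
        unfolding T by (intro image_eqI[of _ _ "(a, b)"]) simp_all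
    qed
    finally show ?thesis using R S by (simp add: rel_of_def)
  qed
  {
    fix s assume "s \<in> rel_comp \<C> X Y Z (rel_of Y Z H) (rel_of X Y G)"
    then obtain Q q0 q1 R r0 r1 S s0 s1 T t0 t1 e where s: "s = (Q, q0, q1)"
        and Q: "monic_span X Z (Q, q0, q1)"
      and R: "(R, r0, r1) \<in> rel_of X Y G" and S: "(S, s0, s1) \<in> rel_of Y Z H"
      and pb: "is_pullback \<C> R S Y r1 s0 T t0 t1" and so: "so_morphism \<C> T Q e"
      and q: "compose (pts T) q0 e = compose (pts T) r0 t0"
          "compose (pts T) q1 e = compose (pts T) s1 t1"
      unfolding rel_comp_def rel_span_iff[OF XYZ(1,3)] by auto
    note r = monic_spanD(1-3)[of X Y R r0 r1] and s' = monic_spanD(1-3)[of Y Z S s0 s1]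
    have RS: "monic_span X Y (R, r0, r1)" "monic_span Y Z (S, s0, s1)" using R S
        by (simp_all add: rel_of_def)
    have T': "monic_span R S (T, t0, t1)" "graph (T, t0, t1) = {(a, b). a \<in> pts R \<and> b \<in> pts S \<and>
        r1 a = s0 b}"
      using pb is_pullback_iff[OF r(1)[OF RS(1)] s'(1)[OF RS(2)] XYZ(2) r(3)[OF RS(1)] s'(2)[OF
          RS(2)]] by auto
    have e: "e ` pts T = pts Q"
        using so so_morphism_iff monic_spanD(1)[OF T'(1)] monic_spanD(1)[OF Q] by blast
    have "graph s = (\<lambda>t. (q0 (e t), q1 (e t))) ` pts T" unfolding s graph_simp e[symmetric]
        by (simp add: image_image)
    also have "\<dots> = (\<lambda>t. (r0 (t0 t), s1 (t1 t))) ` pts T"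
    proof (rule image_cong[OF refl])
      fix t assume "t \<in> pts T"
      then show "(q0 (e t), q1 (e t)) = (r0 (t0 t), s1 (t1 t))"
        using fun_cong[OF q(1), of t] fun_cong[OF q(2), of t] by (simp add: compose_def)
    qed
    also have "\<dots> = G O H" by (rule T[OF R S T'(2)])
    finally show "s \<in> rel_of X Z (G O H)" using Q unfolding s by (simp add: rel_of_def)
  next
    fix s assume s: "s \<in> rel_of X Z (G O H)"
    then obtain Q q0 q1 where s': "s = (Q, q0, q1)" and Q: "monic_span X Z (Q, q0, q1)"
      and Qg: "graph (Q, q0, q1) = G O H" by (cases s) (auto simp: rel_of_def)
    obtain R r0 r1 S s0 s1 where R: "(R, r0, r1) \<in> rel_of X Y G" and S: "(S, s0, s1) \<in> rel_of Y Z H"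
      using rel_of_nonempty[OF XYZ(1,2) G] rel_of_nonempty[OF XYZ(2,3) H] by auto
    have RS: "monic_span X Y (R, r0, r1)" "monic_span Y Z (S, s0, s1)" using R S
        by (simp_all add: rel_of_def)
    note r = monic_spanD(1-3)[OF RS(1)] and t = monic_spanD(1-3)[OF RS(2)]
    let ?P = "prod_topology (fst R) (fst S)"
    have "closedin ?P {z \<in> topspace ?P. r1 (fst z) = s0 (snd z)}"
      using continuous_map_compose[OF continuous_map_fst hom_continuous[OF r(3)], of "fst S"]
        continuous_map_compose[OF continuous_map_snd hom_continuous[OF t(2)], of "fst R"]
      by (intro closedin_continuous_maps_eq[OF nachbin_spaceD(2)[OF nachbin[OF XYZ(2)]]])
          (simp_all add: o_def)
    also have "{z \<in> topspace ?P. r1 (fst z) = s0 (snd z)} = {(a, b). a \<in> pts R \<and> b \<in> pts S \<and>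
        r1 a = s0 b}"
      by auto
    finally obtain T t0 t1 where T': "monic_span R S (T, t0, t1)"
      "graph (T, t0, t1) = {(a, b). a \<in> pts R \<and> b \<in> pts S \<and> r1 a = s0 b}"
      by (rule monic_span_exists[OF r(1) t(1)])
    note t' = monic_spanD(1-3)[OF T'(1)]
    have pb: "is_pullback \<C> R S Y r1 s0 T t0 t1"
      using is_pullback_iff[OF r(1) t(1) XYZ(2) r(3) t(2)] T' by blast
    let ?a = "compose (pts T) r0 t0" and ?b = "compose (pts T) s1 t1"
    have ab: "?a \<in> hom T X" "?b \<in> hom T Z"
      using compose_hom[OF nachbin[OF t'(1)]] t'(2,3) r(2) t(3) by blast+
    have gT: "graph (T, ?a, ?b) = G O H"
      using T[OF R S T'(2)] by (simp add: graph_simp compose_def)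
    have "graph (T, ?a, ?b) \<subseteq> graph (Q, q0, q1)" using gT Qg by simp
    from monic_span_universal[OF Q XYZ(1,3) t'(1) ab this]
    obtain e where e: "e \<in> hom T Q" "compose (pts T) q0 e = ?a" "compose (pts T) q1 e = ?b" by blast
    have "c \<in> e ` pts T" if c: "c \<in> pts Q" for c
    proof -
      have "(q0 c, q1 c) \<in> graph (Q, q0, q1)" unfolding graph_simp using c by blast
      then have "(q0 c, q1 c) \<in> graph (T, ?a, ?b)" unfolding gT Qg .
      then obtain u where u: "u \<in> pts T" "q0 c = ?a u" "q1 c = ?b u" unfolding graph_simp by blast
      then have "c = e u"
        unfolding e(2,3)[symmetric]
        by (rule_tac monic_span_inj[OF Q XYZ(1,3) c hom_pts[OF e(1) u(1)]]) (simp_all add: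
            compose_def)
      then show ?thesis using u(1) by blast
    qed
    then have "e ` pts T = pts Q" using hom_pts[OF e(1)] by blast
    then have "so_morphism \<C> T Q e" using so_morphism_iff[OF t'(1) monic_spanD(1)[OF Q]] e(1)
        by blast
    then show "s \<in> rel_comp \<C> X Y Z (rel_of Y Z H) (rel_of X Y G)"
      using R S pb e(2,3) Q
      unfolding rel_comp_def s' rel_span_iff[OF XYZ(1,3)] ordspace_category_simps by blast
  }
qed

section \<open>Congruences as closed preorders\<close>

definition closed_preorder :: "'a ordspace \<Rightarrow> 'a rel \<Rightarrow> bool" where
  "closed_preorder X E \<longleftrightarrow> closed_rel X X E \<and> snd X \<subseteq> E \<and> trans E"

lemma closed_preorder_refl: "\<lbrakk>closed_preorder X E; X \<in> \<O>; x \<in> pts X\<rbrakk> \<Longrightarrow> (x, x) \<in> E"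
  using nachbin_spaceD(4)[OF nachbin, of X x] unfolding closed_preorder_def by blast

text \<open>Weakening applied to \<open>(x, x)\<close> shows that a congruence contains the order,
  and containing the order in turn gives reflexivity. Conversely, transitivity composes a pair of
  \<open>E\<close> with order pairs on either side, which is weakening. Generalized elements are
  reduced to points by constant maps on one-point objects.\<close>

lemma congruence_iff:
  assumes X: "X \<in> \<O>"
  shows "congruence \<C> X \<E> \<longleftrightarrow> (\<exists>E. \<E> = rel_of X X E \<and> closed_preorder X E)"
proof (intro iffI; (elim exE conjE)?)
  assume c: "congruence \<C> X \<E>"
  then obtain E where E: "\<E> = rel_of X X E" "closed_rel X X E"
    unfolding congruence_def Rels_eq[OF X X] by blast
  have cst: "(\<lambda>_\<in>{x}. y) \<in> hom (point_space X x) X" if "x \<in> pts X" "y \<in> pts X" for x y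
    using const_hom[OF X that(1) X that(2)] .
  have ir: "in_rel \<C> X X (point_space X x) (\<lambda>_\<in>{x}. y) (\<lambda>_\<in>{x}. z) \<E> \<longleftrightarrow> (y, z) \<in> E"
    if "x \<in> pts X" "y \<in> pts X" "z \<in> pts X" for x y z
    using in_rel_rel_of[OF X X point_space(1)[OF X that(1)] E(2) cst cst] that
        point_space(2)[OF X that(1)] E(1) by simp
  have refl: "(x, x) \<in> E" if "x \<in> pts X" for x
    using c that ir[of x x x] cst[of x x] point_space(1)[OF X that] by (simp add: congruence_def)
  have "snd X \<subseteq> E"
  proof
    fix w assume w: "w \<in> snd X"
    obtain x y where xy: "w = (x, y)" by (cases w)
    then have p: "x \<in> pts X" "y \<in> pts X" using nachbin_spaceD(7,8)[OF nachbin[OF X]] w by blast+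
    have "in_rel \<C> X X (point_space X x) (\<lambda>_\<in>{x}. x) (\<lambda>_\<in>{x}. y) \<E>"
    proof (rule c[unfolded congruence_def weakening_closed_def ordspace_category_simps, THEN
        conjunct2,
          THEN conjunct1, rule_format, OF point_space(1)[OF X p(1)] cst[OF p(1) p(1)]
              cst[OF p(1) p(1)]
            cst[OF p(1) p(1)] cst[OF p(1) p(2)]])
      show "(\<forall>z\<in>pts (point_space X x). ((\<lambda>_\<in>{x}. x) z, (\<lambda>_\<in>{x}. x) z) \<in> snd X) \<and>
        in_rel \<C> X X (point_space X x) (\<lambda>_\<in>{x}. x) (\<lambda>_\<in>{x}. x) \<E> \<and>
        (\<forall>z\<in>pts (point_space X x). ((\<lambda>_\<in>{x}. x) z, (\<lambda>_\<in>{x}. y) z) \<in> snd X)"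
        using w xy p ir[of x x x] refl nachbin_spaceD(4)[OF nachbin[OF X]]
            point_space(2)[OF X p(1)] by simp
    qed
    then show "w \<in> E" using ir p xy by simp
  qed
  moreover have "trans E"
  proof (rule transI)
    fix x y z assume xyz: "(x, y) \<in> E" "(y, z) \<in> E"
    then have p: "x \<in> pts X" "y \<in> pts X" "z \<in> pts X" using closed_rel_pts[OF E(2)] by blast+
    have "in_rel \<C> X X (point_space X x) (\<lambda>_\<in>{x}. x) (\<lambda>_\<in>{x}. z) \<E>"
      using c[unfolded congruence_def ordspace_category_simps, THEN conjunct2, THEN conjunct2,
          THEN conjunct2,
          rule_format, OF point_space(1)[OF X p(1)] cst[OF p(1) p(1)] cst[OF p(1) p(2)]
              cst[OF p(1) p(3)]]
        ir[OF p(1) p(1) p(2)] ir[OF p(1) p(2) p(3)] xyz by blast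
    then show "(x, z) \<in> E" using ir p by simp
  qed
  ultimately show "\<exists>E. \<E> = rel_of X X E \<and> closed_preorder X E" using E
      by (auto simp: closed_preorder_def)
next
  fix E assume E: "\<E> = rel_of X X E" "closed_preorder X E"
  have cl: "closed_rel X X E" and le: "snd X \<subseteq> E" and tr: "trans E" using E(2)
      by (auto simp: closed_preorder_def)
  note ir = in_rel_rel_of[OF X X _ cl, folded E(1)]
  show "congruence \<C> X \<E>"
    unfolding congruence_def weakening_closed_def ordspace_category_simps
  proof (intro conjI ballI impI; (elim conjE)?)
    show "\<E> \<in> Rels \<C> X X" using cl unfolding E(1) Rels_eq[OF X X] by blast
    show "in_rel \<C> X X A x x \<E>" if "A \<in> \<O>" "x \<in> hom A X" for A x
      using ir[OF that that(2)] hom_pts[OF that(2)] closed_preorder_refl[OF E(2) X] by blast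
    show "in_rel \<C> X X A x z \<E>" if "A \<in> \<O>" "x \<in> hom A X" "y \<in> hom A X" "z \<in> hom A X"
      "in_rel \<C> X X A x y \<E>" "in_rel \<C> X X A y z \<E>" for A x y z
      using that(5,6) transD[OF tr]
          unfolding ir[OF that(1,2,3)] ir[OF that(1,3,4)] ir[OF that(1,2,4)] by blast
    show "in_rel \<C> X X A x' y' \<E>"
        if h: "A \<in> \<O>" "x \<in> hom A X" "x' \<in> hom A X" "y \<in> hom A X" "y' \<in> hom A X"
      and l: "\<forall>z\<in>pts A. (x' z, x z) \<in> snd X" "in_rel \<C> X X A x y \<E>" "\<forall>z\<in>pts A. (y z, y' z) \<in> snd X"
    for A x x' y y'
      unfolding ir[OF h(1,3,5)]
    proof
      fix a assume a: "a \<in> pts A"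
      have "(x' a, x a) \<in> E" "(x a, y a) \<in> E" "(y a, y' a) \<in> E"
        using l a le unfolding ir[OF h(1,2,4)] by blast+
      then show "(x' a, y' a) \<in> E" using transD[OF tr] by blast
    qed
  qed
qed

section \<open>Bimodules, left adjoints and the exact completion\<close>

definition bimodule :: "'a ordspace \<Rightarrow> 'a rel \<Rightarrow> 'a ordspace \<Rightarrow> 'a rel \<Rightarrow> 'a rel \<Rightarrow> bool" where
  "bimodule X E Y F G \<longleftrightarrow> closed_rel X Y G \<and> E O G = G \<and> G O F = G"

text \<open>Unit and counit in diagrammatic order: \<open>G O H\<close> is the right adjoint
  \<open>H\<close> after \<open>G\<close>.\<close>

definition left_adjoint :: "'a ordspace \<Rightarrow> 'a rel \<Rightarrow> 'a ordspace \<Rightarrow> 'a rel \<Rightarrow> 'a rel \<Rightarrow> bool" where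
  "left_adjoint X E Y F G \<longleftrightarrow> bimodule X E Y F G \<and>
    (\<exists>H. bimodule Y F X E H \<and> E \<subseteq> G O H \<and> H O G \<subseteq> F)"

lemma closed_preorderD:
  assumes "closed_preorder X E" "X \<in> \<O>"
  shows "closed_rel X X E" "trans E" "snd X \<subseteq> E" "E O E = E"
proof -
  show c: "closed_rel X X E" "trans E" "snd X \<subseteq> E" using assms by (auto simp: closed_preorder_def)
  show "E O E = E"
  proof
    show "E O E \<subseteq> E" by (rule trans_O_subset[OF c(2)])
    show "E \<subseteq> E O E"
    proof
      fix w assume w: "w \<in> E"
      then have "(fst w, fst w) \<in> E"
        using closed_preorder_refl[OF assms] closed_rel_pts[OF c(1), of "fst w" "snd w"] by simp
      then show "w \<in> E O E" using w
          by (intro relcompI[of "fst w" "fst w" _ "snd w", simplified]) simp_all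
    qed
  qed
qed

lemma closed_rel_comp:
  assumes "Y \<in> \<O>" "closed_rel X Y G" "closed_rel Y Z H"
  shows "closed_rel X Z (G O H)"
  using closedin_relcomp[OF nachbin_spaceD(1)[OF nachbin[OF assms(1)]] assms(2,3)] .

text \<open>Idempotence of \<open>E\<close> splits the two-sided condition on a morphism into one
  absorption law on each side.\<close>

lemma Qw_Hom:
  assumes X: "X \<in> \<O>" "closed_preorder X E" and Y: "Y \<in> \<O>" "closed_preorder Y F"
  shows "\<R> \<in> Hom (Qw \<C>) (X, rel_of X X E) (Y, rel_of Y Y F) \<longleftrightarrow> (\<exists>G. \<R> = rel_of X Y G \<and>
      bimodule X E Y F G)"
proof -
  note E = closed_preorderD[OF X(2,1)] and F = closed_preorderD[OF Y(2,1)]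
  have eq: "rel_comp \<C> X Y Y (rel_of Y Y F) (rel_comp \<C> X X Y (rel_of X Y G) (rel_of X X E)) =
      rel_of X Y G \<longleftrightarrow>
      E O G = G \<and> G O F = G" if G: "closed_rel X Y G" for G
  proof -
    have "rel_comp \<C> X Y Y (rel_of Y Y F) (rel_comp \<C> X X Y (rel_of X Y G) (rel_of X X E)) =
        rel_of X Y ((E O G) O F)"
      using closed_rel_comp[OF X(1) E(1) G] F(1) X(1) Y(1) G E(1) by (simp add: rel_comp_rel_of)
    also have "\<dots> = rel_of X Y G \<longleftrightarrow> (E O G) O F = G"
      using closed_rel_comp[OF Y(1) closed_rel_comp[OF X(1) E(1) G] F(1)] X(1) Y(1) G
          by (simp add: rel_of_inj)
    also have "\<dots> \<longleftrightarrow> E O G = G \<and> G O F = G"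
    proof
      assume e: "(E O G) O F = G"
      have "E O G = (E O E) O G O F" using e by (metis O_assoc)
      also have "\<dots> = G" unfolding E(4) using e by (simp add: O_assoc)
      finally have "E O G = G" .
      then show "E O G = G \<and> G O F = G" using e by simp
    qed simp
    finally show ?thesis .
  qed
  show ?thesis
  proof
    assume "\<R> \<in> Hom (Qw \<C>) (X, rel_of X X E) (Y, rel_of Y Y F)"
    then have "\<R> \<in> Rels \<C> X Y"
        "rel_comp \<C> X Y Y (rel_of Y Y F) (rel_comp \<C> X X Y \<R> (rel_of X X E)) = \<R>"
      by (simp_all add: Qw_def)
    then show "\<exists>G. \<R> = rel_of X Y G \<and> bimodule X E Y F G"
      unfolding Rels_eq[OF X(1) Y(1)] bimodule_def using eq by blast
  next
    assume "\<exists>G. \<R> = rel_of X Y G \<and> bimodule X E Y F G"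
    then obtain G where G: "\<R> = rel_of X Y G" "closed_rel X Y G" "E O G = G \<and> G O F = G"
      unfolding bimodule_def by blast
    then have "\<R> \<in> Rels \<C> X Y" unfolding Rels_eq[OF X(1) Y(1)] by blast
    then show "\<R> \<in> Hom (Qw \<C>) (X, rel_of X X E) (Y, rel_of Y Y F)"
      using G(3) unfolding eq[OF G(2), symmetric] by (simp add: Qw_def G(1))
  qed
qed

lemma ex_reg_simps:
  "Ident (ex_reg \<C>) (X, \<E>) = \<E>"
  "Comp (ex_reg \<C>) (X, \<E>) (Y, \<F>) (Z, \<G>) \<S> \<R> = rel_comp \<C> X Y Z \<S> \<R>"
  "Le (ex_reg \<C>) (X, \<E>) (Y, \<F>) \<R> \<S> = rel_le \<C> X Y \<S> \<R>"
  by (simp_all add: ex_reg_def Qw_def)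

lemma ex_reg_Obj:
  "a \<in> Obj (ex_reg \<C>) \<longleftrightarrow> (\<exists>X E. a = (X, rel_of X X E) \<and> X \<in> \<O> \<and> closed_preorder X E)"
  by (cases a) (auto simp: ex_reg_def Qw_def congruence_iff)

lemma ex_reg_Hom:
  assumes X: "X \<in> \<O>" "closed_preorder X E" and Y: "Y \<in> \<O>" "closed_preorder Y F"
  shows "\<R> \<in> Hom (ex_reg \<C>) (X, rel_of X X E) (Y, rel_of Y Y F) \<longleftrightarrow>
    (\<exists>G. \<R> = rel_of X Y G \<and> left_adjoint X E Y F G)"
proof -
  note E = closed_preorderD[OF X(2,1)] and F = closed_preorderD[OF Y(2,1)]
  have "adjoint_morphisms (Qw \<C>) (X, rel_of X X E) (Y, rel_of Y Y F) (rel_of X Y G) (rel_of Y X H) \<longleftrightarrow>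
      E \<subseteq> G O H \<and> H O G \<subseteq> F" if G: "bimodule X E Y F G" and H: "bimodule Y F X E H" for G H
  proof -
    have cl: "closed_rel X Y G" "closed_rel Y X H" using G H by (simp_all add: bimodule_def)
    have "rel_of X Y G \<in> Hom (Qw \<C>) (X, rel_of X X E) (Y, rel_of Y Y F)"
        "rel_of Y X H \<in> Hom (Qw \<C>) (Y, rel_of Y Y F) (X, rel_of X X E)"
      using G H Qw_Hom[OF X Y] Qw_Hom[OF Y X] by blast+
    then show ?thesis
      using closed_rel_comp[OF Y(1) cl] closed_rel_comp[OF X(1) cl(2,1)] cl E(1) F(1) X(1) Y(1)
      by (simp add: adjoint_morphisms_def Qw_def rel_comp_rel_of rel_le_rel_of)
  qed
  note adj = this
  have hom: "L \<in> Hom (Qw \<C>) (X, rel_of X X E) (Y, rel_of Y Y F) \<and>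
      R \<in> Hom (Qw \<C>) (Y, rel_of Y Y F) (X, rel_of X X E)"
    if "adjoint_morphisms (Qw \<C>) (X, rel_of X X E) (Y, rel_of Y Y F) L R" for L R
    using that by (simp add: adjoint_morphisms_def)
  have "\<R> \<in> Hom (ex_reg \<C>) (X, rel_of X X E) (Y, rel_of Y Y F) \<longleftrightarrow>
      (\<exists>R. adjoint_morphisms (Qw \<C>) (X, rel_of X X E) (Y, rel_of Y Y F) \<R> R)"
    by (simp add: ex_reg_def)
  also have "\<dots> \<longleftrightarrow> (\<exists>G. \<R> = rel_of X Y G \<and> left_adjoint X E Y F G)"
  proof
    assume "\<exists>R. adjoint_morphisms (Qw \<C>) (X, rel_of X X E) (Y, rel_of Y Y F) \<R> R"
    then obtain G H
        where "adjoint_morphisms (Qw \<C>) (X, rel_of X X E) (Y, rel_of Y Y F) (rel_of X Y G) (rel_of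
        Y X H)"
      "\<R> = rel_of X Y G" "bimodule X E Y F G" "bimodule Y F X E H"
      using hom Qw_Hom[OF X Y] Qw_Hom[OF Y X] by metis
    then show "\<exists>G. \<R> = rel_of X Y G \<and> left_adjoint X E Y F G"
      using adj unfolding left_adjoint_def by blast
  next
    assume "\<exists>G. \<R> = rel_of X Y G \<and> left_adjoint X E Y F G"
    then show "\<exists>R. adjoint_morphisms (Qw \<C>) (X, rel_of X X E) (Y, rel_of Y Y F) \<R> R"
      using adj unfolding left_adjoint_def by blast
  qed
  finally show ?thesis .
qed

lemma left_adjoint_closed: "left_adjoint X E Y F G \<Longrightarrow> closed_rel X Y G"
  by (simp add: left_adjoint_def bimodule_def)

lemma left_adjoint_absorb:
  "left_adjoint X E Y F G \<Longrightarrow> E O G = G" "left_adjoint X E Y F G \<Longrightarrow> G O F = G"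
  by (simp_all add: left_adjoint_def bimodule_def)

lemma left_adjoint_ident:
  assumes "X \<in> \<O>" "closed_preorder X E"
  shows "left_adjoint X E X E E"
  using closed_preorderD[OF assms(2,1)] unfolding left_adjoint_def bimodule_def by blast

text \<open>The right adjoint of the composite is \<open>H' O G'\<close>. The unit of
  \<open>H\<close> is inserted at an \<open>F\<close> that \<open>G'\<close> absorbs, and the
  \<open>F\<close> left over by the counit of \<open>G\<close> is absorbed by
  \<open>H\<close>.\<close>

lemma left_adjoint_comp:
  assumes Y: "Y \<in> \<O>" and XZ: "X \<in> \<O>" "Z \<in> \<O>" and G: "left_adjoint X E Y F G"
      and H: "left_adjoint Y F Z D H"
  shows "left_adjoint X E Z D (G O H)"
proof -
  obtain G' where G': "bimodule Y F X E G'" "E \<subseteq> G O G'" "G' O G \<subseteq> F" using G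
      by (auto simp: left_adjoint_def)
  obtain H' where H': "bimodule Z D Y F H'" "F \<subseteq> H O H'" "H' O H \<subseteq> D" using H
      by (auto simp: left_adjoint_def)
  have comp: "bimodule X E Z D (S O T)" if "bimodule X E Y F S" "bimodule Y F Z D T" for X E Z D S T
  proof -
    have S: "closed_rel X Y S" "E O S = S" and T: "closed_rel Y Z T" "T O D = T"
      using that by (simp_all add: bimodule_def)
    have "E O S O T = S O T" by (simp only: O_assoc[symmetric] S(2))
    moreover have "(S O T) O D = S O T" by (simp only: O_assoc T(2))
    ultimately show ?thesis using closed_rel_comp[OF Y S(1) T(1)] by (simp add: bimodule_def)
  qed
  have "bimodule X E Z D (G O H)" "bimodule Z D X E (H' O G')"
    using comp G H G' H' unfolding left_adjoint_def by blast+
  moreover have "E \<subseteq> (G O H) O (H' O G')"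
  proof -
    have "F O G' = G'" using G'(1) by (simp add: bimodule_def)
    then have "E \<subseteq> G O (F O G')" using G'(2) by simp
    also have "\<dots> \<subseteq> G O ((H O H') O G')" using H'(2) by (intro relcomp_mono) simp_all
    finally show ?thesis by (simp add: O_assoc)
  qed
  moreover have "(H' O G') O (G O H) \<subseteq> D"
  proof -
    have "(H' O G') O (G O H) = H' O (G' O G) O H" by (simp add: O_assoc)
    also have "\<dots> \<subseteq> H' O (F O H)" using G'(3) by (intro relcomp_mono) simp_all
    also have "\<dots> = H' O H" using left_adjoint_absorb(1)[OF H] by simp
    also have "\<dots> \<subseteq> D" by fact
    finally show ?thesis .
  qed
  ultimately show ?thesis unfolding left_adjoint_def by blast
qed

lemma pos_category_ex_reg: "pos_category (ex_reg \<C>)"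
proof
  note simps = ex_reg_simps rel_comp_rel_of rel_le_rel_of closed_rel_comp left_adjoint_closed
    left_adjoint_absorb closed_preorderD(1) rel_of_inj
  fix a b assume "a \<in> Obj (ex_reg \<C>)" "b \<in> Obj (ex_reg \<C>)"
  then obtain X E Y F where a: "a = (X, rel_of X X E)" and b: "b = (Y, rel_of Y Y F)"
    and X: "X \<in> \<O>" "closed_preorder X E" and Y: "Y \<in> \<O>" "closed_preorder Y F"
    unfolding ex_reg_Obj by blast
  note XY = a b X Y
  show "Ident (ex_reg \<C>) a \<in> Hom (ex_reg \<C>) a a"
    unfolding a ex_reg_Hom[OF X X] ex_reg_simps using left_adjoint_ident[OF X] by blast
  {
    fix f assume "f \<in> Hom (ex_reg \<C>) a b"
    then obtain G where f: "f = rel_of X Y G" and G: "left_adjoint X E Y F G"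
      unfolding a b ex_reg_Hom[OF X Y] by blast
    show "Comp (ex_reg \<C>) a b b (Ident (ex_reg \<C>) b) f = f"
        "Comp (ex_reg \<C>) a a b f (Ident (ex_reg \<C>) a) = f"
      using XY by (simp_all add: f simps left_adjoint_closed[OF G] left_adjoint_absorb[OF G])
    show "Le (ex_reg \<C>) a b f f"
      using XY by (simp add: f simps left_adjoint_closed[OF G])
    fix g assume "g \<in> Hom (ex_reg \<C>) a b"
    then obtain H where g: "g = rel_of X Y H" and H: "left_adjoint X E Y F H"
      unfolding a b ex_reg_Hom[OF X Y] by blast
    note cl = left_adjoint_closed[OF G] left_adjoint_closed[OF H]
    show "f = g" if "Le (ex_reg \<C>) a b f g" "Le (ex_reg \<C>) a b g f"
      using that XY cl by (simp add: f g simps)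
    fix h assume "h \<in> Hom (ex_reg \<C>) a b"
    then obtain K where h: "h = rel_of X Y K" and K: "left_adjoint X E Y F K"
      unfolding a b ex_reg_Hom[OF X Y] by blast
    show "Le (ex_reg \<C>) a b f h" if "Le (ex_reg \<C>) a b f g" "Le (ex_reg \<C>) a b g h"
      using that XY cl left_adjoint_closed[OF K] by (simp add: f g h simps)
  }
  fix c assume "c \<in> Obj (ex_reg \<C>)"
  then obtain Z D where c: "c = (Z, rel_of Z Z D)" and Z: "Z \<in> \<O>" "closed_preorder Z D"
    unfolding ex_reg_Obj by blast
  fix f g assume "f \<in> Hom (ex_reg \<C>) a b" "g \<in> Hom (ex_reg \<C>) b c"
  then obtain G H where f: "f = rel_of X Y G" and G: "left_adjoint X E Y F G"
    and g: "g = rel_of Y Z H" and H: "left_adjoint Y F Z D H"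
    unfolding a b c ex_reg_Hom[OF X Y] ex_reg_Hom[OF Y Z] by blast
  note cl = left_adjoint_closed[OF G] left_adjoint_closed[OF H]
  have gf: "Comp (ex_reg \<C>) a b c g f = rel_of X Z (G O H)"
    using cl X Y Z by (simp add: a b c f g simps)
  have "rel_of X Z (G O H) \<in> Hom (ex_reg \<C>) a c"
    unfolding a c ex_reg_Hom[OF X Z] using left_adjoint_comp[OF Y(1) X(1) Z(1) G H] by blast
  then show "Comp (ex_reg \<C>) a b c g f \<in> Hom (ex_reg \<C>) a c" unfolding gf .
  {
    fix f' g' assume "f' \<in> Hom (ex_reg \<C>) a b" "g' \<in> Hom (ex_reg \<C>) b c"
      and le: "Le (ex_reg \<C>) a b f f'" "Le (ex_reg \<C>) b c g g'"
    then obtain G' H' where f': "f' = rel_of X Y G'" and G': "left_adjoint X E Y F G'"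
      and g': "g' = rel_of Y Z H'" and H': "left_adjoint Y F Z D H'"
      unfolding a b c ex_reg_Hom[OF X Y] ex_reg_Hom[OF Y Z] by blast
    note cl' = cl left_adjoint_closed[OF G'] left_adjoint_closed[OF H']
    \<comment> \<open>The order of the completion is reversed inclusion, hence the
      direction.\<close>
    have "G' \<subseteq> G" "H' \<subseteq> H" using le cl' X Y Z by (simp_all add: a b c f g f' g' simps)
    then have "G' O H' \<subseteq> G O H" by (rule relcomp_mono)
    moreover have "Comp (ex_reg \<C>) a b c g' f' = rel_of X Z (G' O H')"
      using cl' X Y Z by (simp add: a b c f' g' simps)
    ultimately show "Le (ex_reg \<C>) a c (Comp (ex_reg \<C>) a b c g f) (Comp (ex_reg \<C>) a b c g' f')"
      unfolding gf using closed_rel_comp[OF Y(1)] cl' X Z by (simp add: a c simps)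
  }
  fix d h assume "d \<in> Obj (ex_reg \<C>)" "h \<in> Hom (ex_reg \<C>) c d"
  then obtain W B K where d: "d = (W, rel_of W W B)" and W: "W \<in> \<O>" "closed_preorder W B"
    and h: "h = rel_of Z W K" and K: "left_adjoint Z D W B K"
    unfolding c ex_reg_Obj using ex_reg_Hom[OF Z] by blast
  note cl' = cl left_adjoint_closed[OF K]
  show "Comp (ex_reg \<C>) a c d h (Comp (ex_reg \<C>) a b c g f) =
      Comp (ex_reg \<C>) a b d (Comp (ex_reg \<C>) b c d h g) f"
    unfolding gf
        using closed_rel_comp[OF Y(1) cl'(1,2)] closed_rel_comp[OF Z(1) cl'(2,3)] cl' X Y Z W
    by (simp add: a b c d h g f ex_reg_simps rel_comp_rel_of O_assoc)
qed

end

section \<open>The exact completion as a category of quotients\<close>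

text \<open>\<open>\<O>\<close> supplies the objects that carry congruences, \<open>\<N>\<close> the
  spaces that are their ordered quotients. From \<open>cover\<close> each space gets an object of
  the completion, and by \<open>quotient\<close> each object of the completion comes from a
  space.\<close>

locale nachbin_cover = nachbin_category \<O> for \<O> :: "'a ordspace set" +
  fixes \<N> :: "'a ordspace set"
  assumes nachbin_N: "N \<in> \<N> \<Longrightarrow> nachbin_space N"
    and cover: "N \<in> \<N> \<Longrightarrow> \<exists>X\<in>\<O>. \<exists>q\<in>hom X N. q ` pts X = pts N"
    and quotient: "\<lbrakk>X \<in> \<O>; closed_preorder X E\<rbrakk> \<Longrightarrow> \<exists>N\<in>\<N>. \<exists>q\<in>hom X N. q ` pts X = pts N \<and>
      E = {(x, y). x \<in> pts X \<and> y \<in> pts X \<and> (q x, q y) \<in> snd N}"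
begin

section \<open>Presentations of Nachbin spaces and the relations induced by maps\<close>

definition presents :: "'a ordspace \<Rightarrow> ('a \<Rightarrow> 'a) \<Rightarrow> 'a ordspace \<Rightarrow> bool" where
  "presents X q N \<longleftrightarrow> X \<in> \<O> \<and> N \<in> \<N> \<and> q \<in> hom X N \<and> q ` pts X = pts N"

text \<open>The companion of \<open>f\<close>, pulled back along the two presentations. Its right
  adjoint is the conjoint, where \<open>p y\<close> lies below \<open>f (q x)\<close>.\<close>

definition rep ::
    "'a ordspace \<Rightarrow> ('a \<Rightarrow> 'a) \<Rightarrow> 'a ordspace \<Rightarrow> ('a \<Rightarrow> 'a) \<Rightarrow> 'a ordspace \<Rightarrow> ('a \<Rightarrow> 'a) \<Rightarrow> 'a rel" where
  "rep X q Y p M f = {(x, y). x \<in> pts X \<and> y \<in> pts Y \<and> (f (q x), p y) \<in> snd M}"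

text \<open>The presented congruence, written as the relation of an identity map, so that
  \<open>rep_comp\<close> also yields the absorption laws.\<close>

abbreviation ker :: "'a ordspace \<Rightarrow> ('a \<Rightarrow> 'a) \<Rightarrow> 'a ordspace \<Rightarrow> 'a rel" where
  "ker X q N \<equiv> rep X q X q N (\<lambda>n\<in>pts N. n)"

lemma repI: "x \<in> pts X \<Longrightarrow> y \<in> pts Y \<Longrightarrow> (f (q x), p y) \<in> snd M \<Longrightarrow> (x, y) \<in> rep X q Y p M f"
  by (simp add: rep_def)

lemma repD:
  assumes "(x, y) \<in> rep X q Y p M f"
  shows "x \<in> pts X" "y \<in> pts Y" "(f (q x), p y) \<in> snd M"
  using assms by (auto simp: rep_def)

lemma presentsD:
  assumes "presents X q N"
  shows "X \<in> \<O>" "N \<in> \<N>" "q \<in> hom X N" "q ` pts X = pts N" "\<And>x. x \<in> pts X \<Longrightarrow> q x \<in> pts N"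
    "\<And>n. n \<in> pts N \<Longrightarrow> \<exists>x\<in>pts X. q x = n"
proof -
  show s: "X \<in> \<O>" "N \<in> \<N>" "q \<in> hom X N" "q ` pts X = pts N"
    using assms by (auto simp: presents_def)
  show "\<And>x. x \<in> pts X \<Longrightarrow> q x \<in> pts N" "\<And>n. n \<in> pts N \<Longrightarrow> \<exists>x\<in>pts X. q x = n"
    unfolding s(4)[symmetric] by blast+
qed

lemmas N_refl = nachbin_spaceD(4)[OF nachbin_N]
  and N_trans = nachbin_spaceD(5)[OF nachbin_N]
  and N_antisym = nachbin_spaceD(6)[OF nachbin_N]

lemma rep_ident: "presents X q N \<Longrightarrow> ker X q N = {(x, y). x \<in> pts X \<and> y \<in> pts X \<and> (q x, q y) \<in> snd N}"
  using presentsD(5)[of X q N] by (auto simp: rep_def)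

lemma ker_iff: "presents X q N \<Longrightarrow> (x, y) \<in> ker X q N \<longleftrightarrow> x \<in> pts X \<and> y \<in> pts X \<and> (q x, q y) \<in> snd N"
  using rep_ident by auto

text \<open>One inclusion is monotonicity of \<open>g\<close> and transitivity. For the other,
  surjectivity of \<open>p\<close> provides an intermediate \<open>y\<close> with
  \<open>p y = f (q x)\<close>.\<close>

lemma rep_comp:
  assumes q: "presents X q N" and p: "presents Y p M" and r: "presents Z r L"
    and f: "f \<in> hom N M" and g: "g \<in> hom M L"
  shows "rep X q Y p M f O rep Y p Z r L g = rep X q Z r L (compose (pts N) g f)"
proof (intro equalityI subsetI)
  fix w assume "w \<in> rep X q Y p M f O rep Y p Z r L g"
  then obtain x y z where w: "w = (x, z)" and xy: "(x, y) \<in> rep X q Y p M f"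
      and yz: "(y, z) \<in> rep Y p Z r L g"
    by blast
  have "(g (f (q x)), r z) \<in> snd L"
    using N_trans[OF presentsD(2)[OF r] hom_mono[OF g repD(3)[OF xy]] repD(3)[OF yz]] .
  then show "w \<in> rep X q Z r L (compose (pts N) g f)"
    unfolding w using presentsD(5)[OF q repD(1)[OF xy]]
    by (intro repI repD(1)[OF xy] repD(2)[OF yz]) (simp add: compose_def)
next
  fix w assume w': "w \<in> rep X q Z r L (compose (pts N) g f)"
  obtain x z where w: "w = (x, z)" by (cases w)
  note xz = repD[OF w'[unfolded w]]
  note qx = presentsD(5)[OF q xz(1)]
  obtain y where y: "y \<in> pts Y" "p y = f (q x)" using presentsD(6)[OF p hom_pts[OF f qx]] by blast
  have "(x, y) \<in> rep X q Y p M f"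
    using N_refl[OF presentsD(2)[OF p] hom_pts[OF f qx]] y xz(1) by (intro repI) simp_all
  moreover have "(y, z) \<in> rep Y p Z r L g"
    using xz(3) qx y by (intro repI xz(2)) (simp_all add: compose_def)
  ultimately show "w \<in> rep X q Y p M f O rep Y p Z r L g" unfolding w by blast
qed

lemma ident_hom: "N \<in> \<N> \<Longrightarrow> (\<lambda>n\<in>pts N. n) \<in> hom N N"
  by (rule restrict_id_hom[OF nachbin_N])

lemma compose_ident:
  assumes "f \<in> hom N M"
  shows "compose (pts N) f (\<lambda>n\<in>pts N. n) = f" "compose (pts N) (\<lambda>n\<in>pts M. n) f = f"
  using hom_extensional[OF assms] hom_pts[OF assms]
  by (auto simp: compose_def fun_eq_iff restrict_def extensional_def)

lemma rep_closed:
  assumes q: "presents X q N" and p: "presents Y p M" and f: "f \<in> hom N M"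
  shows "closed_rel X Y (rep X q Y p M f)" "closed_rel Y X {(y, x). y \<in> pts Y \<and> x \<in> pts X \<and>
      (p y, f (q x)) \<in> snd M}"
proof -
  note c = hom_continuous[OF presentsD(3)[OF p]] nachbin_spaceD(3)[OF nachbin_N[OF presentsD(2)[OF
      p]]]
  have fq: "continuous_map (fst X) (fst M) (\<lambda>x. f (q x))"
    using continuous_map_compose[OF hom_continuous[OF presentsD(3)[OF q]] hom_continuous[OF f]]
        by (simp add: o_def)
  show "closed_rel X Y (rep X q Y p M f)"
    unfolding rep_def by (rule closedin_vimage_pair[OF fq c])
  show "closed_rel Y X {(y, x). y \<in> pts Y \<and> x \<in> pts X \<and> (p y, f (q x)) \<in> snd M}"
    by (rule closedin_vimage_pair[OF c(1) fq c(2)])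
qed

lemma ker_closed_preorder:
  assumes q: "presents X q N"
  shows "closed_preorder X (ker X q N)"
  unfolding closed_preorder_def
proof (intro conjI subsetI transI)
  note X = presentsD(1)[OF q] and N = presentsD(2)[OF q]
  show "closed_rel X X (ker X q N)" by (rule rep_closed(1)[OF q q ident_hom[OF N]])
  show "w \<in> ker X q N" if w: "w \<in> snd X" for w
  proof -
    obtain x y where xy: "w = (x, y)" by (cases w)
    show ?thesis
      using nachbin_spaceD(7,8)[OF nachbin[OF X] w[unfolded xy]] hom_mono[OF presentsD(3)[OF q]
          w[unfolded xy]]
      unfolding xy ker_iff[OF q] by blast
  qed
  show "(x, z) \<in> ker X q N" if "(x, y) \<in> ker X q N" "(y, z) \<in> ker X q N" for x y z
    using that N_trans[OF N] unfolding ker_iff[OF q] by blast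
qed

text \<open>The right adjoint is the conjoint \<open>?H\<close>. The unit passes through some
  \<open>y\<close> with \<open>p y = f (q x)\<close>, which exists because \<open>p\<close> is onto;
  the counit is transitivity in \<open>M\<close>.\<close>

lemma rep_left_adjoint:
  assumes q: "presents X q N" and p: "presents Y p M" and f: "f \<in> hom N M"
  shows "left_adjoint X (ker X q N) Y (ker Y p M) (rep X q Y p M f)"
proof -
  note N = presentsD(2)[OF q] and M = presentsD(2)[OF p]
  let ?G = "rep X q Y p M f" and ?E = "ker X q N" and ?F = "ker Y p M"
  let ?H = "{(y, x). y \<in> pts Y \<and> x \<in> pts X \<and> (p y, f (q x)) \<in> snd M}"
  have G: "bimodule X ?E Y ?F ?G"
    unfolding bimodule_def rep_comp[OF q q p ident_hom[OF N] f] rep_comp[OF q p p f ident_hom[OF M]]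
      compose_ident[OF f] using rep_closed(1)[OF q p f] by blast
  have fq: "f (q x) \<in> pts M" if "x \<in> pts X" for x using hom_pts[OF f presentsD(5)[OF q that]] .
  have "?F O ?H \<subseteq> ?H" "?H O ?E \<subseteq> ?H"
  proof -
    have "(y, x) \<in> ?H" if "(y, y') \<in> ?F" "(y', x) \<in> ?H" for y y' x
      using that N_trans[OF M, of "p y" "p y'" "f (q x)"] unfolding ker_iff[OF p] by blast
    then show "?F O ?H \<subseteq> ?H" by blast
    have "(y, x) \<in> ?H" if "(y, x') \<in> ?H" "(x', x) \<in> ?E" for y x' x
      using that N_trans[OF M, of "p y" "f (q x')" "f (q x)"] hom_mono[OF f, of "q x'" "q x"]
      unfolding ker_iff[OF q] by blast
    then show "?H O ?E \<subseteq> ?H" by blast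
  qed
  moreover have "?H \<subseteq> ?F O ?H" "?H \<subseteq> ?H O ?E"
  proof -
    have "(y, y) \<in> ?F" if "y \<in> pts Y" for y
      using that N_refl[OF M presentsD(5)[OF p that]] unfolding ker_iff[OF p] by blast
    then show "?H \<subseteq> ?F O ?H" by blast
    have "(x, x) \<in> ?E" if "x \<in> pts X" for x
      using that N_refl[OF N presentsD(5)[OF q that]] unfolding ker_iff[OF q] by blast
    then show "?H \<subseteq> ?H O ?E" by blast
  qed
  ultimately have H: "bimodule Y ?F X ?E ?H"
    using rep_closed(2)[OF q p f] unfolding bimodule_def by blast
  have "?E \<subseteq> ?G O ?H"
  proof
    fix w assume w: "w \<in> ?E"
    obtain x x' where xx': "w = (x, x')" by (cases w)
    have x: "x \<in> pts X" "x' \<in> pts X" "(q x, q x') \<in> snd N" using w unfolding xx' ker_iff[OF q]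
        by blast+
    obtain y where y: "y \<in> pts Y" "p y = f (q x)" using presentsD(6)[OF p fq[OF x(1)]] by blast
    have "(x, y) \<in> ?G" using N_refl[OF M fq[OF x(1)]] x y by (intro repI) simp_all
    moreover have "(y, x') \<in> ?H" using hom_mono[OF f x(3)] x y by simp
    ultimately show "w \<in> ?G O ?H" unfolding xx' by blast
  qed
  moreover have "?H O ?G \<subseteq> ?F"
  proof
    fix w assume "w \<in> ?H O ?G"
    then obtain y x y' where w: "w = (y, y')" and yx: "(y, x) \<in> ?H" and xy': "(x, y') \<in> ?G" by blast
    then show "w \<in> ?F"
      using N_trans[OF M _ repD(3)[OF xy'], of "p y"] repD(2)[OF xy'] unfolding w ker_iff[OF p]
          by blast
  qed
  ultimately show ?thesis unfolding left_adjoint_def using G H by blast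
qed

text \<open>Among the classes that \<open>g\<close> relates to \<open>x\<close>, the least is
  \<open>g (q x)\<close> itself, and it is attained because \<open>p\<close> is onto. Testing the
  inclusion there gives the inequality, with \<open>f\<close> and \<open>g\<close>
  exchanged.\<close>

lemma rep_subset_iff:
  assumes q: "presents X q N" and p: "presents Y p M" and f: "f \<in> hom N M" and g: "g \<in> hom N M"
  shows "rep X q Y p M g \<subseteq> rep X q Y p M f \<longleftrightarrow> (\<forall>n\<in>pts N. (f n, g n) \<in> snd M)"
proof
  note M = presentsD(2)[OF p]
  assume sub: "rep X q Y p M g \<subseteq> rep X q Y p M f"
  show "\<forall>n\<in>pts N. (f n, g n) \<in> snd M"
  proof
    fix n assume n: "n \<in> pts N"
    obtain x where x: "x \<in> pts X" "q x = n" using presentsD(6)[OF q n] by blast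
    obtain y where y: "y \<in> pts Y" "p y = g n" using presentsD(6)[OF p hom_pts[OF g n]] by blast
    have "(x, y) \<in> rep X q Y p M g" using N_refl[OF M hom_pts[OF g n]] x y by (intro repI) simp_all
    then have "(f (q x), p y) \<in> snd M" using sub repD(3) by blast
    then show "(f n, g n) \<in> snd M" by (simp add: x y)
  qed
next
  assume le: "\<forall>n\<in>pts N. (f n, g n) \<in> snd M"
  show "rep X q Y p M g \<subseteq> rep X q Y p M f"
  proof
    fix w assume w: "w \<in> rep X q Y p M g"
    obtain x y where xy: "w = (x, y)" by (cases w)
    note d = repD[OF w[unfolded xy]]
    have "(f (q x), g (q x)) \<in> snd M" using le presentsD(5)[OF q d(1)] by blast
    then show "w \<in> rep X q Y p M f"
      unfolding xy using N_trans[OF presentsD(2)[OF p] _ d(3)] by (intro repI d(1,2))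
  qed
qed

text \<open>A left adjoint \<open>G\<close> with right adjoint \<open>H\<close> relates \<open>x\<close> in both directions to at least one \<open>y\<close>,
  and all such \<open>y\<close> become equal in the quotient: this is the map that \<open>G\<close> represents.\<close>

lemma left_adjoint_rep:
  assumes q: "presents X q N" and p: "presents Y p M"
    and G: "left_adjoint X (ker X q N) Y (ker Y p M) G"
  obtains f where "f \<in> hom N M" "G = rep X q Y p M f"
proof -
  note X = presentsD(1)[OF q] and Y = presentsD(1)[OF p] and N = presentsD(2)[OF q]
      and M = presentsD(2)[OF p]
  let ?E = "ker X q N" and ?F = "ker Y p M"
  obtain H where H: "bimodule Y ?F X ?E H" and EGH: "?E \<subseteq> G O H" and HGF: "H O G \<subseteq> ?F"
    using G by (auto simp: left_adjoint_def)
  have clG: "closed_rel X Y G" and clH: "closed_rel Y X H" using G H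
      by (simp_all add: left_adjoint_def bimodule_def)
  \<comment> \<open>\<open>G\<close> absorbs \<open>?E\<close>, and the counit places
    \<open>H O G\<close> inside \<open>?F\<close>. Well-definedness and monotonicity of
    \<open>f\<close>, as well as the bound on \<open>G\<close>, are read off from such
    chains.\<close>
  have HEG: "(p y, p y') \<in> snd M" if "(y, x) \<in> H" "(x, x') \<in> ?E" "(x', y') \<in> G" for x x' y y'
  proof -
    have "(x, y') \<in> G" using that(2,3) left_adjoint_absorb(1)[OF G] by blast
    then have "(y, y') \<in> ?F" using that(1) HGF by blast
    then show ?thesis unfolding ker_iff[OF p] by blast
  qed
  have E_eq: "(x, x') \<in> ?E" if "x \<in> pts X" "x' \<in> pts X" "q x = q x'" for x x'
    using that N_refl[OF N presentsD(5)[OF q that(1)]] unfolding ker_iff[OF q] by simp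
  \<comment> \<open>The unit, read at the pair \<open>(x, x)\<close>.\<close>
  have "\<exists>y. (x, y) \<in> G \<and> (y, x) \<in> H" if "x \<in> pts X" for x
    using EGH E_eq[OF that that refl] by blast
  then obtain y where y: "\<And>x. x \<in> pts X \<Longrightarrow> (x, y x) \<in> G \<and> (y x, x) \<in> H" by metis
  obtain s where s: "\<And>n. n \<in> pts N \<Longrightarrow> s n \<in> pts X \<and> q (s n) = n" using presentsD(6)[OF q] by metis
  define f where "f = (\<lambda>n\<in>pts N. p (y (s n)))"
  \<comment> \<open>The value depends neither on the representative \<open>s\<close> nor on the
    choice of \<open>y\<close>: chains in both directions give two inequalities, and antisymmetry in
    \<open>M\<close> makes them an equality.\<close>
  have val: "p z = f (q x)" if "(x, z) \<in> G" "(z, x) \<in> H" for x z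
  proof -
    have x: "x \<in> pts X" using closed_rel_pts[OF clG that(1)] by blast
    note qx = presentsD(5)[OF q x]
    have e: "(s (q x), x) \<in> ?E" "(x, s (q x)) \<in> ?E" using s[OF qx] x by (simp_all add: E_eq)
    have "(p (y (s (q x))), p z) \<in> snd M" "(p z, p (y (s (q x)))) \<in> snd M"
      using HEG[OF _ e(1) that(1)] HEG[OF that(2) e(2)] y s[OF qx] by blast+
    then have "p z = p (y (s (q x)))" by (rule_tac N_antisym[OF M])
    then show ?thesis using qx by (simp add: f_def)
  qed
  have fq: "f (q x) = p (y x)" if "x \<in> pts X" for x using val y[OF that] by auto
  have y_pts: "y x \<in> pts Y" if "x \<in> pts X" for x using closed_rel_pts[OF clG] y[OF that] by blast
  have f_pts: "f n \<in> pts M" if "n \<in> pts N" for n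
    using presentsD(5)[OF p y_pts] s[OF that] fq[of "s n"] by simp
  have mono: "(f n, f n') \<in> snd M" if le: "(n, n') \<in> snd N" for n n'
  proof -
    have n: "n \<in> pts N" "n' \<in> pts N" using nachbin_spaceD(7,8)[OF nachbin_N[OF N] le] by blast+
    have "(s n, s n') \<in> ?E" using s[OF n(1)] s[OF n(2)] le unfolding ker_iff[OF q] by simp
    then have "(p (y (s n)), p (y (s n'))) \<in> snd M" using HEG y s[OF n(1)] s[OF n(2)] by blast
    then show ?thesis using n by (simp add: f_def)
  qed
  \<comment> \<open>The graph of \<open>f\<close> is the image of the closed relation
    \<open>G \<inter> H\<inverse>\<close>, so continuity follows although \<open>s\<close> and
    \<open>y\<close> are arbitrary choices.\<close>
  have "closedin (prod_topology (fst N) (fst M)) ((\<lambda>(x, y). (q x, p y)) ` (G \<inter> H\<inverse>))"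
    using nachbin_spaceD(1)[OF nachbin[OF X]] nachbin_spaceD(1)[OF nachbin[OF Y]]
      nachbin_spaceD(2)[OF nachbin_N[OF N]] nachbin_spaceD(2)[OF nachbin_N[OF M]]
      hom_continuous[OF presentsD(3)[OF q]] hom_continuous[OF presentsD(3)[OF p]]
      closedin_Int[OF clG closedin_converse[OF clH]]
    by (rule closedin_image_pair)
  also have "(\<lambda>(x, y). (q x, p y)) ` (G \<inter> H\<inverse>) = (\<lambda>n. (n, f n)) ` pts N"
  proof (intro equalityI subsetI)
    fix w assume "w \<in> (\<lambda>(x, y). (q x, p y)) ` (G \<inter> H\<inverse>)"
    then obtain x z where w: "w = (q x, p z)" and xz: "(x, z) \<in> G" "(z, x) \<in> H" by auto
    have "q x \<in> pts N" using presentsD(5)[OF q] closed_rel_pts[OF clG xz(1)] by blast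
    then show "w \<in> (\<lambda>n. (n, f n)) ` pts N" unfolding w val[OF xz] by blast
  next
    fix w assume "w \<in> (\<lambda>n. (n, f n)) ` pts N"
    then obtain n where n: "n \<in> pts N" "w = (n, f n)" by blast
    then have "w = (q (s n), p (y (s n)))" using s[OF n(1)] by (simp add: f_def)
    moreover have "(s n, y (s n)) \<in> G \<inter> H\<inverse>" using y s[OF n(1)] by blast
    ultimately show "w \<in> (\<lambda>(x, y). (q x, p y)) ` (G \<inter> H\<inverse>)"
        by (intro image_eqI[of _ _ "(s n, y (s n))"]) simp_all
  qed
  finally have "continuous_map (fst N) (fst M) f"
    using f_pts by (intro continuous_map_if_closed_graph nachbin_spaceD(1)[OF nachbin_N[OF M]]) auto
  then have f: "f \<in> hom N M" using mono by (simp add: hom_def f_def)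
  have "G = rep X q Y p M f"
  proof (intro equalityI subsetI)
    fix w assume w: "w \<in> G"
    obtain x z where xz: "w = (x, z)" by (cases w)
    note G' = w[unfolded xz] and x = closed_rel_pts[OF clG w[unfolded xz]]
    have "(p (y x), p z) \<in> snd M" using HEG[OF _ E_eq G'] y x by blast
    then show "w \<in> rep X q Y p M f" unfolding xz using x fq[of x] by (intro repI) simp_all
  next
    fix w assume w: "w \<in> rep X q Y p M f"
    obtain x z where xz: "w = (x, z)" by (cases w)
    note d = repD[OF w[unfolded xz]]
    have "(y x, z) \<in> ?F" using d fq[OF d(1)] y_pts[OF d(1)] unfolding ker_iff[OF p] by simp
    then have "(x, z) \<in> G O ?F" using y[OF d(1)] by blast
    then show "w \<in> G" unfolding xz left_adjoint_absorb(2)[OF G] .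
  qed
  with f show ?thesis by (rule that)
qed

text \<open>Fullness is \<open>left_adjoint_rep\<close> and order reflection is
  \<open>rep_subset_iff\<close>. The auxiliary facts are stated for arbitrary presentations because
  essential surjectivity compares the chosen cover of a space with a second presentation of
  it.\<close>

theorem ordspace_category_equivalent_ex_reg: "pos_equivalent (ordspace_category \<N>) (ex_reg \<C>)"
proof -
  obtain X c where c: "\<And>N. N \<in> \<N> \<Longrightarrow> presents (X N) (c N) N"
    using cover unfolding presents_def by metis
  define Fo where "Fo N = (X N, rel_of (X N) (X N) (ker (X N) (c N) N))" for N
  define Fm where "Fm N M f = rel_of (X N) (X M) (rep (X N) (c N) (X M) (c M) M f)" for N M f
  have rel_of_hom:
      "rel_of U V (rep U q V p M f) \<in> Hom (ex_reg \<C>) (U, rel_of U U (ker U q N)) (V, rel_of V V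
      (ker V p M))"
    if "presents U q N" "presents V p M" "f \<in> hom N M" for U q N V p M f
    using ex_reg_Hom[OF presentsD(1)[OF that(1)] ker_closed_preorder[OF that(1)]
        presentsD(1)[OF that(2)] ker_closed_preorder[OF that(2)]] rep_left_adjoint[OF that] by blast
  have rel_of_comp:
      "Comp (ex_reg \<C>) (U, \<U>) (V, \<V>) (W, \<W>) (rel_of V W (rep V p W r L g)) (rel_of U V (rep U q V
      p M f))
      = rel_of U W (rep U q W r L (compose (pts N) g f))"
    if "presents U q N" "presents V p M" "presents W r L" "f \<in> hom N M" "g \<in> hom M L"
    for U q N V p M W r L f g \<U> \<V> \<W>
    using that presentsD(1) rep_closed(1)
    by (simp add: ex_reg_simps rel_comp_rel_of[OF _ _ _ rep_closed(1)[OF that(1,2,4)]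
        rep_closed(1)[OF that(2,3,5)]]
        rep_comp[OF that])
  have rel_of_le:
      "Le (ex_reg \<C>) (U, \<U>) (V, \<V>) (rel_of U V (rep U q V p M f)) (rel_of U V (rep U q V p M g)) \<longleftrightarrow>
      (\<forall>n\<in>pts N. (f n, g n) \<in> snd M)"
    if "presents U q N" "presents V p M" "f \<in> hom N M" "g \<in> hom N M" for U q N V p M f g \<U> \<V>
    unfolding ex_reg_simps rep_subset_iff[OF that, symmetric]
    by (rule rel_le_rel_of[OF presentsD(1)[OF that(1)] presentsD(1)[OF that(2)]
          rep_closed(1)[OF that(1,2,4)] rep_closed(1)[OF that(1,2,3)]])
  show ?thesis
  proof (rule pos_equivalentI[where Fo = Fo and Fm = Fm])
    show "pos_category (ordspace_category \<N>)" by (rule pos_category_ordspace[OF nachbin_N])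
    show "pos_category (ex_reg \<C>)" by (rule pos_category_ex_reg)
    show "pos_functor (ordspace_category \<N>) (ex_reg \<C>) Fo Fm"
      unfolding pos_functor_def ordspace_category_simps
    proof (intro conjI ballI impI)
      fix N assume N: "N \<in> \<N>"
      show "Fo N \<in> Obj (ex_reg \<C>)"
        unfolding Fo_def ex_reg_Obj using presentsD(1)[OF c[OF N]] ker_closed_preorder[OF c[OF N]]
            by blast
      show "Fm N N (\<lambda>n\<in>pts N. n) = Ident (ex_reg \<C>) (Fo N)"
          by (simp add: Fm_def Fo_def ex_reg_simps)
      fix M f assume M: "M \<in> \<N>" and f: "f \<in> hom N M"
      show "Fm N M f \<in> Hom (ex_reg \<C>) (Fo N) (Fo M)"
        unfolding Fm_def Fo_def by (rule rel_of_hom[OF c[OF N] c[OF M] f])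
      show "Fm N L (compose (pts N) g f) =
          Comp (ex_reg \<C>) (Fo N) (Fo M) (Fo L) (Fm M L g) (Fm N M f)"
        if "L \<in> \<N>" "g \<in> hom M L" for L g
        unfolding Fm_def Fo_def
            by (rule rel_of_comp[OF c[OF N] c[OF M] c[OF that(1)] f that(2), symmetric])
      show "Le (ex_reg \<C>) (Fo N) (Fo M) (Fm N M f) (Fm N M g)"
        if "g \<in> hom N M" "\<forall>x\<in>pts N. (f x, g x) \<in> snd M" for g
        using that(2) unfolding Fm_def Fo_def rel_of_le[OF c[OF N] c[OF M] f that(1)] .
    qed
  next
    fix N M g assume "N \<in> Obj (ordspace_category \<N>)" "M \<in> Obj (ordspace_category \<N>)"
      and g: "g \<in> Hom (ex_reg \<C>) (Fo N) (Fo M)"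
    then have N: "N \<in> \<N>" and M: "M \<in> \<N>" by simp_all
    note cN = c[OF N] and cM = c[OF M]
    obtain G where G: "g = rel_of (X N) (X M) G"
      "left_adjoint (X N) (ker (X N) (c N) N) (X M) (ker (X M) (c M) M) G"
      using g unfolding Fo_def ex_reg_Hom[OF presentsD(1)[OF cN] ker_closed_preorder[OF cN]
          presentsD(1)[OF cM] ker_closed_preorder[OF cM]] by blast
    obtain f where "f \<in> hom N M" "G = rep (X N) (c N) (X M) (c M) M f"
      using left_adjoint_rep[OF cN cM G(2)] .
    then show "\<exists>f\<in>Hom (ordspace_category \<N>) N M. Fm N M f = g"
      unfolding Fm_def G(1) ordspace_category_simps by blast
  next
    fix N M f g assume "N \<in> Obj (ordspace_category \<N>)" "M \<in> Obj (ordspace_category \<N>)"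
      "f \<in> Hom (ordspace_category \<N>) N M" "g \<in> Hom (ordspace_category \<N>) N M"
      and le: "Le (ex_reg \<C>) (Fo N) (Fo M) (Fm N M f) (Fm N M g)"
    then have h: "N \<in> \<N>" "M \<in> \<N>" "f \<in> hom N M" "g \<in> hom N M" by simp_all
    show "Le (ordspace_category \<N>) N M f g"
      using le unfolding Fm_def Fo_def rel_of_le[OF c[OF h(1)] c[OF h(2)] h(3,4)]
          ordspace_category_simps .
  next
    fix a assume "a \<in> Obj (ex_reg \<C>)"
    then obtain U E where a: "a = (U, rel_of U U E)" and U: "U \<in> \<O>" "closed_preorder U E"
      unfolding ex_reg_Obj by blast
    obtain N q where N: "N \<in> \<N>" and q: "presents U q N"
      and E: "E = {(x, y). x \<in> pts U \<and> y \<in> pts U \<and> (q x, q y) \<in> snd N}"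
      using quotient[OF U] U(1) unfolding presents_def by blast
    have E': "E = ker U q N" using rep_ident[OF q] E by simp
    note cN = c[OF N] and i = ident_hom[OF N]
    \<comment> \<open>Two presentations of one space are isomorphic in the completion: the identity
      of \<open>N\<close>, read in both directions, gives mutually inverse relations.\<close>
    have "is_iso (ex_reg \<C>) (Fo N) a (rel_of (X N) U (rep (X N) (c N) U q N (\<lambda>n\<in>pts N. n)))"
      unfolding is_iso_def Fo_def a E'
    proof (intro conjI bexI)
      show "rel_of (X N) U (rep (X N) (c N) U q N (\<lambda>n\<in>pts N. n)) \<in>
          Hom (ex_reg \<C>) (X N, rel_of (X N) (X N) (ker (X N) (c N) N)) (U, rel_of U U (ker U q N))"
        by (rule rel_of_hom[OF cN q i])
      show "rel_of U (X N) (rep U q (X N) (c N) N (\<lambda>n\<in>pts N. n)) \<in>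
          Hom (ex_reg \<C>) (U, rel_of U U (ker U q N)) (X N, rel_of (X N) (X N) (ker (X N) (c N) N))"
        by (rule rel_of_hom[OF q cN i])
    qed (simp_all only: rel_of_comp[OF cN q cN i i] rel_of_comp[OF q cN q i i] compose_ident[OF i]
        ex_reg_simps(1))
    then show "\<exists>N\<in>Obj (ordspace_category \<N>). \<exists>e. is_iso (ex_reg \<C>) (Fo N) a e"
      unfolding ordspace_category_simps using N by blast
  qed
qed

end

section \<open>Weight\<close>

lemma lesspoll_Times:
  assumes C: "infinite C" and A: "A \<prec> C" and B: "B \<prec> C"
  shows "A \<times> B \<prec> C"
proof (cases "finite A \<and> finite B")
  case True
  then show ?thesis using C by (simp add: finite_lesspoll_infinite)
next
  case False
  have "A \<times> B \<prec> C" if "infinite B" "A \<lesssim> B" "B \<prec> C" for A B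
  proof -
    have "A \<times> B \<lesssim> B \<times> B" using that by (intro times_lepoll_mono) simp_all
    also have "\<dots> \<lesssim> B" by (rule times_self_lepoll[OF that(1)])
    finally show ?thesis using that(3) by (rule lesspoll_trans1)
  qed
  note * = this
  have "A \<lesssim> B \<or> B \<lesssim> A"
    using ordLeq_total[OF card_of_Well_order card_of_Well_order, of A B]
    unfolding lepoll_def card_of_ordLeq[symmetric] by blast
  moreover have fin: "finite A" if "A \<lesssim> B" "finite B" for A :: "'x set" and B :: "'y set"
    using that unfolding lepoll_def by (blast intro: inj_on_finite)
  ultimately show ?thesis
  proof (elim disjE)
    assume le: "A \<lesssim> B"
    then have "infinite B" using False fin by blast
    then show ?thesis using * le B by blast
  next
    assume le: "B \<lesssim> A"
    then have "infinite A" using False fin by blast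
    then have "B \<times> A \<prec> C" using * le A by blast
    moreover have "A \<times> B \<lesssim> B \<times> A"
      by (rule lepoll_trans1[OF times_commute_eqpoll]) simp
    ultimately show ?thesis by (rule lesspoll_trans1[rotated])
  qed
qed

lemma lesspoll_Fpow:
  assumes "infinite C" "A \<prec> C"
  shows "Fpow A \<prec> C"
proof (cases "finite A")
  case True
  then show ?thesis using assms(1) by (simp add: finite_lesspoll_infinite Fpow_Pow_finite)
next
  case False
  then show ?thesis using lesspoll_trans1[OF Fpow_lepoll assms(2)] by blast
qed

text \<open>The bound is a set of an independent type, since products and covers are first built on
  pairs and families and copied to \<open>'k set\<close> only afterwards.\<close>

definition weight_less :: "'a topology \<Rightarrow> 'k set \<Rightarrow> bool" where
  "weight_less T K \<longleftrightarrow> (\<exists>\<B>. \<B> \<prec> K \<and> (\<forall>V\<in>\<B>. openin T V) \<and>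
    (\<forall>U x. openin T U \<and> x \<in> U \<longrightarrow> (\<exists>V\<in>\<B>. x \<in> V \<and> V \<subseteq> U)))"

lemma small_space_eq: "small_space (T :: 'k set topology) \<longleftrightarrow> weight_less T (UNIV :: 'k set)"
  by (simp add: small_space_def weight_less_def)

lemma weight_lessE:
  assumes "weight_less T K"
  obtains \<B> where "\<B> \<prec> K" "\<And>V. V \<in> \<B> \<Longrightarrow> openin T V"
    "\<And>U x. openin T U \<Longrightarrow> x \<in> U \<Longrightarrow> \<exists>V\<in>\<B>. x \<in> V \<and> V \<subseteq> U"
  using assms unfolding weight_less_def by metis

lemma weight_less_subtopology:
  assumes "weight_less T K"
  shows "weight_less (subtopology T A) K"
proof -
  obtain \<B> where \<B>: "\<B> \<prec> K" "\<And>V. V \<in> \<B> \<Longrightarrow> openin T V"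
    "\<And>U x. openin T U \<Longrightarrow> x \<in> U \<Longrightarrow> \<exists>V\<in>\<B>. x \<in> V \<and> V \<subseteq> U"
    using assms by (rule weight_lessE) blast
  show ?thesis
    unfolding weight_less_def
  proof (intro exI[of _ "(\<lambda>V. V \<inter> A) ` \<B>"] conjI ballI allI impI; (elim conjE)?)
    show "(\<lambda>V. V \<inter> A) ` \<B> \<prec> K" by (rule lesspoll_trans1[OF image_lepoll \<B>(1)])
    show "openin (subtopology T A) V" if "V \<in> (\<lambda>V. V \<inter> A) ` \<B>" for V
      using that \<B>(2) by (auto simp: openin_subtopology)
    fix U x assume "openin (subtopology T A) U" "x \<in> U"
    then obtain W where W: "openin T W" "U = W \<inter> A" "x \<in> W" "x \<in> A"
        by (auto simp: openin_subtopology)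
    obtain V where "V \<in> \<B>" "x \<in> V" "V \<subseteq> W" using \<B>(3)[OF W(1,3)] by blast
    then show "\<exists>V\<in>(\<lambda>V. V \<inter> A) ` \<B>. x \<in> V \<and> V \<subseteq> U"
      using W(4) unfolding W(2) by (intro bexI[of _ "V \<inter> A"]) auto
  qed
qed

lemma weight_less_prod_topology:
  assumes K: "infinite K" and S: "weight_less S K" and T: "weight_less T K"
  shows "weight_less (prod_topology S T) K"
proof -
  obtain \<A> where \<A>: "\<A> \<prec> K" "\<And>V. V \<in> \<A> \<Longrightarrow> openin S V"
    "\<And>U x. openin S U \<Longrightarrow> x \<in> U \<Longrightarrow> \<exists>V\<in>\<A>. x \<in> V \<and> V \<subseteq> U"
    using S by (rule weight_lessE) blast
  obtain \<B> where \<B>: "\<B> \<prec> K" "\<And>V. V \<in> \<B> \<Longrightarrow> openin T V"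
    "\<And>U x. openin T U \<Longrightarrow> x \<in> U \<Longrightarrow> \<exists>V\<in>\<B>. x \<in> V \<and> V \<subseteq> U"
    using T by (rule weight_lessE) blast
  show ?thesis
    unfolding weight_less_def
  proof (intro exI[of _ "(\<lambda>(U, V). U \<times> V) ` (\<A> \<times> \<B>)"] conjI ballI allI impI; (elim conjE)?)
    show "(\<lambda>(U, V). U \<times> V) ` (\<A> \<times> \<B>) \<prec> K"
      by (rule lesspoll_trans1[OF image_lepoll lesspoll_Times[OF K \<A>(1) \<B>(1)]])
    show "openin (prod_topology S T) V" if "V \<in> (\<lambda>(U, V). U \<times> V) ` (\<A> \<times> \<B>)" for V
      using that \<A>(2) \<B>(2) by (auto simp: openin_prod_Times_iff)
    fix W z assume W: "openin (prod_topology S T) W" "z \<in> W"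
    obtain x y where z: "z = (x, y)" by (cases z)
    obtain U V where UV: "openin S U" "openin T V" "x \<in> U" "y \<in> V" "U \<times> V \<subseteq> W"
      using W(1)[unfolded openin_prod_topology_alt, rule_format, OF W(2)[unfolded z]]
          by (elim exE conjE)
    obtain U' where "U' \<in> \<A>" "x \<in> U'" "U' \<subseteq> U" using \<A>(3)[OF UV(1,3)] by blast
    moreover obtain V' where "V' \<in> \<B>" "y \<in> V'" "V' \<subseteq> V" using \<B>(3)[OF UV(2,4)] by blast
    ultimately show "\<exists>V\<in>(\<lambda>(U, V). U \<times> V) ` (\<A> \<times> \<B>). z \<in> V \<and> V \<subseteq> W"
      using UV(5) unfolding z by (intro bexI[of _ "U' \<times> V'"]) auto
  qed
qed

text \<open>The sets \<open>q(X) - q(X - W)\<close>,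
    for finite unions \<open>W\<close> of basic open sets, form a base of the image.\<close>

lemma weight_less_image:
  assumes K: "infinite K" and comp: "compact_space S"
      and q: "continuous_map S T q" "closed_map S T q"
    and surj: "q ` topspace S = topspace T" and T: "t1_space T" and w: "weight_less S K"
  shows "weight_less T K"
proof -
  obtain \<B> where \<B>: "\<B> \<prec> K" "\<And>V. V \<in> \<B> \<Longrightarrow> openin S V"
    "\<And>U x. openin S U \<Longrightarrow> x \<in> U \<Longrightarrow> \<exists>V\<in>\<B>. x \<in> V \<and> V \<subseteq> U"
    using w by (rule weight_lessE) blast
  define g where "g \<F> = topspace T - q ` (topspace S - \<Union>\<F>)" for \<F>
  show ?thesis
    unfolding weight_less_def
  proof (intro exI[of _ "g ` Fpow \<B>"] conjI ballI allI impI; (elim conjE)?)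
    \<comment> \<open>Finite unions of basic sets are indexed by finite subsets of the base, and
      their number stays below the infinite bound.\<close>
    show "g ` Fpow \<B> \<prec> K" by (rule lesspoll_trans1[OF image_lepoll lesspoll_Fpow[OF K \<B>(1)]])
    show "openin T V" if V: "V \<in> g ` Fpow \<B>" for V
    proof -
      obtain \<F> where "\<F> \<in> Fpow \<B>" "V = g \<F>" using V by (elim imageE)
      then have \<F>: "\<F> \<subseteq> \<B>" "V = g \<F>" by (simp_all add: Fpow_def)
      have "openin S (\<Union>\<F>)" using \<F>(1) \<B>(2) by blast
      then have "closedin T (q ` (topspace S - \<Union>\<F>))"
        using q(2) by (simp add: closed_map_def closedin_diff)
      then show ?thesis unfolding \<F>(2) g_def by blast
    qed
    fix U y assume U: "openin T U" "y \<in> U"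
    have y: "y \<in> topspace T" using U openin_subset by blast
    let ?A = "{x \<in> topspace S. q x \<in> {y}}" and ?U = "{x \<in> topspace S. q x \<in> U}"
    \<comment> \<open>The fibre over \<open>y\<close> is compact, so finitely many basic sets inside
      the preimage of \<open>U\<close> cover it; this is why finite unions suffice.\<close>
    have "closedin T {y}" using T y by (simp add: t1_space_closedin_singleton)
    then have "compactin S ?A"
      using closedin_continuous_map_preimage[OF q(1)] comp closedin_compact_space by blast
    moreover have oU: "openin S ?U" by (rule openin_continuous_map_preimage[OF q(1) U(1)])
    have "?A \<subseteq> \<Union>{V \<in> \<B>. V \<subseteq> ?U}"
    proof
      fix x assume "x \<in> ?A"
      then have "x \<in> ?U" using U(2) by simp
      then show "x \<in> \<Union>{V \<in> \<B>. V \<subseteq> ?U}" using \<B>(3)[OF oU] by blast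
    qed
    ultimately obtain \<F> where \<F>: "finite \<F>" "\<F> \<subseteq> {V \<in> \<B>. V \<subseteq> ?U}" "?A \<subseteq> \<Union>\<F>"
      unfolding compactin_def using \<B>(2) by (metis (no_types, lifting) mem_Collect_eq)
    have "g \<F> \<in> g ` Fpow \<B>" using \<F>(1,2) unfolding Fpow_def by blast
    moreover have "y \<in> g \<F>" using \<F>(3) y by (auto simp: g_def)
    moreover have "g \<F> \<subseteq> U"
    proof
      fix z assume z: "z \<in> g \<F>"
      then have "z \<in> q ` topspace S" unfolding surj g_def by blast
      then obtain x where x: "x \<in> topspace S" "q x = z" by blast
      then have "x \<in> \<Union>\<F>" using z unfolding g_def by blast
      then show "z \<in> U" using \<F>(2) x by blast
    qed
    ultimately show "\<exists>V\<in>g ` Fpow \<B>. y \<in> V \<and> V \<subseteq> U" by blast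
  qed
qed

lemma weight_less_compact_Hausdorff_image:
  assumes "infinite K" "compact_space S" "continuous_map S T q" "q ` topspace S = topspace T"
    "Hausdorff_space T" "weight_less S K"
  shows "weight_less T K"
  using assms continuous_imp_closed_map[of S T q]
  by (intro weight_less_image[of K S T q]) (simp_all add: Hausdorff_imp_t1_space)

text \<open>In a compact space a point-separating family of clopen sets is a subbase: the complement
  of an open \<open>U\<close> is compact and is covered by complements of members that contain
  \<open>x\<close>, so finitely many members around \<open>x\<close> have their intersection inside
  \<open>U\<close>.\<close>

lemma weight_less_clopen_separation:
  assumes K: "infinite K" and comp: "compact_space T"
      and S: "\<S> \<prec> K" "\<And>V. V \<in> \<S> \<Longrightarrow> openin T V \<and> closedin T V"
    and sep: "\<And>x y. \<lbrakk>x \<in> topspace T; y \<in> topspace T; x \<noteq> y\<rbrakk> \<Longrightarrow> \<exists>V\<in>\<S>. x \<in> V \<and> y \<notin> V"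
  shows "weight_less T K"
  unfolding weight_less_def
proof (intro exI[of _ "(\<lambda>\<F>. topspace T \<inter> \<Inter>\<F>) ` Fpow \<S>"] conjI ballI allI impI; (elim conjE)?)
  \<comment> \<open>Intersecting with \<open>topspace T\<close> gives the empty family the whole
    space as its value.\<close>
  show "(\<lambda>\<F>. topspace T \<inter> \<Inter>\<F>) ` Fpow \<S> \<prec> K"
    by (rule lesspoll_trans1[OF image_lepoll lesspoll_Fpow[OF K S(1)]])
  show "openin T V" if V: "V \<in> (\<lambda>\<F>. topspace T \<inter> \<Inter>\<F>) ` Fpow \<S>" for V
  proof -
    obtain \<F> where "\<F> \<in> Fpow \<S>" "V = topspace T \<inter> \<Inter>\<F>" using V by (elim imageE)
    then have \<F>: "finite \<F>" "\<F> \<subseteq> \<S>" "V = topspace T \<inter> \<Inter>\<F>" by (simp_all add: Fpow_def)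
    have "openin T (\<Inter>(insert (topspace T) \<F>))"
      using \<F> S(2) by (intro openin_Inter) auto
    then show ?thesis using \<F>(3) by simp
  qed
  fix U x assume U: "openin T U" "x \<in> U"
  have x: "x \<in> topspace T" using U openin_subset by blast
  let ?\<V> = "{V \<in> \<S>. x \<in> V}"
  have "compactin T (topspace T - U)" using U(1) comp
      by (simp add: closedin_compact_space closedin_diff)
  moreover have "topspace T - U \<subseteq> \<Union>((\<lambda>V. topspace T - V) ` ?\<V>)"
  proof
    fix y assume y: "y \<in> topspace T - U"
    then obtain V where "V \<in> \<S>" "x \<in> V" "y \<notin> V" using sep[OF x, of y] U(2) by blast
    then show "y \<in> \<Union>((\<lambda>V. topspace T - V) ` ?\<V>)" using y by blast
  qed
  moreover have "\<forall>W\<in>(\<lambda>V. topspace T - V) ` ?\<V>. openin T W" using S(2) by blast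
  ultimately obtain \<G> where \<G>: "finite \<G>" "\<G> \<subseteq> (\<lambda>V. topspace T - V) ` ?\<V>" "topspace T - U \<subseteq> \<Union>\<G>"
    unfolding compactin_def by meson
  obtain \<F> where \<F>': "\<F> \<subseteq> ?\<V>" "finite \<F>" "\<G> = (\<lambda>V. topspace T - V) ` \<F>"
    using finite_subset_image[OF \<G>(1,2)] by blast
  note \<F> = \<F>'(2,1) \<G>(3)[unfolded \<F>'(3)]
  show "\<exists>V\<in>(\<lambda>\<F>. topspace T \<inter> \<Inter>\<F>) ` Fpow \<S>. x \<in> V \<and> V \<subseteq> U"
  proof (intro bexI[of _ "topspace T \<inter> \<Inter>\<F>"] conjI imageI)
    show "topspace T \<inter> \<Inter>\<F> \<subseteq> U" using \<F>(3) by blast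
    show "\<F> \<in> Fpow \<S>" using \<F>(1,2) by (auto simp: Fpow_def)
  qed (use x \<F>(2) in blast)
qed

section \<open>Constructions of ordered spaces\<close>

text \<open>Transport of structure along an injection, the means by which auxiliary spaces are moved
  onto points of type \<open>'k set\<close>.\<close>

lemma homeomorphic_copy:
  assumes "inj_on f (topspace T)"
  obtains T' where "homeomorphic_map T T' f" "topspace T' = f ` topspace T"
proof -
  define g where "g = inv_into (topspace T) f"
  have gf: "g (f x) = x" if "x \<in> topspace T" for x unfolding g_def using assms that by simp
  define T' where "T' = pullback_topology (f ` topspace T) g T"
  have top: "topspace T' = f ` topspace T" using gf
      by (auto simp: T'_def topspace_pullback_topology)
  have "continuous_map T' T g"
    unfolding T'_def using continuous_map_pullback[OF continuous_map_id[of T]] by (metis id_comp)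
  moreover have "continuous_map T T' f"
    unfolding T'_def
        by (intro continuous_map_pullback' continuous_map_eq[OF continuous_map_id]) (auto simp: gf)
  ultimately have "homeomorphic_maps T T' f g"
    unfolding homeomorphic_maps_def using gf top by auto
  then show ?thesis using that top homeomorphic_maps_map by blast
qed

text \<open>For a pair outside the order, a separating clopen upper set \<open>U\<close> gives the
  open box \<open>U \<times> (topspace T - U)\<close> around the pair, and this box misses the
  order.\<close>

lemma priestley_imp_nachbin:
  assumes "priestley_space X"
  shows "nachbin_space X"
proof -
  obtain T r where X: "X = (T, r)" by (cases X)
  have po: "partial_order_on (topspace T) r" and comp: "compact_space T"
    and sep: "\<And>x y. \<lbrakk>x \<in> topspace T; y \<in> topspace T; (x, y) \<notin> r\<rbrakk> \<Longrightarrow>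
      \<exists>U. openin T U \<and> closedin T U \<and> (\<forall>u\<in>U. \<forall>v. (u, v) \<in> r \<longrightarrow> v \<in> U) \<and> x \<in> U \<and> y \<notin> U"
    using assms unfolding X priestley_space_def ordered_space_def by auto
  have sub: "r \<subseteq> topspace T \<times> topspace T" using po
      by (simp add: partial_order_on_def preorder_on_def)
  have "openin (prod_topology T T) (topspace T \<times> topspace T - r)"
    unfolding openin_prod_topology_alt
  proof (intro allI impI)
    fix x y assume xy: "(x, y) \<in> topspace T \<times> topspace T - r"
    then obtain U where U: "openin T U" "closedin T U" "\<forall>u\<in>U. \<forall>v. (u, v) \<in> r \<longrightarrow> v \<in> U" "x \<in> U"
        "y \<notin> U"
      using sep[of x y] by blast
    have "U \<times> (topspace T - U) \<subseteq> topspace T \<times> topspace T - r" using U(3) openin_subset[OF U(1)]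
        by blast
    then show "\<exists>U V. openin T U \<and> openin T V \<and> x \<in> U \<and> y \<in> V \<and> U \<times> V \<subseteq> topspace T \<times> topspace T - r"
      using U xy by (intro exI[of _ U] exI[of _ "topspace T - U"]) auto
  qed
  then have "closedin (prod_topology T T) r" unfolding closedin_def using sub by simp
  then show ?thesis using po comp by (simp add: X nachbin_space_def ordered_space_def)
qed

text \<open>A failure of the induced order is a failure in \<open>X\<close> or in \<open>Y\<close>,
  and the separating clopen upper set pulls back along \<open>p\<close> or \<open>q\<close>. Closed
  subspaces are the case where both maps are the inclusion, binary products the case of the two
  projections.\<close>

lemma priestley_initial:
  assumes comp: "compact_space P" and X: "priestley_space X" and Y: "priestley_space Y"
    and p: "continuous_map P (fst X) p" and q: "continuous_map P (fst Y) q"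
    and inj: "\<And>a b. \<lbrakk>a \<in> topspace P; b \<in> topspace P; p a = p b; q a = q b\<rbrakk> \<Longrightarrow> a = b"
    and r: "r = {(a, b). a \<in> topspace P \<and> b \<in> topspace P \<and> (p a, p b) \<in> snd X \<and> (q a, q b) \<in> snd Y}"
  shows "priestley_space (P, r)"
proof -
  note nX = nachbin_spaceD[OF priestley_imp_nachbin[OF X]]
      and nY = nachbin_spaceD[OF priestley_imp_nachbin[OF Y]]
  have pts: "p a \<in> pts X" "q a \<in> pts Y" if "a \<in> topspace P" for a
    using that continuous_map_funspace[OF p] continuous_map_funspace[OF q] by blast+
  have "partial_order_on (topspace P) r"
    unfolding partial_order_on_def preorder_on_def
  proof (intro conjI)
    show "refl_on (topspace P) r" unfolding refl_on_def r using nX(4) nY(4) pts by auto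
    show "r \<subseteq> topspace P \<times> topspace P" unfolding r by blast
    show "trans r" unfolding r trans_def using nX(5) nY(5) by blast
    show "antisym r" unfolding r antisym_def using nX(6) nY(6) inj by blast
  qed
  moreover have "\<exists>U. openin P U \<and> closedin P U \<and> (\<forall>u\<in>U. \<forall>v. (u, v) \<in> r \<longrightarrow> v \<in> U) \<and> x \<in> U \<and> y \<notin> U"
    if xy: "x \<in> topspace P" "y \<in> topspace P" "(x, y) \<notin> r" for x y
  proof -
    have *: "?thesis" if f: "continuous_map P (fst Z) f" and Z: "priestley_space Z"
      and n: "(f x, f y) \<notin> snd Z" and m: "\<And>a b. (a, b) \<in> r \<Longrightarrow> (f a, f b) \<in> snd Z"
          for f :: "'a \<Rightarrow> 'd" and Z
    proof -
      have "f x \<in> pts Z" "f y \<in> pts Z" using xy continuous_map_funspace[OF f] by blast+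
      then obtain U where U: "openin (fst Z) U" "closedin (fst Z) U"
        "\<forall>u\<in>U. \<forall>v. (u, v) \<in> snd Z \<longrightarrow> v \<in> U" "f x \<in> U" "f y \<notin> U"
        using Z n unfolding priestley_space_def case_prod_unfold by blast
      have "v \<in> topspace P" if "(u, v) \<in> r" for u v using that unfolding r by blast
      then have "\<forall>u\<in>{a \<in> topspace P. f a \<in> U}. \<forall>v. (u, v) \<in> r \<longrightarrow> v \<in> {a \<in> topspace P. f a \<in> U}"
        using U(3) m by blast
      moreover note openin_continuous_map_preimage[OF f U(1)] closedin_continuous_map_preimage[OF
          f U(2)]
      moreover have "x \<in> {a \<in> topspace P. f a \<in> U}" "y \<notin> {a \<in> topspace P. f a \<in> U}"
          using xy U(4,5) by simp_all
      ultimately show ?thesis by blast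
    qed
    have "(p x, p y) \<notin> snd X \<or> (q x, q y) \<notin> snd Y" using xy unfolding r by blast
    then show ?thesis
    proof
      assume "(p x, p y) \<notin> snd X"
      then show ?thesis using *[OF p X] unfolding r by blast
    next
      assume "(q x, q y) \<notin> snd Y"
      then show ?thesis using *[OF q Y] unfolding r by blast
    qed
  qed
  ultimately show ?thesis using comp by (simp add: priestley_space_def ordered_space_def)
qed

text \<open>The order induced from two discrete orders is discrete because \<open>p\<close> and
  \<open>q\<close> are jointly injective.\<close>

lemma stone_initial:
  assumes comp: "compact_space P" and X: "stone_space X" and Y: "stone_space Y"
    and p: "continuous_map P (fst X) p" and q: "continuous_map P (fst Y) q"
    and inj: "\<And>a b. \<lbrakk>a \<in> topspace P; b \<in> topspace P; p a = p b; q a = q b\<rbrakk> \<Longrightarrow> a = b"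
    and r: "r = {(a, b). a \<in> topspace P \<and> b \<in> topspace P \<and> (p a, p b) \<in> snd X \<and> (q a, q b) \<in> snd Y}"
  shows "stone_space (P, r)"
proof -
  have XY: "priestley_space X" "priestley_space Y" "snd X = Id_on (pts X)" "snd Y = Id_on (pts Y)"
    using X Y by (auto simp: stone_space_def split: prod.splits)
  have pts: "p a \<in> pts X" "q a \<in> pts Y" if "a \<in> topspace P" for a
    using that continuous_map_funspace[OF p] continuous_map_funspace[OF q] by blast+
  have "r = Id_on (topspace P)"
  proof (intro equalityI subrelI)
    fix a b assume "(a, b) \<in> r"
    then have "a \<in> topspace P" "b \<in> topspace P" "p a = p b" "q a = q b"
      unfolding r XY(3,4) by (simp_all add: Id_on_iff)
    then have "a = b" by (rule inj)
    with \<open>a \<in> topspace P\<close> show "(a, b) \<in> Id_on (topspace P)" by blast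
  next
    fix a b assume "(a, b) \<in> Id_on (topspace P)"
    then have ab: "a = b" "b \<in> topspace P" by blast+
    show "(a, b) \<in> r" using pts[OF ab(2)] ab unfolding r XY(3,4) by (simp add: Id_on_iff)
  qed
  moreover have "priestley_space (P, r)"
      by (rule priestley_initial[OF comp XY(1,2) p q _ r]) (rule inj)
  ultimately show ?thesis unfolding stone_space_def by blast
qed

text \<open>This is the quotient by \<open>E \<inter> E\<inverse>\<close>, with chosen
  representatives as points so that the type is kept. The saturation of a closed set is a projection
  along a compact space, so \<open>q\<close> is closed. A closed continuous image of a normal
  Hausdorff space is Hausdorff, and the weight bound passes to it; the order is the closed image of
  \<open>E\<close>.\<close>

lemma nachbin_quotient:
  assumes K: "infinite K" and X: "nachbin_space X" "weight_less (fst X) K"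
    and E: "closedin (prod_topology (fst X) (fst X)) E" "snd X \<subseteq> E" "trans E"
  obtains N q where "nachbin_space N" "weight_less (fst N) K" "q \<in> hom X N" "q ` pts X = pts N"
    "E = {(x, y). x \<in> pts X \<and> y \<in> pts X \<and> (q x, q y) \<in> snd N}"
proof -
  let ?T = "fst X"
  have E_pts: "x \<in> pts X" "y \<in> pts X" if "(x, y) \<in> E" for x y
    using that closedin_subset[OF E(1)] by auto
  have E_refl: "(x, x) \<in> E" if "x \<in> pts X" for x using nachbin_spaceD(4)[OF X(1) that] E(2) by blast
  define R where "R = E \<inter> E\<inverse>"
  have R: "closedin (prod_topology ?T ?T) R" unfolding R_def
      by (intro closedin_Int E(1) closedin_converse)
  \<comment> \<open>Equivalent points are \<open>R\<close>-related to the same points, so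
    \<open>SOME\<close> makes the same choice throughout a class.\<close>
  define q where "q = (\<lambda>x\<in>pts X. SOME y. (x, y) \<in> R)"
  have q_R: "(x, q x) \<in> R" if "x \<in> pts X" for x
    unfolding q_def restrict_apply'[OF that]
        by (rule someI[of _ x]) (simp add: R_def E_refl[OF that])
  have q_eq: "q x = q y \<longleftrightarrow> (x, y) \<in> R" if "x \<in> pts X" "y \<in> pts X" for x y
  proof
    assume "q x = q y"
    then show "(x, y) \<in> R" using q_R[OF that(1)] q_R[OF that(2)] transD[OF E(3)] unfolding R_def
        by auto
  next
    assume "(x, y) \<in> R"
    then have "(x, z) \<in> R \<longleftrightarrow> (y, z) \<in> R" for z using transD[OF E(3)] unfolding R_def by blast
    then show "q x = q y" using that by (simp add: q_def)
  qed
  have qE: "(x, y) \<in> E" if "x \<in> pts X" "y \<in> pts X" "(x', y') \<in> E" "q x = q x'" "q y = q y'"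
      for x y x' y'
  proof -
    have "(x, x') \<in> E" "(y', y) \<in> E"
      using that q_eq[OF that(1) E_pts(1)[OF that(3)]] q_eq[OF that(2) E_pts(2)[OF that(3)]]
          unfolding R_def by auto
    then show ?thesis using that(3) transD[OF E(3)] by blast
  qed
  define T where "T = topology (\<lambda>U. U \<subseteq> q ` pts X \<and> openin ?T {x \<in> pts X. q x \<in> U})"
  have "istopology (\<lambda>U. U \<subseteq> q ` pts X \<and> openin ?T {x \<in> pts X. q x \<in> U})"
    unfolding istopology_def
  proof (intro conjI allI impI; (elim conjE)?)
    fix U V assume "openin ?T {x \<in> pts X. q x \<in> U}" "openin ?T {x \<in> pts X. q x \<in> V}"
    then have "openin ?T ({x \<in> pts X. q x \<in> U} \<inter> {x \<in> pts X. q x \<in> V})" by (rule openin_Int)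
    then show "openin ?T {x \<in> pts X. q x \<in> U \<inter> V}" by (rule back_subst[of "openin ?T"]) blast
  next
    fix \<U> assume U: "\<forall>U\<in>\<U>. U \<subseteq> q ` pts X \<and> openin ?T {x \<in> pts X. q x \<in> U}"
    then have "openin ?T (\<Union>U\<in>\<U>. {x \<in> pts X. q x \<in> U})" by blast
    then show "openin ?T {x \<in> pts X. q x \<in> \<Union>\<U>}" by (rule back_subst[of "openin ?T"]) blast
    show "\<Union>\<U> \<subseteq> q ` pts X" using U by blast
  qed blast
  then have opT: "openin T U \<longleftrightarrow> U \<subseteq> q ` pts X \<and> openin ?T {x \<in> pts X. q x \<in> U}" for U
    unfolding T_def by (simp add: topology_inverse')
  have "openin T (q ` pts X)" unfolding opT
    by (intro conjI subset_refl) (rule back_subst[of "openin ?T" "pts X"], simp, blast)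
  moreover have "topspace T \<subseteq> q ` pts X" using opT openin_topspace by blast
  ultimately have top: "topspace T = q ` pts X" using openin_subset by blast
  have q_cont: "continuous_map ?T T q" unfolding continuous_map by (simp add: top opT)
  have q_closed: "closed_map ?T T q"
    unfolding closed_map_def
  proof (intro allI impI)
    fix C assume C: "closedin ?T C"
    have "closedin ?T (snd ` (R \<inter> C \<times> pts X))"
      using closed_map_snd[OF nachbin_spaceD(1)[OF X(1)], of ?T] R C
      unfolding closed_map_def by (simp add: closedin_Int closedin_prod_Times_iff)
    also have "snd ` (R \<inter> C \<times> pts X) = {x \<in> pts X. q x \<in> q ` C}"
    proof (intro equalityI subsetI)
      fix y assume "y \<in> snd ` (R \<inter> C \<times> pts X)"
      then obtain x where x: "(x, y) \<in> R" "x \<in> C" "y \<in> pts X" by force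
      then have "q y = q x" using q_eq[of x y] closedin_subset[OF C] by auto
      then show "y \<in> {x \<in> pts X. q x \<in> q ` C}" using x by blast
    next
      fix y assume "y \<in> {x \<in> pts X. q x \<in> q ` C}"
      then obtain x where x: "y \<in> pts X" "x \<in> C" "q y = q x" by blast
      then have "(x, y) \<in> R \<inter> C \<times> pts X" using q_eq[of x y] closedin_subset[OF C] by auto
      then show "y \<in> snd ` (R \<inter> C \<times> pts X)" by force
    qed
    finally have "openin ?T (pts X - {x \<in> pts X. q x \<in> q ` C})" by blast
    moreover have "pts X - {x \<in> pts X. q x \<in> q ` C} = {x \<in> pts X. q x \<in> topspace T - q ` C}"
        unfolding top by blast
    ultimately have "openin T (topspace T - q ` C)" unfolding opT top by simp
    then show "closedin T (q ` C)" using closedin_subset[OF C] unfolding closedin_def top by blast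
  qed
  have haus: "Hausdorff_space T"
    using normal_Hausdorff_space_closed_continuous_map_image[OF _ nachbin_spaceD(2)[OF X(1)]
        q_closed q_cont top[symmetric]]
      compact_Hausdorff_or_regular_imp_normal_space nachbin_spaceD(1,2)[OF X(1)] by blast
  have comp: "compact_space T"
    using image_compactin[OF _ q_cont, of "pts X"] nachbin_spaceD(1)[OF X(1)] top
        by (simp add: compact_space_def)
  define r where "r = (\<lambda>(x, y). (q x, q y)) ` E"
  have r_iff: "(q x, q y) \<in> r \<longleftrightarrow> (x, y) \<in> E" if "x \<in> pts X" "y \<in> pts X" for x y
  proof
    assume "(q x, q y) \<in> r"
    then obtain x' y' where "(x', y') \<in> E" "q x = q x'" "q y = q y'" unfolding r_def by auto
    then show "(x, y) \<in> E" using qE that by blast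
  next
    assume "(x, y) \<in> E"
    then show "(q x, q y) \<in> r" unfolding r_def by force
  qed
  have r_pts: "\<exists>x\<in>pts X. \<exists>y\<in>pts X. a = q x \<and> b = q y" if "(a, b) \<in> r" for a b
  proof -
    obtain x y where "(x, y) \<in> E" "a = q x" "b = q y" using \<open>(a, b) \<in> r\<close> unfolding r_def by auto
    then show ?thesis using E_pts by blast
  qed
  have "closedin (prod_topology T T) r"
    unfolding r_def using nachbin_spaceD(1)[OF X(1)] haus q_cont E(1) by (intro closedin_image_pair)
  moreover have "partial_order_on (topspace T) r"
    unfolding partial_order_on_def preorder_on_def
  proof (intro conjI)
    show "refl_on (topspace T) r" unfolding refl_on_def top using r_iff E_refl by blast
    show "r \<subseteq> topspace T \<times> topspace T" unfolding top using r_pts by fast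
    show "trans r"
    proof (rule transI)
      fix a b c assume abc: "(a, b) \<in> r" "(b, c) \<in> r"
      obtain x y where x: "x \<in> pts X" "y \<in> pts X" "a = q x" "b = q y" using r_pts[OF abc(1)]
          by blast
      obtain z where z: "z \<in> pts X" "c = q z" using r_pts[OF abc(2)] by blast
      show "(a, c) \<in> r" using abc transD[OF E(3)]
          unfolding x(3,4) z(2) r_iff[OF x(1,2)] r_iff[OF x(2) z(1)] r_iff[OF x(1) z(1)] by blast
    qed
    show "antisym r"
    proof (rule antisymI)
      fix a b assume ab: "(a, b) \<in> r" "(b, a) \<in> r"
      obtain x y where x: "x \<in> pts X" "y \<in> pts X" "a = q x" "b = q y" using r_pts[OF ab(1)] by blast
      show "a = b" using ab
          unfolding x(3,4) r_iff[OF x(1,2)] r_iff[OF x(2,1)] q_eq[OF x(1,2)] R_def by blast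
    qed
  qed
  ultimately have nach: "nachbin_space (T, r)" using comp
      by (simp add: nachbin_space_def ordered_space_def)
  moreover have "weight_less T K"
    by (rule weight_less_image[OF K nachbin_spaceD(1)[OF X(1)] q_cont q_closed top[symmetric]
        Hausdorff_imp_t1_space[OF haus] X(2)])
  moreover have "(q x, q y) \<in> r" if "(x, y) \<in> snd X" for x y
    using that E(2) E_pts r_iff by blast
  then have "q \<in> hom X (T, r)" using q_cont by (simp add: hom_def q_def)
  moreover have "E = {(x, y). x \<in> pts X \<and> y \<in> pts X \<and> (q x, q y) \<in> r}"
    using E_pts r_iff by blast
  ultimately show ?thesis using top by (intro that[of "(T, r)" q]) simp_all
qed

section \<open>Stone covers without increase of weight\<close>

lemma stone_spaceI:
  assumes "compact_space T"
    and "\<And>x y. \<lbrakk>x \<in> topspace T; y \<in> topspace T; x \<noteq> y\<rbrakk> \<Longrightarrow> \<exists>U. openin T U \<and> closedin T U \<and> x \<in> U \<and>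
        y \<notin> U"
  shows "stone_space (T, Id_on (topspace T))"
proof -
  have "partial_order_on (topspace T) (Id_on (topspace T))"
    by (auto simp: partial_order_on_def preorder_on_def refl_on_def trans_def antisym_def)
  moreover have "\<exists>U. openin T U \<and> closedin T U \<and> (\<forall>u\<in>U. \<forall>v. (u, v) \<in> Id_on (topspace T) \<longrightarrow> v \<in> U) \<and>
      x \<in> U \<and> y \<notin> U"
    if "x \<in> topspace T" "y \<in> topspace T" "(x, y) \<notin> Id_on (topspace T)" for x y
  proof -
    have "x \<noteq> y" using that by blast
    from assms(2)[OF that(1,2) this] show ?thesis by (auto simp: Id_on_iff)
  qed
  ultimately show ?thesis using assms(1)
      by (simp add: stone_space_def priestley_space_def ordered_space_def)
qed

text \<open>For a base \<open>\<B>\<close> of \<open>N\<close>, the cover consists of the pairs of a point \<open>x\<close> and a \<open>\<B>\<close>-indexed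
  family \<open>s\<close> of Booleans such that \<open>x\<close> lies in the closure of \<open>V\<close> if \<open>s V\<close> holds and outside
  \<open>V\<close> otherwise. The family determines \<open>x\<close>, because \<open>N\<close> is regular; so the cover is
  zero-dimensional, and its points can be coded by subsets of \<open>\<B>\<close>.\<close>

lemma stone_cover:
  fixes N :: "'k set ordspace"
  assumes K: "infinite (UNIV :: 'k set)" and N: "nachbin_space N" "small_space (fst N)"
  obtains X :: "'k set ordspace" and q
  where "stone_space X" "small_space (fst X)" "q \<in> hom X N" "q ` pts X = pts N"
proof -
  let ?T = "fst N"
  obtain \<B> where \<B>: "\<B> \<prec> (UNIV :: 'k set)" "\<And>V. V \<in> \<B> \<Longrightarrow> openin ?T V"
    "\<And>U x. openin ?T U \<Longrightarrow> x \<in> U \<Longrightarrow> \<exists>V\<in>\<B>. x \<in> V \<and> V \<subseteq> U"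
    using N(2)[unfolded small_space_eq] by (rule weight_lessE) blast
  obtain i :: "'k set set \<Rightarrow> 'k" where i: "inj_on i \<B>"
    using lesspoll_imp_lepoll[OF \<B>(1)] unfolding lepoll_def by blast
  \<comment> \<open>The Cantor cube over the base; its clopen coordinate sets will separate the
    points of the cover.\<close>
  define C where "C = product_topology (\<lambda>_. discrete_topology (UNIV :: bool set)) \<B>"
  define P where "P = prod_topology C ?T"
  have compP: "compact_space P"
    using nachbin_spaceD(1)[OF N(1)]
    by (simp add: P_def C_def compact_space_prod_topology compact_space_product_topology
        compact_space_discrete_topology)
  have topP: "topspace P = (\<B> \<rightarrow>\<^sub>E UNIV) \<times> pts N" by (simp add: P_def C_def)
  have snd_cont: "continuous_map P ?T snd" unfolding P_def by (rule continuous_map_snd)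
  have coord: "continuous_map P (discrete_topology UNIV) (\<lambda>t. fst t V)" if V: "V \<in> \<B>" for V
    using continuous_map_compose[OF continuous_map_fst[of C ?T]
        continuous_map_product_projection[OF V, of
            "\<lambda>_. discrete_topology (UNIV :: bool set)", folded C_def]]
    by (simp add: P_def o_def)
  have clopen: "openin P {t \<in> topspace P. fst t V = b}" "closedin P {t \<in> topspace P. fst t V = b}"
      if V: "V \<in> \<B>" for V b
    using openin_continuous_map_preimage[OF coord[OF V], of
        "{b}"] closedin_continuous_map_preimage[OF coord[OF V], of "{b}"]
    by simp_all
  define A where "A V = {t \<in> topspace P. (fst t V \<longrightarrow> snd t \<in> ?T closure_of V) \<and> (\<not> fst t V \<longrightarrow>
      snd t \<notin> V)}" for V
  have A: "closedin P (A V)" if V: "V \<in> \<B>" for V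
  proof -
    let ?c = "\<lambda>b. {t \<in> topspace P. fst t V = b}"
    have 1: "closedin P {t \<in> topspace P. snd t \<in> ?T closure_of V}"
      by (rule closedin_continuous_map_preimage[OF snd_cont closedin_closure_of])
    have 2: "closedin P {t \<in> topspace P. snd t \<in> pts N - V}"
      using \<B>(2)[OF V] by (intro closedin_continuous_map_preimage[OF snd_cont]) blast
    have "closedin P ((?c False \<union> {t \<in> topspace P. snd t \<in> ?T closure_of V}) \<inter>
        (?c True \<union> {t \<in> topspace P. snd t \<in> pts N - V}))"
      by (intro closedin_Int closedin_Un clopen[OF V] 1 2)
    also have "(?c False \<union> {t \<in> topspace P. snd t \<in> ?T closure_of V}) \<inter>
        (?c True \<union> {t \<in> topspace P. snd t \<in> pts N - V}) = A V"
      unfolding A_def topP by auto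
    finally show ?thesis .
  qed
  \<comment> \<open>Inserting \<open>topspace P\<close> keeps \<open>D\<close> inside the space also
    when the base is empty.\<close>
  define D where "D = \<Inter>(insert (topspace P) (A ` \<B>))"
  have D: "closedin P D" unfolding D_def using A by (intro closedin_Inter) auto
  have D_sub: "D \<subseteq> topspace P" unfolding D_def by blast
  have DA: "(fst t V \<longrightarrow> snd t \<in> ?T closure_of V) \<and> (\<not> fst t V \<longrightarrow> snd t \<notin> V)" if "t \<in> D" "V \<in> \<B>"
      for t V
    using that unfolding D_def A_def by blast
  define S where "S = subtopology P D"
  have topS: "topspace S = D" unfolding S_def using D_sub by auto
  have compS: "compact_space S" unfolding S_def
    using closedin_compact_space[OF compP D] by (simp add: compact_space_subtopology)
  have clopenS: "openin S {t \<in> D. fst t V = b}" "closedin S {t \<in> D. fst t V = b}" if V: "V \<in> \<B>"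
      for V b
  proof -
    have "{t \<in> D. fst t V = b} = D \<inter> {t \<in> topspace P. fst t V = b}" using D_sub by blast
    then show "openin S {t \<in> D. fst t V = b}" "closedin S {t \<in> D. fst t V = b}"
      unfolding S_def using clopen[OF V, of b]
          by (auto simp: openin_subtopology_Int2 closedin_subtopology_Int_closed)
  qed
  have sepD: "\<exists>V\<in>\<B>. fst t V \<noteq> fst u V" if t: "t \<in> D" and u: "u \<in> D" and ne: "t \<noteq> u" for t u
  proof (rule ccontr)
    assume eq: "\<not> (\<exists>V\<in>\<B>. fst t V \<noteq> fst u V)"
    have tu: "t \<in> topspace P" "u \<in> topspace P" using t u D_sub by blast+
    then have "fst t \<in> \<B> \<rightarrow>\<^sub>E UNIV" "fst u \<in> \<B> \<rightarrow>\<^sub>E UNIV" "snd t \<in> pts N" "snd u \<in> pts N"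
      unfolding topP by (simp_all add: mem_Times_iff)
    note f = this
    have "fst t = fst u" using f(1,2) eq by (intro PiE_ext[OF f(1,2)]) blast
    then have "snd t \<noteq> snd u" using ne by (simp add: prod_eq_iff)
    then obtain U W where UW: "openin ?T U" "openin ?T W" "snd t \<in> U" "snd u \<in> W" "disjnt U W"
      using nachbin_spaceD(2)[OF N(1)] f(3,4) unfolding Hausdorff_space_def by blast
    \<comment> \<open>Since \<open>snd t\<close> lies in \<open>V\<close>, the family of
      \<open>t\<close> must select \<open>V\<close>, and so does the equal family of
      \<open>u\<close>. Then \<open>snd u\<close> is in the closure of \<open>V\<close>, which its
      neighbourhood \<open>W\<close> excludes.\<close>
    obtain V where V: "V \<in> \<B>" "snd t \<in> V" "V \<subseteq> U" using \<B>(3)[OF UW(1,3)] by blast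
    have "fst u V" using DA[OF t V(1)] V(2) eq V(1) by blast
    then have "snd u \<in> ?T closure_of V" using DA[OF u V(1)] by blast
    then show False using UW(2,4,5) V(3) unfolding in_closure_of disjnt_def by blast
  qed
  \<comment> \<open>By \<open>sepD\<close> the Boolean family alone determines a point of
    \<open>D\<close>, so the set of codes of its selected basic sets is an injective label in
    \<open>'k set\<close>.\<close>
  define f where "f t = i ` {V \<in> \<B>. fst t V}" for t :: "('k set set \<Rightarrow> bool) \<times> 'k set"
  have f_inj: "inj_on f D"
  proof (rule inj_onI, rule ccontr)
    fix t u assume tu: "t \<in> D" "u \<in> D" "f t = f u" "t \<noteq> u"
    have "{V \<in> \<B>. fst t V} = {V \<in> \<B>. fst u V}"
      using tu(3) inj_on_image_eq_iff[OF i, of "{V \<in> \<B>. fst t V}" "{V \<in> \<B>. fst u V}"]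
          unfolding f_def by blast
    then show False using sepD[OF tu(1,2,4)] by blast
  qed
  obtain X :: "'k set topology" where X: "homeomorphic_map S X f" "topspace X = f ` D"
    using homeomorphic_copy[of f S] f_inj unfolding topS by blast
  obtain g where g: "homeomorphic_maps S X f g" using X(1) homeomorphic_map_maps by blast
  have g_cont: "continuous_map X S g" and f_cont: "continuous_map S X f"
    and fg: "\<And>a. a \<in> topspace X \<Longrightarrow> f (g a) = a" and gf: "\<And>t. t \<in> D \<Longrightarrow> g (f t) = t"
    using g unfolding homeomorphic_maps_def topS by blast+
  have gD: "g a \<in> D" if "a \<in> topspace X" for a
    using that continuous_map_funspace[OF g_cont] topS by blast
  have compX: "compact_space X"
    using compS homeomorphic_compact_space[OF homeomorphic_map_imp_homeomorphic_space[OF X(1)]]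
        by blast
  have stone: "stone_space (X, Id_on (topspace X))"
  proof (rule stone_spaceI[OF compX])
    fix a b assume ab: "a \<in> topspace X" "b \<in> topspace X" "a \<noteq> b"
    then have "g a \<noteq> g b" using fg by metis
    then obtain V where V: "V \<in> \<B>" "fst (g a) V \<noteq> fst (g b) V"
        using sepD[OF gD[OF ab(1)] gD[OF ab(2)]] by blast
    show "\<exists>U. openin X U \<and> closedin X U \<and> a \<in> U \<and> b \<notin> U"
      using openin_continuous_map_preimage[OF g_cont clopenS(1)[OF V(1), of "fst (g a) V"]]
        closedin_continuous_map_preimage[OF g_cont clopenS(2)[OF V(1), of
            "fst (g a) V"]] ab V(2) gD[OF ab(1)]
      by (intro exI[of _ "{x \<in> topspace X. g x \<in> {t \<in> D. fst t V = fst (g a) V}}"]) auto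
  qed
  have "priestley_space (X, Id_on (topspace X))" using stone by (simp add: stone_space_def)
  then have hausX: "Hausdorff_space X"
    using nachbin_spaceD(2)[OF priestley_imp_nachbin] by force
  have "weight_less S (UNIV :: 'k set)"
  \<comment> \<open>The coordinate sets are indexed by \<open>\<B>\<close> times the Booleans, which
    is still below \<open>'k\<close>.\<close>
  proof (rule weight_less_clopen_separation[OF K compS,
      where \<S> = "(\<lambda>(V, b). {t \<in> D. fst t V = b}) ` (\<B> \<times> UNIV)"])
    have "\<B> \<times> (UNIV :: bool set) \<prec> (UNIV :: 'k set)"
      by (intro lesspoll_Times K \<B>(1) finite_lesspoll_infinite) simp
    then show "(\<lambda>(V, b). {t \<in> D. fst t V = b}) ` (\<B> \<times> UNIV) \<prec> (UNIV :: 'k set)"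
      by (rule lesspoll_trans1[OF image_lepoll])
    show "openin S W \<and> closedin S W" if "W \<in> (\<lambda>(V, b). {t \<in> D. fst t V = b}) ` (\<B> \<times> UNIV)" for W
      using that clopenS by (auto simp: image_iff)
    fix t u assume tu: "t \<in> topspace S" "u \<in> topspace S" "t \<noteq> u"
    then obtain V where V: "V \<in> \<B>" "fst t V \<noteq> fst u V" using sepD unfolding topS by blast
    show "\<exists>W\<in>(\<lambda>(V, b). {t \<in> D. fst t V = b}) ` (\<B> \<times> UNIV). t \<in> W \<and> u \<notin> W"
      using V tu unfolding topS
          by (intro bexI[of _ "{t' \<in> D. fst t' V = fst t V}"] image_eqI[of _ _ "(V, fst t V)"]) auto
  qed
  then have "weight_less X (UNIV :: 'k set)"
    using weight_less_compact_Hausdorff_image[OF K compS f_cont _ hausX] X(2) topS by simp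
  then have small: "small_space X" unfolding small_space_eq .
  define q where "q = (\<lambda>a\<in>topspace X. snd (g a))"
  have "continuous_map S ?T snd"
    unfolding S_def by (rule continuous_map_from_subtopology[OF snd_cont])
  from continuous_map_compose[OF g_cont this] have "continuous_map X ?T q"
    by (rule continuous_map_eq) (simp add: q_def)
  moreover have qN: "q a \<in> pts N" if "a \<in> topspace X" for a
    using gD[OF that] D_sub that unfolding q_def topP by auto
  ultimately have "q \<in> hom (X, Id_on (topspace X)) N"
    using nachbin_spaceD(4)[OF N(1)] by (auto simp: hom_def q_def Id_on_iff)
  moreover have "q ` topspace X = pts N"
  proof (intro equalityI subsetI)
    show "x \<in> pts N" if "x \<in> q ` topspace X" for x using that qN by blast
    fix x assume x: "x \<in> pts N"
    \<comment> \<open>The family that selects exactly the basic sets containing \<open>x\<close>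
      meets all constraints, so \<open>x\<close> has a preimage.\<close>
    let ?t = "(\<lambda>V\<in>\<B>. x \<in> V, x)"
    have "x \<in> ?T closure_of V" if "V \<in> \<B>" "x \<in> V" for V
      using closure_of_subset[of V ?T] openin_subset[OF \<B>(2)[OF that(1)]] that(2) by blast
    then have t: "?t \<in> D" unfolding D_def A_def topP using x by auto
    have "f ?t \<in> topspace X" unfolding X(2) using t by (rule imageI)
    moreover have "q (f ?t) = x" using calculation gf[OF t] by (simp add: q_def)
    ultimately show "x \<in> q ` topspace X" by (metis imageI)
  qed
  ultimately show ?thesis using that[of "(X, Id_on (topspace X))" q] stone small by simp
qed

text \<open>The type \<open>'k set\<close> is infinite, so pairs of its elements inject into it and
  the product can be copied there. The copy inherits the weight bound as a continuous image of a
  compact space.\<close>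

lemma product_copy:
  fixes X Y :: "'k set ordspace"
  assumes K: "infinite (UNIV :: 'k set)" and X: "nachbin_space X" "small_space (fst X)"
    and Y: "nachbin_space Y" "small_space (fst Y)"
  obtains P :: "'k set topology" and p q
  where "compact_space P" "small_space P" "continuous_map P (fst X) p" "continuous_map P (fst Y) q"
    "p \<in> extensional (topspace P)" "q \<in> extensional (topspace P)"
    "(\<lambda>a. (p a, q a)) ` topspace P = pts X \<times> pts Y" "inj_on (\<lambda>a. (p a, q a)) (topspace P)"
proof -
  let ?S = "prod_topology (fst X) (fst Y)"
  have "infinite (UNIV :: 'k set set)" using K by (simp add: Finite_Set.finite_set)
  then obtain f :: "'k set \<times> 'k set \<Rightarrow> 'k set" where f: "inj f"
    using times_self_lepoll[of "UNIV :: 'k set set"] unfolding lepoll_def by auto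
  obtain P where P: "homeomorphic_map ?S P f" "topspace P = f ` topspace ?S"
    using homeomorphic_copy[of f ?S] inj_on_subset[OF f] by blast
  obtain g where g: "homeomorphic_maps ?S P f g" using P(1) homeomorphic_map_maps by blast
  have g_cont: "continuous_map P ?S g" and f_cont: "continuous_map ?S P f"
    and fg: "\<And>a. a \<in> topspace P \<Longrightarrow> f (g a) = a" and gf: "\<And>t. t \<in> topspace ?S \<Longrightarrow> g (f t) = t"
    using g unfolding homeomorphic_maps_def by blast+
  have hs: "?S homeomorphic_space P" by (rule homeomorphic_map_imp_homeomorphic_space[OF P(1)])
  have compS: "compact_space ?S"
    using nachbin_spaceD(1)[OF X(1)] nachbin_spaceD(1)[OF Y(1)]
        by (simp add: compact_space_prod_topology)
  then have compP: "compact_space P" using homeomorphic_compact_space[OF hs] by blast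
  have "Hausdorff_space ?S"
    using nachbin_spaceD(2)[OF X(1)] nachbin_spaceD(2)[OF Y(1)]
        by (simp add: Hausdorff_space_prod_topology)
  then have hausP: "Hausdorff_space P" using homeomorphic_Hausdorff_space[OF hs] by blast
  have "weight_less ?S (UNIV :: 'k set)"
    using weight_less_prod_topology[OF K] X(2) Y(2) unfolding small_space_eq .
  then have small: "small_space P"
    unfolding small_space_eq
    by (rule weight_less_compact_Hausdorff_image[OF K compS f_cont P(2)[symmetric] hausP])
  define p where "p = (\<lambda>a\<in>topspace P. fst (g a))"
  define q where "q = (\<lambda>a\<in>topspace P. snd (g a))"
  have "continuous_map P (fst X) p"
    using continuous_map_compose[OF g_cont continuous_map_fst] unfolding p_def
    by (rule continuous_map_eq) simp
  moreover have "continuous_map P (fst Y) q"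
    using continuous_map_compose[OF g_cont continuous_map_snd] unfolding q_def
    by (rule continuous_map_eq) simp
  moreover have "(\<lambda>a. (p a, q a)) ` topspace P = pts X \<times> pts Y"
  proof -
    have "(\<lambda>a. (p a, q a)) ` topspace P = g ` topspace P"
        by (rule image_cong) (simp_all add: p_def q_def)
    also have "\<dots> = (\<lambda>t. t) ` topspace ?S" unfolding P(2) image_image using gf
        by (intro image_cong) simp_all
    finally show ?thesis by simp
  qed
  moreover have "inj_on (\<lambda>a. (p a, q a)) (topspace P)"
  proof (rule inj_onI)
    fix a b assume ab: "a \<in> topspace P" "b \<in> topspace P" "(p a, q a) = (p b, q b)"
    then have "fst (g a) = fst (g b)" "snd (g a) = snd (g b)" by (simp_all add: p_def q_def)
    then have "g a = g b" by (rule prod_eqI)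
    then show "a = b" using fg[OF ab(1)] fg[OF ab(2)] by metis
  qed
  moreover have "p \<in> extensional (topspace P)" "q \<in> extensional (topspace P)"
    unfolding p_def q_def by (rule restrict_extensional)+
  ultimately show ?thesis using compP small by (intro that)
qed

text \<open>\<open>good\<close> stands for the Priestley or the Stone property. The hypothesis on
  initial structures gives closed subspaces and products at once, and the cover by a Stone space
  serves both cases since Stone spaces are \<open>good\<close>.\<close>

lemma nachbin_cover_small:
  fixes good :: "'k set ordspace \<Rightarrow> bool"
  assumes K: "infinite (UNIV :: 'k set)" and nach: "\<And>X. good X \<Longrightarrow> nachbin_space X"
    and stone: "\<And>X. stone_space X \<Longrightarrow> good X"
    and initial: "\<And>P X Y p q r. \<lbrakk>compact_space P; good X; good Y; continuous_map P (fst X) p;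
      continuous_map P (fst Y) q;
      \<And>a b. \<lbrakk>a \<in> topspace P; b \<in> topspace P; p a = p b; q a = q b\<rbrakk> \<Longrightarrow> a = b;
      r = {(a, b). a \<in> topspace P \<and> b \<in> topspace P \<and> (p a, p b) \<in> snd X \<and> (q a, q b) \<in> snd Y}\<rbrakk>
      \<Longrightarrow> good (P, r)"
  shows "nachbin_cover {(T, r). small_space T \<and> good (T, r)} {(T, r). small_space T \<and>
      nachbin_space (T, r)}"
    (is "nachbin_cover ?O ?N")
proof -
  have O_iff: "X \<in> ?O \<longleftrightarrow> small_space (fst X) \<and> good X"
      and N_iff: "X \<in> ?N \<longleftrightarrow> small_space (fst X) \<and> nachbin_space X" for X
    by (simp_all add: case_prod_unfold)
  interpret nachbin_category ?O
  proof
    show "nachbin_space X" if "X \<in> ?O" for X using that nach unfolding O_iff by blast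
    show "(subtopology (fst X) A, snd X \<inter> A \<times> A) \<in> ?O" if X: "X \<in> ?O" and A: "closedin (fst X) A"
        for X A
      unfolding O_iff fst_conv
    proof
      have g: "good X" "small_space (fst X)" using X unfolding O_iff by blast+
      show "small_space (subtopology (fst X) A)" using g(2) unfolding small_space_eq
          by (rule weight_less_subtopology)
      have top: "topspace (subtopology (fst X) A) = A" using closedin_subset[OF A] by auto
      have c: "continuous_map (subtopology (fst X) A) (fst X) (\<lambda>x. x)"
        by (rule continuous_map_from_subtopology) (simp add: continuous_map_id[unfolded id_def])
      have comp: "compact_space (subtopology (fst X) A)"
        using closedin_compact_space[OF nachbin_spaceD(1)[OF nach[OF g(1)]] A]
            by (simp add: compact_space_subtopology)
      show "good (subtopology (fst X) A, snd X \<inter> A \<times> A)"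
        by (rule initial[OF comp g(1) g(1) c c]) (use closedin_subset[OF A] in auto)
    qed
    fix X Y assume "X \<in> ?O" "Y \<in> ?O"
    then have X: "good X" "small_space (fst X)" and Y: "good Y" "small_space (fst Y)"
        unfolding O_iff by blast+
    obtain P :: "'k set topology" and p q where P: "compact_space P" "small_space P"
      and p: "continuous_map P (fst X) p" and q: "continuous_map P (fst Y) q"
      and ext: "p \<in> extensional (topspace P)" "q \<in> extensional (topspace P)"
      and surj: "(\<lambda>a. (p a, q a)) ` topspace P = pts X \<times> pts Y"
          and inj: "inj_on (\<lambda>a. (p a, q a)) (topspace P)"
      using product_copy[OF K nach[OF X(1)] X(2) nach[OF Y(1)] Y(2)] .
    define r where "r = {(a, b). a \<in> topspace P \<and> b \<in> topspace P \<and> (p a, p b) \<in> snd X \<and>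
        (q a, q b) \<in> snd Y}"
    have "a = b" if "a \<in> topspace P" "b \<in> topspace P" "p a = p b" "q a = q b" for a b
      by (rule inj_onD[OF inj _ that(1,2)]) (simp add: that)
    then have "good (P, r)" by (rule initial[OF P(1) X(1) Y(1) p q _ r_def])
    then have "(P, r) \<in> ?O" using P(2) unfolding O_iff by simp
    moreover have "p \<in> hom (P, r) X" "q \<in> hom (P, r) Y" using p q ext by (auto simp: hom_def r_def)
    moreover have "graph ((P, r), p, q) = pts X \<times> pts Y" using surj by (simp add: graph_simp)
    moreover have "\<forall>a\<in>pts (P, r). \<forall>b\<in>pts (P, r). (p a, p b) \<in> snd X \<and> (q a, q b) \<in> snd Y \<longrightarrow>
        (a, b) \<in> snd (P, r)"
      by (simp add: r_def)
    ultimately show "\<exists>P\<in>?O. \<exists>p\<in>hom P X. \<exists>q\<in>hom P Y. graph (P, p, q) = pts X \<times> pts Y \<and>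
      (\<forall>a\<in>pts P. \<forall>b\<in>pts P. (p a, p b) \<in> snd X \<and> (q a, q b) \<in> snd Y \<longrightarrow> (a, b) \<in> snd P)"
      by blast
  qed
  show ?thesis
  proof
    show "nachbin_space N" if "N \<in> ?N" for N using that unfolding N_iff by blast
    show "\<exists>X\<in>?O. \<exists>q\<in>hom X N. q ` pts X = pts N" if "N \<in> ?N" for N
    proof -
      have N: "nachbin_space N" "small_space (fst N)" using that unfolding N_iff by blast+
      obtain X q where "stone_space X" "small_space (fst X)" "q \<in> hom X N" "q ` pts X = pts N"
        using stone_cover[OF K N] .
      then show ?thesis using stone unfolding Bex_def O_iff by blast
    qed
    show "\<exists>N\<in>?N. \<exists>q\<in>hom X N. q ` pts X = pts N \<and> E = {(x, y). x \<in> pts X \<and> y \<in> pts X \<and>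
        (q x, q y) \<in> snd N}"
      if X: "X \<in> ?O" and E: "closed_preorder X E" for X E
    proof -
      have "good X" "small_space (fst X)" using X unfolding O_iff by blast+
      then have g: "nachbin_space X" "weight_less (fst X) (UNIV :: 'k set)"
        unfolding small_space_eq by (simp_all only: nach)
      obtain N q where N: "nachbin_space N" "weight_less (fst N) (UNIV :: 'k set)"
          and q: "q \<in> hom X N" "q ` pts X = pts N"
        "E = {(x, y). x \<in> pts X \<and> y \<in> pts X \<and> (q x, q y) \<in> snd N}"
        by (rule nachbin_quotient[OF K g E[unfolded closed_preorder_def, THEN conjunct1]
              E[unfolded closed_preorder_def, THEN conjunct2, THEN conjunct1]
              E[unfolded closed_preorder_def, THEN conjunct2, THEN conjunct2]])
      have "small_space (fst N)" unfolding small_space_eq by (rule N(2))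
      then have "N \<in> ?N" unfolding N_iff using N(1) by blast
      then show ?thesis by (intro bexI[of _ N] bexI[of _ q] conjI q)
    qed
  qed
qed

theorem corollary5p9:
  assumes "infinite (UNIV :: 'k set)"
  shows "pos_equivalent
           (ex_reg (Pries :: ('k set ordspace, 'k set \<Rightarrow> 'k set) poscat))
           (Nach :: ('k set ordspace, 'k set \<Rightarrow> 'k set) poscat)
         \<and> pos_equivalent
           (Nach :: ('k set ordspace, 'k set \<Rightarrow> 'k set) poscat)
           (ex_reg (Stone :: ('k set ordspace, 'k set \<Rightarrow> 'k set) poscat))"
proof -
  have stone_priestley: "stone_space X \<Longrightarrow> priestley_space X" for X :: "'k set ordspace"
    by (simp add: stone_space_def split: prod.splits)
  interpret P: nachbin_cover "{(T, r). small_space T \<and> priestley_space (T, r)}"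
      "{(T :: 'k set topology, r). small_space T \<and> nachbin_space (T, r)}"
  proof (rule nachbin_cover_small[where good = priestley_space])
    show "infinite (UNIV :: 'k set)" by (rule assms)
  qed (fact priestley_imp_nachbin stone_priestley priestley_initial)+
  interpret S: nachbin_cover "{(T, r). small_space T \<and> stone_space (T, r)}"
      "{(T :: 'k set topology, r). small_space T \<and> nachbin_space (T, r)}"
  proof (rule nachbin_cover_small[where good = stone_space])
    show "infinite (UNIV :: 'k set)" by (rule assms)
    show "nachbin_space X" if "stone_space X" for X :: "'k set ordspace"
      by (rule priestley_imp_nachbin[OF stone_priestley[OF that]])
  qed (assumption | fact stone_initial)+
  show ?thesis
    using pos_equivalent_sym[OF P.ordspace_category_equivalent_ex_reg]
        S.ordspace_category_equivalent_ex_reg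
    unfolding Pries_def Nach_def Stone_def by blast
qed

end
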